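(* Let $(M_1^{m_1},g_1)$ and $(M_2^{m_2},g_2)$, $m_1\ge1$, $m_2\ge0$, be Einstein manifolds satisfying $m_2(m_2-1)\,\mathrm{Sc}(g_1)=-m_1(m_1-1)\,\mathrm{Sc}(g_2)$. Then there is a conformally compact Einstein manifold (Poincaré–Einstein structure) $(M^{1,2},g^{1,2})$ with $$\mathrm{Ric}(g^{1,2})=-(m_1+m_2)\,g^{1,2}$$ and conformal infinity $(M_1\times M_2,[g_1\times g_2])$. Explicitly, with $\mu\in\mathbb R$ satisfying $2m_1(m_1-1)\mu=\mathrm{Sc}(g_1)$ and $2m_2(m_2-1)\mu=-\mathrm{Sc}(g_2)$, it is given by $M^{1,2}=M_1\times M_2\times I$, where $$I=\begin{cases}[0,\infty)&\text{if }\mu=0,\\ [0,\infty)&\text{if }\mu<0\text{ and }m_2=0,\\ [0,\infty)\setminus\{\sqrt{2/\mu}\}&\text{if }\mu>0\text{ and }m_2=0,\\ [0,\infty)\setminus\{\sqrt{2/|\mu|}\}&\text{otherwise,}\end{cases}$$ and, with $r$ the standard coordinate on $I$, $$g^{1,2}=r^{-2}\big(dr^2+(1-\mu r^2/2)^2g_1+(1+\mu r^2/2)^2g_2\big)$$ on the interior $\{r>0\}$.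
   Context: Metrics are pseudo-Riemannian of arbitrary signature. $\mathrm{Sc}$ is scalar curvature. An $m$-manifold $(M,g)$ is Einstein if $\mathrm{Ric}(g)=\frac1m\mathrm{Sc}(g)\,g$ with $\mathrm{Sc}(g)$ constant; 1-manifolds are Einstein with $\mathrm{Sc}=0$, and $m_2=0$ means $M_2$ is a point, with $\mathrm{Sc}(g_2)=0$ and the $g_2$ term absent. Let $\underline M$ be an $(n+1)$-manifold with boundary $M=\partial\underline M$; following the paper's convention, $\underline M$ is not assumed compact. A metric $g^+$ on the interior is conformally compact if $\underline g=r^2g^+$ extends to $\underline M$ as a metric that is non-degenerate up to the boundary, where $r$ is a non-negative defining function for $M$ (its zero set is $M$ and $dr\neq0$ along $M$). The conformal class on $M$ of the restriction of $\underline g$ to $TM$ is the conformal infinity. If moreover $\mathrm{Ric}(g^+)=-n\,g^+$ the structure is called conformally compact Einstein or Poincaré–Einstein. *)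

theory Defs
  imports "HOL-Analysis.Analysis"
begin

section \<open>Smooth functions of real coordinates\<close>

text \<open>Points of $R^n$ are the elements of \<open>topspace (Euclidean_space n)\<close>, i.e. functions
  \<open>x :: nat \<Rightarrow> real\<close> with \<open>x i = 0\<close> for \<open>i \<ge> n\<close>; coordinates are numbered from 0.\<close>

definition half_space :: "nat \<Rightarrow> (nat \<Rightarrow> real) set" where
  "half_space n = {x \<in> topspace (Euclidean_space n). 0 < n \<longrightarrow> 0 \<le> x (n - 1)}"

text \<open>The \<open>i\<close>-th partial derivative at \<open>x\<close> of a function defined on \<open>S\<close>. It is taken within \<open>S\<close>, so
  that at a boundary point of a half-space the derivative in the last direction is one-sided;
  for open \<open>S\<close> it is the usual one.\<close>

definition pd :: "(nat \<Rightarrow> real) set \<Rightarrow> nat \<Rightarrow> ((nat \<Rightarrow> real) \<Rightarrow> real) \<Rightarrow> (nat \<Rightarrow> real) \<Rightarrow> real" where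
  "pd S i f x = vector_derivative (\<lambda>t. f (x(i := t))) (at (x i) within {t. x(i := t) \<in> S})"

text \<open>\<open>Ck k n U f\<close>: \<open>f\<close> is of class $C^k$ on the open subset \<open>U\<close> of $R^n$.\<close>

primrec Ck :: "nat \<Rightarrow> nat \<Rightarrow> (nat \<Rightarrow> real) set \<Rightarrow> ((nat \<Rightarrow> real) \<Rightarrow> real) \<Rightarrow> bool" where
  "Ck 0 n U f \<longleftrightarrow> continuous_map (subtopology (Euclidean_space n) U) euclideanreal f"
| "Ck (Suc k) n U f \<longleftrightarrow>
     continuous_map (subtopology (Euclidean_space n) U) euclideanreal f \<and>
     (\<forall>i<n. (\<forall>x\<in>U. (\<lambda>t. f (x(i := t))) differentiable (at (x i))) \<and> Ck k n U (pd U i f))"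

text \<open>Smoothness on an arbitrary subset \<open>S\<close> of $R^n$ (in practice a relatively open subset of $R^n$ or
  of the half-space): local extendability to a $C^\infty$ function on an open subset of $R^n$.\<close>

definition smooth_on :: "nat \<Rightarrow> (nat \<Rightarrow> real) set \<Rightarrow> ((nat \<Rightarrow> real) \<Rightarrow> real) \<Rightarrow> bool" where
  "smooth_on n S f \<longleftrightarrow>
     (\<forall>x\<in>S. \<exists>U h. openin (Euclidean_space n) U \<and> x \<in> U \<and> (\<forall>k. Ck k n U h) \<and>
        (\<forall>y\<in>U \<inter> S. h y = f y))"


section \<open>Manifolds with and without boundary\<close>

text \<open>A chart is a pair of its domain and its coordinate map. The map is a total function, whose
  values outside the domain are irrelevant.\<close>

type_synonym 'a chart = "'a set \<times> ('a \<Rightarrow> nat \<Rightarrow> real)"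

record 'a atlas_space =
  mtop :: "'a topology"
  atlas :: "'a chart set"
  mdim :: nat

definition chart_inv :: "'a chart \<Rightarrow> (nat \<Rightarrow> real) \<Rightarrow> 'a" where
  "chart_inv c = inv_into (fst c) (snd c)"

definition manifold_modelled_on :: "(nat \<Rightarrow> real) set \<Rightarrow> 'a atlas_space \<Rightarrow> bool" where
  "manifold_modelled_on H M \<longleftrightarrow>
     Hausdorff_space (mtop M) \<and> second_countable (mtop M) \<and>
     (\<Union>c\<in>atlas M. fst c) = topspace (mtop M) \<and>
     (\<forall>c\<in>atlas M.
        openin (mtop M) (fst c) \<and>
        openin (subtopology (Euclidean_space (mdim M)) H) (snd c ` fst c) \<and>
        homeomorphic_map (subtopology (mtop M) (fst c))
          (subtopology (Euclidean_space (mdim M)) (snd c ` fst c)) (snd c)) \<and>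
     (\<forall>c\<in>atlas M. \<forall>c'\<in>atlas M. \<forall>i<mdim M.
        smooth_on (mdim M) (snd c ` (fst c \<inter> fst c')) (\<lambda>x. snd c' (chart_inv c x) i))"

definition manifold :: "'a atlas_space \<Rightarrow> bool" where
  "manifold M \<longleftrightarrow> manifold_modelled_on (topspace (Euclidean_space (mdim M))) M"

definition manifold_with_boundary :: "'a atlas_space \<Rightarrow> bool" where
  "manifold_with_boundary M \<longleftrightarrow> manifold_modelled_on (half_space (mdim M)) M"

definition boundary_points :: "'a atlas_space \<Rightarrow> 'a set" where
  "boundary_points N = {p. 0 < mdim N \<and> (\<exists>c\<in>atlas N. p \<in> fst c \<and> snd c p (mdim N - 1) = 0)}"

definition mfd_interior :: "'a atlas_space \<Rightarrow> 'a atlas_space" where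
  "mfd_interior N =
     \<lparr>mtop = subtopology (mtop N) (topspace (mtop N) - boundary_points N),
      atlas = (\<lambda>c. (fst c - boundary_points N, snd c)) ` atlas N,
      mdim = mdim N\<rparr>"

text \<open>On the boundary the last coordinate of every chart of \<open>N\<close> vanishes, so the restricted chart
  takes its values in $R^{n-1}$, where \<open>n = mdim N\<close>.\<close>

definition mfd_boundary :: "'a atlas_space \<Rightarrow> 'a atlas_space" where
  "mfd_boundary N =
     \<lparr>mtop = subtopology (mtop N) (boundary_points N),
      atlas = (\<lambda>c. (fst c \<inter> boundary_points N, snd c)) ` atlas N,
      mdim = mdim N - 1\<rparr>"

text \<open>Only products in which at most the second factor has a boundary are used; for these the
  last coordinate of a product chart is that of the second factor (if its dimension is positive).\<close>

definition prod_chart :: "nat \<Rightarrow> 'a chart \<Rightarrow> 'b chart \<Rightarrow> ('a \<times> 'b) chart" where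
  "prod_chart m c c' =
     (fst c \<times> fst c', \<lambda>(p, q) i. if i < m then snd c p i else snd c' q (i - m))"

definition prod_mfd :: "'a atlas_space \<Rightarrow> 'b atlas_space \<Rightarrow> ('a \<times> 'b) atlas_space" where
  "prod_mfd M N =
     \<lparr>mtop = prod_topology (mtop M) (mtop N),
      atlas = (\<lambda>(c, c'). prod_chart (mdim M) c c') ` (atlas M \<times> atlas N),
      mdim = mdim M + mdim N\<rparr>"

text \<open>The interval manifold, for \<open>J\<close> relatively open in $[0,\infty)$.\<close>

definition half_line_mfd :: "real set \<Rightarrow> real atlas_space" where
  "half_line_mfd J =
     \<lparr>mtop = subtopology euclideanreal J,
      atlas = {(J, \<lambda>r i. if i = 0 then r else 0)},
      mdim = 1\<rparr>"

definition smooth_fun :: "'a atlas_space \<Rightarrow> ('a \<Rightarrow> real) \<Rightarrow> bool" where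
  "smooth_fun M f \<longleftrightarrow>
     (\<forall>c\<in>atlas M. smooth_on (mdim M) (snd c ` fst c) (\<lambda>x. f (chart_inv c x)))"

definition smooth_map :: "'a atlas_space \<Rightarrow> 'b atlas_space \<Rightarrow> ('a \<Rightarrow> 'b) \<Rightarrow> bool" where
  "smooth_map M N F \<longleftrightarrow>
     continuous_map (mtop M) (mtop N) F \<and>
     (\<forall>c\<in>atlas M. \<forall>c'\<in>atlas N. \<forall>k<mdim N.
        smooth_on (mdim M) (snd c ` (fst c \<inter> F -` fst c'))
          (\<lambda>x. snd c' (F (chart_inv c x)) k))"

definition diffeo :: "'a atlas_space \<Rightarrow> 'b atlas_space \<Rightarrow> ('a \<Rightarrow> 'b) \<Rightarrow> bool" where
  "diffeo M N F \<longleftrightarrow>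
     smooth_map M N F \<and>
     (\<exists>G. smooth_map N M G \<and>
        (\<forall>p\<in>topspace (mtop M). G (F p) = p) \<and> (\<forall>q\<in>topspace (mtop N). F (G q) = q))"

text \<open>The \<open>i\<close>-th component of $df$ at \<open>p\<close> in the chart \<open>c\<close>.\<close>

definition differential :: "'a chart \<Rightarrow> ('a \<Rightarrow> real) \<Rightarrow> nat \<Rightarrow> 'a \<Rightarrow> real" where
  "differential c f i p = pd (snd c ` fst c) i (\<lambda>x. f (chart_inv c x)) (snd c p)"


section \<open>Pseudo-Riemannian metrics\<close>

text \<open>A covariant 2-tensor field is given by its components: \<open>g c i j p\<close> is the value at \<open>p\<close> of
  $g(\partial_i, \partial_j)$ for the coordinate fields of the chart \<open>c\<close>. The components in different
  charts are tied together by the transformation law.\<close>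

type_synonym 'a tensor2 = "'a chart \<Rightarrow> nat \<Rightarrow> nat \<Rightarrow> 'a \<Rightarrow> real"

definition smooth_tensor2 :: "'a atlas_space \<Rightarrow> 'a tensor2 \<Rightarrow> bool" where
  "smooth_tensor2 M g \<longleftrightarrow>
     (\<forall>c\<in>atlas M. \<forall>i<mdim M. \<forall>j<mdim M.
        smooth_on (mdim M) (snd c ` fst c) (\<lambda>x. g c i j (chart_inv c x))) \<and>
     (\<forall>c\<in>atlas M. \<forall>c'\<in>atlas M. \<forall>p\<in>fst c \<inter> fst c'. \<forall>i<mdim M. \<forall>j<mdim M.
        g c i j p =
          (\<Sum>k<mdim M. \<Sum>l<mdim M.
             differential c (\<lambda>q. snd c' q k) i p * differential c (\<lambda>q. snd c' q l) j p *
             g c' k l p))"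

definition pseudo_metric :: "'a atlas_space \<Rightarrow> 'a tensor2 \<Rightarrow> bool" where
  "pseudo_metric M g \<longleftrightarrow>
     smooth_tensor2 M g \<and>
     (\<forall>c\<in>atlas M. \<forall>p\<in>fst c.
        (\<forall>i<mdim M. \<forall>j<mdim M. g c i j p = g c j i p) \<and>
        (\<forall>v :: nat \<Rightarrow> real. (\<forall>j<mdim M. (\<Sum>i<mdim M. v i * g c i j p) = 0) \<longrightarrow>
           (\<forall>i<mdim M. v i = 0)))"

text \<open>The pullback $F^*g$ for a map $F : M \to N$. The components of \<open>g\<close> are taken in some chart
  around \<open>F p\<close>; by the transformation law the choice does not matter.\<close>

definition pullback :: "'b atlas_space \<Rightarrow> ('a \<Rightarrow> 'b) \<Rightarrow> 'b tensor2 \<Rightarrow> 'a tensor2" where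
  "pullback N F g c i j p =
     (let c' = (SOME c'. c' \<in> atlas N \<and> F p \<in> fst c') in
        \<Sum>k<mdim N. \<Sum>l<mdim N.
          differential c (\<lambda>q. snd c' (F q) k) i p * differential c (\<lambda>q. snd c' (F q) l) j p *
          g c' k l (F p))"

definition product_metric ::
  "'a atlas_space \<Rightarrow> 'a tensor2 \<Rightarrow> 'b atlas_space \<Rightarrow> 'b tensor2 \<Rightarrow> ('a \<times> 'b) tensor2" where
  "product_metric M g N h c i j p = pullback M fst g c i j p + pullback N snd h c i j p"

definition conformal_class :: "'a atlas_space \<Rightarrow> 'a tensor2 \<Rightarrow> 'a tensor2 set" where
  "conformal_class M g =
     {h. pseudo_metric M h \<and>
         (\<exists>w. smooth_fun M w \<and> (\<forall>p\<in>topspace (mtop M). 0 < w p) \<and>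
            (\<forall>c\<in>atlas M. \<forall>p\<in>fst c. \<forall>i<mdim M. \<forall>j<mdim M. h c i j p = w p * g c i j p))}"


section \<open>Curvature\<close>

definition matrix_inverse :: "nat \<Rightarrow> (nat \<Rightarrow> nat \<Rightarrow> real) \<Rightarrow> nat \<Rightarrow> nat \<Rightarrow> real" where
  "matrix_inverse n A =
     (SOME B. \<forall>i<n. \<forall>j<n. (\<Sum>k<n. A i k * B k j) = (if i = j then 1 else 0))"

text \<open>In the next three definitions \<open>G\<close> is the matrix of components of a metric, as a function of
  the coordinates in \<open>S\<close>: \<open>christoffel n S G k i j\<close> is $\Gamma^k_{ij}$, and
  \<open>riemann n S G l k i j\<close> is the component $R^l{}_{kij}$ in
  $R(\partial_i,\partial_j)\partial_k = R^l{}_{kij}\,\partial_l$, where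
  $R(X,Y) = [\nabla_X,\nabla_Y] - \nabla_{[X,Y]}$. The Ricci tensor is
  $\mathrm{Ric}(Y,Z) = \mathrm{tr}(X \mapsto R(X,Y)Z)$, which is positive on round spheres.\<close>

definition christoffel ::
  "nat \<Rightarrow> (nat \<Rightarrow> real) set \<Rightarrow> (nat \<Rightarrow> nat \<Rightarrow> (nat \<Rightarrow> real) \<Rightarrow> real) \<Rightarrow>
   nat \<Rightarrow> nat \<Rightarrow> nat \<Rightarrow> (nat \<Rightarrow> real) \<Rightarrow> real" where
  "christoffel n S G k i j x =
     (\<Sum>l<n. matrix_inverse n (\<lambda>a b. G a b x) k l *
        (pd S i (G j l) x + pd S j (G i l) x - pd S l (G i j) x)) / 2"

definition riemann ::
  "nat \<Rightarrow> (nat \<Rightarrow> real) set \<Rightarrow> (nat \<Rightarrow> nat \<Rightarrow> (nat \<Rightarrow> real) \<Rightarrow> real) \<Rightarrow>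
   nat \<Rightarrow> nat \<Rightarrow> nat \<Rightarrow> nat \<Rightarrow> (nat \<Rightarrow> real) \<Rightarrow> real" where
  "riemann n S G l k i j x =
     pd S i (christoffel n S G l j k) x - pd S j (christoffel n S G l i k) x +
     (\<Sum>m<n. christoffel n S G l i m x * christoffel n S G m j k x -
            christoffel n S G l j m x * christoffel n S G m i k x)"

definition ricci_coord ::
  "nat \<Rightarrow> (nat \<Rightarrow> real) set \<Rightarrow> (nat \<Rightarrow> nat \<Rightarrow> (nat \<Rightarrow> real) \<Rightarrow> real) \<Rightarrow>
   nat \<Rightarrow> nat \<Rightarrow> (nat \<Rightarrow> real) \<Rightarrow> real" where
  "ricci_coord n S G j k x = (\<Sum>i<n. riemann n S G i k i j x)"

definition ricci :: "'a atlas_space \<Rightarrow> 'a tensor2 \<Rightarrow> 'a tensor2" where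
  "ricci M g c i j p =
     ricci_coord (mdim M) (snd c ` fst c) (\<lambda>a b x. g c a b (chart_inv c x)) i j (snd c p)"

definition scalar_curvature :: "'a atlas_space \<Rightarrow> 'a tensor2 \<Rightarrow> 'a chart \<Rightarrow> 'a \<Rightarrow> real" where
  "scalar_curvature M g c p =
     (\<Sum>i<mdim M. \<Sum>j<mdim M.
        matrix_inverse (mdim M) (\<lambda>a b. g c a b p) i j * ricci M g c i j p)"

definition ricci_eq :: "'a atlas_space \<Rightarrow> 'a tensor2 \<Rightarrow> real \<Rightarrow> bool" where
  "ricci_eq M g t \<longleftrightarrow>
     (\<forall>c\<in>atlas M. \<forall>p\<in>fst c. \<forall>i<mdim M. \<forall>j<mdim M. ricci M g c i j p = t * g c i j p)"

text \<open>\<open>einstein M g s\<close>: the manifold $(M,g)$ is Einstein, and its constant scalar curvature is \<open>s\<close>.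
  In dimension 1, and on a point, the definition forces \<open>s = 0\<close> if \<open>M\<close> is non-empty.\<close>

definition einstein :: "'a atlas_space \<Rightarrow> 'a tensor2 \<Rightarrow> real \<Rightarrow> bool" where
  "einstein M g s \<longleftrightarrow>
     manifold M \<and> pseudo_metric M g \<and>
     (\<forall>c\<in>atlas M. \<forall>p\<in>fst c. scalar_curvature M g c p = s) \<and>
     ricci_eq M g (s / real (mdim M))"


section \<open>Poincare-Einstein structures\<close>

definition defining_function :: "'a atlas_space \<Rightarrow> ('a \<Rightarrow> real) \<Rightarrow> bool" where
  "defining_function N r \<longleftrightarrow>
     smooth_fun N r \<and>
     (\<forall>p\<in>topspace (mtop N). 0 \<le> r p \<and> (r p = 0 \<longleftrightarrow> p \<in> boundary_points N)) \<and>
     (\<forall>c\<in>atlas N. \<forall>p\<in>fst c \<inter> boundary_points N. \<exists>i<mdim N. differential c r i p \<noteq> 0)"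

text \<open>\<open>gbar\<close> is a metric on all of \<open>N\<close>, non-degenerate up to the boundary, that extends \<open>r\<^sup>2 gp\<close>.
  Restriction to the interior is pullback along the inclusion.\<close>

definition compactification :: "'a atlas_space \<Rightarrow> 'a tensor2 \<Rightarrow> ('a \<Rightarrow> real) \<Rightarrow> 'a tensor2 \<Rightarrow> bool" where
  "compactification N gp r gbar \<longleftrightarrow>
     defining_function N r \<and> pseudo_metric N gbar \<and>
     (\<forall>c\<in>atlas (mfd_interior N). \<forall>p\<in>fst c. \<forall>i<mdim N. \<forall>j<mdim N.
        pullback N (\<lambda>q. q) gbar c i j p = (r p)\<^sup>2 * gp c i j p)"

definition conformally_compact :: "'a atlas_space \<Rightarrow> 'a tensor2 \<Rightarrow> bool" where
  "conformally_compact N gp \<longleftrightarrow>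
     manifold_with_boundary N \<and> 0 < mdim N \<and> pseudo_metric (mfd_interior N) gp \<and>
     (\<exists>r gbar. compactification N gp r gbar)"

definition poincare_einstein :: "'a atlas_space \<Rightarrow> 'a tensor2 \<Rightarrow> bool" where
  "poincare_einstein N gp \<longleftrightarrow>
     conformally_compact N gp \<and> ricci_eq (mfd_interior N) gp (- (real (mdim N) - 1))"

text \<open>The conformal infinity of \<open>(N, gp)\<close> is \<open>(M, [h])\<close> under the identification \<open>F\<close> of \<open>M\<close> with the
  boundary of \<open>N\<close>: the restriction of \<open>gbar\<close> to the tangent bundle of the boundary corresponds under
  \<open>F\<close> to a metric conformal to \<open>h\<close>.\<close>

definition conformal_infinity ::
  "'a atlas_space \<Rightarrow> 'a tensor2 \<Rightarrow> 'b atlas_space \<Rightarrow> 'b tensor2 \<Rightarrow> ('b \<Rightarrow> 'a) \<Rightarrow> bool" where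
  "conformal_infinity N gp M h F \<longleftrightarrow>
     diffeo M (mfd_boundary N) F \<and>
     (\<exists>r gbar. compactification N gp r gbar \<and>
        pullback (mfd_boundary N) F (pullback N (\<lambda>q. q) gbar) \<in> conformal_class M h)"


section \<open>The explicit structure\<close>

definition interval_I :: "nat \<Rightarrow> real \<Rightarrow> real set" where
  "interval_I m2 \<mu> =
     (if \<mu> = 0 then {0..}
      else if \<mu> < 0 \<and> m2 = 0 then {0..}
      else if \<mu> > 0 \<and> m2 = 0 then {0..} - {sqrt (2 / \<mu>)}
      else {0..} - {sqrt (2 / \<bar>\<mu>\<bar>)})"

definition M12 :: "'a atlas_space \<Rightarrow> 'b atlas_space \<Rightarrow> real \<Rightarrow> ('a \<times> 'b \<times> real) atlas_space" where
  "M12 M1 M2 \<mu> = prod_mfd M1 (prod_mfd M2 (half_line_mfd (interval_I (mdim M2) \<mu>)))"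

text \<open>If \<open>M2\<close> is a point, then the pullback of \<open>g2\<close> is 0, being an empty sum.\<close>

definition g12 ::
  "'a atlas_space \<Rightarrow> 'a tensor2 \<Rightarrow> 'b atlas_space \<Rightarrow> 'b tensor2 \<Rightarrow> real \<Rightarrow>
   ('a \<times> 'b \<times> real) tensor2" where
  "g12 M1 g1 M2 g2 \<mu> c i j P =
     (let r = (\<lambda>(p, q, r). r) in
        (differential c r i P * differential c r j P
         + (1 - \<mu> * (r P)\<^sup>2 / 2)\<^sup>2 * pullback M1 fst g1 c i j P
         + (1 + \<mu> * (r P)\<^sup>2 / 2)\<^sup>2 * pullback M2 (\<lambda>(p, q, r). q) g2 c i j P) / (r P)\<^sup>2)"

end

theory Submission
  imports Defs "Jordan_Normal_Form.Determinant"
begin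

text \<open>In product charts the metric is the block matrix with blocks \<open>f(r) g1\<close>, \<open>h(r) g2\<close> and \<open>1 / r\<^sup>2\<close>.
  Its Christoffel symbols are those of \<open>g1\<close> and \<open>g2\<close> together with a few terms in \<open>f' / f\<close> and \<open>h' / h\<close>, so
  that the Ricci tensor consists of the blocks \<open>Ric(g1) + c1(r) g1\<close>, \<open>Ric(g2) + c2(r) g2\<close> and a multiple
  of \<open>dr\<^sup>2\<close>. Put \<open>F = 1 / r - \<mu> r / 2\<close> and \<open>H = 1 / r + \<mu> r / 2\<close>, whose squares are \<open>f\<close> and \<open>h\<close>. They satisfy
  \<open>r F' = - H\<close>, \<open>r H' = - F\<close> and \<open>H\<^sup>2 - F\<^sup>2 = 2 \<mu>\<close>, and the normalisation of \<open>\<mu>\<close> is exactly what turns each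
  block into \<open>-(m1 + m2)\<close> times that of the metric. After multiplication by \<open>r\<^sup>2\<close> the coefficients are
  polynomials in \<open>r\<close>, which gives the extension to the boundary.\<close>

section \<open>Smooth functions\<close>

text \<open>With \<open>r = exp (-t)\<close> the metric reads \<open>dt^2 + F^2 g1 + H^2 g2\<close>,
  where \<open>F = exp t - \<mu> exp (-t) / 2\<close> and
  \<open>H = exp t + \<mu> exp (-t) / 2\<close> are each other's derivative in \<open>t\<close>.
  Both therefore solve \<open>y'' = y\<close>, which settles the \<open>dr\<close> block. The
  \<open>g1\<close> block then asks for \<open>Ric(g1) = (m1 - 1) (H^2 - F^2) g1\<close> and the
  \<open>g2\<close> block for \<open>Ric(g2) = (m2 - 1) (F^2 - H^2) g2\<close>; this is where the
  constant \<open>2 \<mu>\<close> and the opposite signs of the two normalisations come from. Two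
  obstacles shape the proof. Tensors are given by components in charts and \<open>pullback\<close>
  chooses its target chart, so components are computed in product charts and for every possible
  target chart. Partial derivatives are one-sided at the boundary, where they are determined only if
  coordinate lines have no isolated points in the chart image. Interior and boundary are shown to be
  equal, as records, to products over \<open>J - {0}\<close> and over the point 0, so that one
  computation of pulled back components serves both.\<close>

abbreviation Rn :: "nat \<Rightarrow> (nat \<Rightarrow> real) set" where
  "Rn n \<equiv> {x. \<forall>i\<ge>n. x i = 0}"

text \<open>As a subspace of the function space it becomes accessible to
  \<open>continuous_on\<close> and to relative openness.\<close>

lemma Euclidean_space_eq: "Euclidean_space n = top_of_set (Rn n)"
  by (simp add: Euclidean_space_def euclidean_product_topology)

lemma openin_Rn_subset: "openin (Euclidean_space n) U \<Longrightarrow> U \<subseteq> Rn n"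
  using openin_subset topspace_Euclidean_space by blast

lemma continuous_map_Rn_subset:
  assumes "U \<subseteq> Rn n"
  shows "continuous_map (subtopology (Euclidean_space n) U) euclideanreal f \<longleftrightarrow> continuous_on U f"
  using assms by (simp add: Euclidean_space_eq subtopology_subtopology Int_absorb1)

lemma continuous_on_upd: "continuous_on A (\<lambda>t::real. (x::nat \<Rightarrow> real)(i := t))"
proof (rule continuous_on_coordinatewise_then_product)
  show "continuous_on A (\<lambda>t. (x(i := t)) j)" for j
    by (cases "j = i") auto
qed

lemma open_slice:
  assumes "openin (Euclidean_space n) U" "x \<in> U" "i < n"
  shows "open {t. x(i := t) \<in> U}"
proof -
  obtain T where T: "open T" "U = Rn n \<inter> T"
    using assms(1) by (auto simp: Euclidean_space_eq openin_open)
  have "{t. x(i := t) \<in> U} = (\<lambda>t. x(i := t)) -` T"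
    using assms T by auto
  then show ?thesis
    using open_vimage[OF T(1) continuous_on_upd] by simp
qed

text \<open>On open sets the derivative in \<open>pd\<close> is thus two-sided; the restriction to a
  slice matters only at boundary points.\<close>

lemma at_within_slice:
  assumes "openin (Euclidean_space n) U" "x \<in> U" "i < n"
  shows "at (x i) within {t. x(i := t) \<in> U} = at (x i)"
  by (rule at_within_open) (use assms open_slice in auto)

text \<open>No differentiability is needed: both sides are the same choice of a derivative, defined or not.\<close>

lemma vector_derivative_cong_on:
  assumes "x \<in> T" "\<And>t. t \<in> T \<Longrightarrow> f t = g t"
  shows "vector_derivative f (at x within T) = vector_derivative g (at x within T)"
proof -
  have "(f has_vector_derivative d) (at x within T) \<longleftrightarrow> (g has_vector_derivative d) (at x within T)" for d
    using assms by (metis has_vector_derivative_transform)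
  then show ?thesis
    by (simp add: vector_derivative_def)
qed

lemma pd_cong:
  assumes "x \<in> S" "\<And>y. y \<in> S \<Longrightarrow> f y = g y"
  shows "pd S i f x = pd S i g x"
  unfolding pd_def using assms by (intro vector_derivative_cong_on) auto

lemma pd_open:
  assumes "openin (Euclidean_space n) U" "x \<in> U" "i < n"
  shows "pd U i f x = vector_derivative (\<lambda>t. f (x(i := t))) (at (x i))"
  using at_within_slice[OF assms] by (simp add: pd_def)

lemma pd_eqI:
  assumes "openin (Euclidean_space n) U" "x \<in> U" "i < n"
    and "((\<lambda>t. f (x(i := t))) has_real_derivative d) (at (x i))"
  shows "pd U i f x = d"
  using assms(4) unfolding pd_open[OF assms(1-3)] has_real_derivative_iff_has_vector_derivative
  by (rule vector_derivative_at)

lemma pd_works: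
  assumes "openin (Euclidean_space n) U" "x \<in> U" "i < n"
    and "(\<lambda>t. f (x(i := t))) differentiable (at (x i))"
  shows "((\<lambda>t. f (x(i := t))) has_real_derivative pd U i f x) (at (x i))"
  using assms(4) unfolding pd_open[OF assms(1-3)] has_real_derivative_iff_has_vector_derivative
  by (simp add: vector_derivative_works)

lemma differentiable_slice_cong:
  assumes "openin (Euclidean_space n) U" "x \<in> U" "i < n" "\<And>y. y \<in> U \<Longrightarrow> f y = g y"
    and "(\<lambda>t. f (x(i := t))) differentiable (at (x i))"
  shows "(\<lambda>t. g (x(i := t))) differentiable (at (x i))"
proof -
  obtain D where "((\<lambda>t. f (x(i := t))) has_derivative D) (at (x i))"
    using assms(5) by (auto simp: differentiable_def)
  then have "((\<lambda>t. g (x(i := t))) has_derivative D) (at (x i))"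
    by (rule has_derivative_transform_within_open[OF _ open_slice[OF assms(1-3)]])
       (use assms in auto)
  then show ?thesis
    by (auto simp: differentiable_def)
qed

text \<open>Functions are total, so their values off \<open>U\<close> must not count; the induction
  works because \<open>pd U\<close> sees only values on \<open>U\<close>.\<close>

lemma Ck_cong:
  assumes "openin (Euclidean_space n) U" "\<And>y. y \<in> U \<Longrightarrow> f y = g y" "Ck k n U f"
  shows "Ck k n U g"
  using assms(2,3)
proof (induction k arbitrary: f g)
  case 0
  then show ?case
    using assms(1) openin_Rn_subset by (simp add: continuous_map_Rn_subset cong: continuous_on_cong)
next
  case (Suc k)
  have "Ck k n U (pd U i g)" if "i < n" for i
    using Suc.IH[of "pd U i f" "pd U i g"] Suc.prems that pd_cong[of _ U f g] by auto
  moreover have "continuous_map (subtopology (Euclidean_space n) U) euclideanreal g"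
    using Suc.prems assms(1) openin_Rn_subset
    by (simp add: continuous_map_Rn_subset cong: continuous_on_cong)
  ultimately show ?case
    using Suc.prems differentiable_slice_cong[OF assms(1), of _ _ f g] by auto
qed

lemma Ck_Suc_D: "Ck (Suc k) n U f \<Longrightarrow> Ck k n U f"
  by (induction k arbitrary: f) auto

lemma Ck_continuous: "Ck k n U f \<Longrightarrow> U \<subseteq> Rn n \<Longrightarrow> continuous_on U f"
  by (cases k) (auto simp: continuous_map_Rn_subset)

lemma Ck_Suc_iff:
  assumes "openin (Euclidean_space n) U"
  shows "Ck (Suc k) n U f \<longleftrightarrow> continuous_on U f \<and>
    (\<forall>i<n. (\<forall>x\<in>U. (\<lambda>t. f (x(i := t))) differentiable (at (x i))) \<and> Ck k n U (pd U i f))"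
  using openin_Rn_subset[OF assms] by (simp add: continuous_map_Rn_subset)

lemma Ck_mono:
  assumes "openin (Euclidean_space n) U" "openin (Euclidean_space n) V" "V \<subseteq> U" "Ck k n U f"
  shows "Ck k n V f"
  using assms(4)
proof (induction k arbitrary: f)
  case 0
  then show ?case
    using continuous_on_subset[OF Ck_continuous[OF 0 openin_Rn_subset[OF assms(1)]] assms(3)]
      openin_Rn_subset[OF assms(2)] by (simp add: continuous_map_Rn_subset)
next
  case (Suc k)
  have "Ck k n V (pd V i f)" if "i < n" for i
  proof (rule Ck_cong[OF assms(2)])
    show "Ck k n V (pd U i f)"
      using Suc that by auto
    \<comment> \<open>Both are two-sided derivatives, since \<open>U\<close> and \<open>V\<close>
      are open.\<close>
    show "pd U i f y = pd V i f y" if "y \<in> V" for y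
      using that assms \<open>i < n\<close> by (simp add: pd_open[where n=n] subset_iff)
  qed
  moreover have "continuous_on V f"
    using continuous_on_subset[OF Ck_continuous[OF Suc.prems openin_Rn_subset[OF assms(1)]] assms(3)] .
  moreover have "(\<lambda>t. f (x(i := t))) differentiable (at (x i))" if "i < n" "x \<in> V" for i x
    using Suc.prems assms(3) that by auto
  ultimately show ?case
    unfolding Ck_Suc_iff[OF assms(2)] by simp
qed

text \<open>Lets any closed form \<open>d\<close> of the partial derivatives stand in for
  \<open>pd\<close>, so that the inductions below handle explicit expressions.\<close>

lemma Ck_SucI:
  assumes "openin (Euclidean_space n) U" "continuous_on U f"
    and "\<And>i x. i < n \<Longrightarrow> x \<in> U \<Longrightarrow> ((\<lambda>t. f (x(i := t))) has_real_derivative d i x) (at (x i))"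
    and "\<And>i. i < n \<Longrightarrow> Ck k n U (d i)"
  shows "Ck (Suc k) n U f"
  unfolding Ck_Suc_iff[OF assms(1)]
proof (intro conjI allI impI ballI)
  fix i assume i: "i < n"
  show "(\<lambda>t. f (x(i := t))) differentiable at (x i)" if "x \<in> U" for x
    using assms(3)[OF i that] real_differentiable_def by blast
  show "Ck k n U (pd U i f)"
    using pd_eqI[OF assms(1) _ i assms(3)[OF i]] by (intro Ck_cong[OF assms(1) _ assms(4)[OF i]]) auto
qed fact

lemma Ck_has_derivative:
  assumes "openin (Euclidean_space n) U" "Ck (Suc k) n U f" "i < n" "x \<in> U"
  shows "((\<lambda>t. f (x(i := t))) has_real_derivative pd U i f x) (at (x i))"
  using assms by (intro pd_works) auto

section \<open>Arithmetic of \<open>Ck\<close> functions on open sets\<close>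

lemma Ck_const: "openin (Euclidean_space n) U \<Longrightarrow> Ck k n U (\<lambda>x. c)"
proof (induction k arbitrary: c)
  case (Suc k)
  then show ?case
    by (intro Ck_SucI[where d="\<lambda>i x. 0"]) auto
qed simp

lemma Ck_add:
  assumes "openin (Euclidean_space n) U" "Ck k n U f" "Ck k n U g"
  shows "Ck k n U (\<lambda>x. f x + g x)"
  using assms(2,3)
proof (induction k arbitrary: f g)
  case 0
  then show ?case
    by (simp add: continuous_map_add)
next
  case (Suc k)
  have U: "U \<subseteq> Rn n"
    by (rule openin_Rn_subset[OF assms(1)])
  show ?case
  proof (rule Ck_SucI[OF assms(1), where d="\<lambda>i x. pd U i f x + pd U i g x"])
    show "continuous_on U (\<lambda>x. f x + g x)"
      by (intro continuous_on_add Ck_continuous[OF Suc.prems(1) U] Ck_continuous[OF Suc.prems(2) U])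
    show "((\<lambda>t. f (x(i := t)) + g (x(i := t))) has_real_derivative pd U i f x + pd U i g x) (at (x i))"
      if "i < n" "x \<in> U" for i x
      by (intro DERIV_add Ck_has_derivative[OF assms(1) Suc.prems(1) that] Ck_has_derivative[OF assms(1) Suc.prems(2) that])
    show "Ck k n U (\<lambda>x. pd U i f x + pd U i g x)" if "i < n" for i
      by (rule Suc.IH) (use Suc.prems that in simp_all)
  qed
qed

text \<open>The product rule leaves one factor undifferentiated, so the induction runs over all
  pairs of functions and \<open>Ck_Suc_D\<close> lowers the order of that factor.\<close>

lemma Ck_mult:
  assumes "openin (Euclidean_space n) U" "Ck k n U f" "Ck k n U g"
  shows "Ck k n U (\<lambda>x. f x * g x)"
  using assms(2,3)
proof (induction k arbitrary: f g)
  case 0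
  then show ?case
    by (simp add: continuous_map_real_mult)
next
  case (Suc k)
  have U: "U \<subseteq> Rn n"
    by (rule openin_Rn_subset[OF assms(1)])
  show ?case
  proof (rule Ck_SucI[OF assms(1), where d="\<lambda>i x. pd U i f x * g x + pd U i g x * f x"])
    show "continuous_on U (\<lambda>x. f x * g x)"
      by (intro continuous_on_mult Ck_continuous[OF Suc.prems(1) U] Ck_continuous[OF Suc.prems(2) U])
    show "((\<lambda>t. f (x(i := t)) * g (x(i := t))) has_real_derivative pd U i f x * g x + pd U i g x * f x) (at (x i))"
      if "i < n" "x \<in> U" for i x
      by (rule DERIV_cong[OF DERIV_mult[OF Ck_has_derivative[OF assms(1) Suc.prems(1) that]
          Ck_has_derivative[OF assms(1) Suc.prems(2) that]]]) simp
    show "Ck k n U (\<lambda>x. pd U i f x * g x + pd U i g x * f x)" if "i < n" for i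
    proof (intro Ck_add[OF assms(1)] Suc.IH)
      show "Ck k n U (pd U i f)" "Ck k n U (pd U i g)"
        using Suc.prems that by simp_all
    qed (rule Ck_Suc_D[OF Suc.prems(1)] Ck_Suc_D[OF Suc.prems(2)])+
  qed
qed

text \<open>The derivative is \<open>- f' (1/f)^2\<close>, so the induction hypothesis for the same
  \<open>f\<close>, one order lower, covers the factors \<open>1/f\<close>.\<close>

lemma Ck_inverse:
  assumes "openin (Euclidean_space n) U" "Ck k n U f" "\<And>x. x \<in> U \<Longrightarrow> f x \<noteq> 0"
  shows "Ck k n U (\<lambda>x. inverse (f x))"
  using assms(2)
proof (induction k)
  case 0
  then show ?case
    using assms openin_Rn_subset[OF assms(1)] by (simp add: continuous_map_Rn_subset continuous_on_inverse)
next
  case (Suc k)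
  have U: "U \<subseteq> Rn n"
    by (rule openin_Rn_subset[OF assms(1)])
  let ?d = "\<lambda>i x. (-1) * (pd U i f x * (inverse (f x) * inverse (f x)))"
  show ?case
  proof (rule Ck_SucI[OF assms(1), where d="?d"])
    show "continuous_on U (\<lambda>x. inverse (f x))"
      using assms(3) by (intro continuous_on_inverse Ck_continuous[OF Suc.prems(1) U]) simp
    show "((\<lambda>t. inverse (f (x(i := t)))) has_real_derivative ?d i x) (at (x i))"
      if "i < n" "x \<in> U" for i x
      by (rule DERIV_cong[OF DERIV_inverse_fun[OF Ck_has_derivative[OF assms(1) Suc.prems that]]])
         (use assms(3)[OF that(2)] in \<open>simp_all add: power2_eq_square\<close>)
    show "Ck k n U (?d i)" if "i < n" for i
    proof (intro Ck_mult[OF assms(1)] Ck_const[OF assms(1)])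
      show "Ck k n U (pd U i f)"
        using Suc.prems that by simp
    qed (rule Suc.IH[OF Ck_Suc_D[OF Suc.prems]])+
  qed
qed

lemma Ck_coordinate: "openin (Euclidean_space n) U \<Longrightarrow> Ck k n U (\<lambda>x. x i)"
proof (cases k)
  case 0
  then show "openin (Euclidean_space n) U \<Longrightarrow> ?thesis"
    using openin_Rn_subset[of n U] continuous_on_subset[OF continuous_on_product_coordinates]
    by (simp add: continuous_map_Rn_subset)
next
  case (Suc k')
  assume U: "openin (Euclidean_space n) U"
  have "((\<lambda>t. (x(j := t)) i) has_real_derivative (if i = j then 1 else 0)) (at (x j))" for x j
    by (cases "i = j") (auto intro!: derivative_eq_intros)
  then show ?thesis
    unfolding Suc
    by (intro Ck_SucI[OF U, where d="\<lambda>j x. if i = j then 1 else 0"] Ck_const[OF U]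
       continuous_on_subset[OF continuous_on_product_coordinates]) simp_all
qed

section \<open>Smoothness on arbitrary sets through local extensions\<close>

abbreviation smooth_germ :: "nat \<Rightarrow> (nat \<Rightarrow> real) set \<Rightarrow> ((nat \<Rightarrow> real) \<Rightarrow> real) \<Rightarrow> (nat \<Rightarrow> real) \<Rightarrow> bool" where
  "smooth_germ n S f x \<equiv>
     \<exists>U h. openin (Euclidean_space n) U \<and> x \<in> U \<and> (\<forall>k. Ck k n U h) \<and> (\<forall>y\<in>U \<inter> S. h y = f y)"

lemma smooth_onI:
  assumes "\<And>x. x \<in> S \<Longrightarrow> smooth_germ n S f x"
  shows "smooth_on n S f"
  using assms by (simp add: smooth_on_def)

lemma smooth_onE:
  assumes "smooth_on n S f" "x \<in> S"
  obtains U h where "openin (Euclidean_space n) U" "x \<in> U" "\<And>k. Ck k n U h"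
    "\<And>y. y \<in> U \<Longrightarrow> y \<in> S \<Longrightarrow> h y = f y"
  using assms unfolding smooth_on_def by (metis Int_iff)

lemma smooth_germI:
  assumes "openin (Euclidean_space n) U" "x \<in> U" "\<And>k. Ck k n U h"
    "\<And>y. y \<in> U \<Longrightarrow> y \<in> S \<Longrightarrow> h y = f y"
  shows "smooth_germ n S f x"
  using assms by (intro exI[of _ U] exI[of _ h]) simp

lemma smooth_on_cong:
  assumes "smooth_on n S f" "\<And>x. x \<in> S \<Longrightarrow> f x = g x"
  shows "smooth_on n S g"
  using assms unfolding smooth_on_def by (metis Int_iff)

lemma smooth_on_global:
  assumes "S \<subseteq> Rn n" "\<And>k. Ck k n (topspace (Euclidean_space n)) f"
  shows "smooth_on n S f"
  by (intro smooth_onI smooth_germI[OF openin_topspace _ assms(2)])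
     (use assms(1) in \<open>auto simp: topspace_Euclidean_space\<close>)

lemma smooth_on_const: "S \<subseteq> Rn n \<Longrightarrow> smooth_on n S (\<lambda>x. c)"
  by (rule smooth_on_global) (simp_all add: Ck_const)

lemma smooth_on_coordinate: "S \<subseteq> Rn n \<Longrightarrow> smooth_on n S (\<lambda>x. x i)"
  by (rule smooth_on_global) (simp_all add: Ck_coordinate)

text \<open>Two local extensions are restricted to the intersection of their domains; sums and
  products are the instances.\<close>

lemma smooth_on_combine:
  assumes "\<And>U h h' k. openin (Euclidean_space n) U \<Longrightarrow> Ck k n U h \<Longrightarrow> Ck k n U h' \<Longrightarrow> Ck k n U (\<lambda>x. op2 (h x) (h' x))"
    and "smooth_on n S f" "smooth_on n S g"
  shows "smooth_on n S (\<lambda>x. op2 (f x) (g x))"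
proof (rule smooth_onI)
  fix x assume x: "x \<in> S"
  obtain U h where U: "openin (Euclidean_space n) U" "x \<in> U" "\<And>k. Ck k n U h"
      "\<And>y. y \<in> U \<Longrightarrow> y \<in> S \<Longrightarrow> h y = f y"
    by (rule smooth_onE[OF assms(2) x]) blast
  obtain V h' where V: "openin (Euclidean_space n) V" "x \<in> V" "\<And>k. Ck k n V h'"
      "\<And>y. y \<in> V \<Longrightarrow> y \<in> S \<Longrightarrow> h' y = g y"
    by (rule smooth_onE[OF assms(3) x]) blast
  have UV: "openin (Euclidean_space n) (U \<inter> V)"
    using U V by blast
  have "Ck k n (U \<inter> V) h" "Ck k n (U \<inter> V) h'" for k
    using Ck_mono[OF U(1) UV _ U(3)] Ck_mono[OF V(1) UV _ V(3)] by simp_all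
  then have ck: "Ck k n (U \<inter> V) (\<lambda>x. op2 (h x) (h' x))" for k
    by (rule assms(1)[OF UV])
  have eq: "op2 (h y) (h' y) = op2 (f y) (g y)" if "y \<in> U \<inter> V" "y \<in> S" for y
    using that U(4)[of y] V(4)[of y] by simp
  show "smooth_germ n S (\<lambda>y. op2 (f y) (g y)) x"
    by (rule smooth_germI[OF UV _ ck eq]) (use U(2) V(2) in simp_all)
qed

lemma smooth_on_add: "smooth_on n S f \<Longrightarrow> smooth_on n S g \<Longrightarrow> smooth_on n S (\<lambda>x. f x + g x)"
  by (rule smooth_on_combine[OF Ck_add])

lemma smooth_on_mult: "smooth_on n S f \<Longrightarrow> smooth_on n S g \<Longrightarrow> smooth_on n S (\<lambda>x. f x * g x)"
  by (rule smooth_on_combine[OF Ck_mult])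

lemma smooth_on_inverse:
  assumes "smooth_on n S f" "\<And>x. x \<in> S \<Longrightarrow> f x \<noteq> 0"
  shows "smooth_on n S (\<lambda>x. inverse (f x))"
proof (rule smooth_onI)
  fix x assume x: "x \<in> S"
  obtain U h where U: "openin (Euclidean_space n) U" "x \<in> U" "\<And>k. Ck k n U h"
      "\<And>y. y \<in> U \<Longrightarrow> y \<in> S \<Longrightarrow> h y = f y"
    by (rule smooth_onE[OF assms(1) x]) blast
  \<comment> \<open>The extension \<open>h\<close> may vanish off \<open>S\<close>, so its domain is
    shrunk to where it does not.\<close>
  define V where "V = {y \<in> U. h y \<noteq> 0}"
  have "openin (subtopology (Euclidean_space n) U) {y \<in> topspace (subtopology (Euclidean_space n) U). h y \<in> - {0}}"
    by (rule openin_continuous_map_preimage[where Y=euclideanreal]) (use U(3)[of 0] in auto)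
  moreover have "{y \<in> topspace (subtopology (Euclidean_space n) U). h y \<in> - {0}} = V"
    using openin_subset[OF U(1)] by (auto simp: V_def)
  ultimately have V: "openin (Euclidean_space n) V"
    using openin_trans_full U(1) by metis
  have "Ck k n V (\<lambda>x. inverse (h x))" for k
    by (rule Ck_inverse[OF V Ck_mono[OF U(1) V _ U(3)]]) (auto simp: V_def)
  then show "smooth_germ n S (\<lambda>y. inverse (f y)) x"
    using U(2,4) x V assms(2) by (intro smooth_germI[where U=V and h="\<lambda>x. inverse (h x)"]) (simp_all add: V_def)
qed

lemma smooth_on_power: "S \<subseteq> Rn n \<Longrightarrow> smooth_on n S f \<Longrightarrow> smooth_on n S (\<lambda>x. f x ^ k)"
  by (induction k) (auto intro: smooth_on_const smooth_on_mult)

text \<open>Links the smoothness of metric components to the derivative hypotheses of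
  \<open>warped_metric\<close>.\<close>

lemma smooth_on_has_derivative:
  assumes "openin (Euclidean_space n) S" "smooth_on n S f" "x \<in> S" "i < n"
  shows "((\<lambda>t. f (x(i := t))) has_real_derivative pd S i f x) (at (x i))"
proof -
  obtain U h where U: "openin (Euclidean_space n) U" "x \<in> U" "\<And>k. Ck k n U h"
      "\<And>y. y \<in> U \<Longrightarrow> y \<in> S \<Longrightarrow> h y = f y"
    by (rule smooth_onE[OF assms(2,3)]) blast
  have "(\<lambda>t. h (x(i := t))) differentiable (at (x i))"
    using U(2) U(3)[of "Suc 0"] assms(4) by auto
  then have "(\<lambda>t. f (x(i := t))) differentiable (at (x i))"
    by (rule differentiable_slice_cong[OF openin_Int[OF U(1) assms(1)], rotated -1])
       (use U(2,4) assms(3,4) in simp_all)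
  then show ?thesis
    using pd_works assms by blast
qed

subsection \<open>Splitting off the first coordinates\<close>

text \<open>Projections and gluing for \<open>R^m x R^n\<close> inside \<open>R^(m+n)\<close>.
  \<open>headc\<close> pads with zeros in order to land in \<open>Rn m\<close>; \<open>tailc\<close>
  shifts, and the zeros of \<open>Rn (m + n)\<close> put the result in \<open>Rn n\<close>.\<close>

definition headc :: "nat \<Rightarrow> (nat \<Rightarrow> real) \<Rightarrow> nat \<Rightarrow> real" where
  "headc m x = (\<lambda>i. if i < m then x i else 0)"

definition tailc :: "nat \<Rightarrow> (nat \<Rightarrow> real) \<Rightarrow> nat \<Rightarrow> real" where
  "tailc m x = (\<lambda>i. x (i + m))"

definition joinc :: "nat \<Rightarrow> (nat \<Rightarrow> real) \<Rightarrow> (nat \<Rightarrow> real) \<Rightarrow> nat \<Rightarrow> real" where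
  "joinc m y z = (\<lambda>i. if i < m then y i else z (i - m))"

lemma head_nth: "i < m \<Longrightarrow> headc m x i = x i"
  by (simp add: headc_def)

lemma tail_nth: "\<not> i < m \<Longrightarrow> tailc m x (i - m) = x i"
  by (simp add: tailc_def)

lemma tail_in_Rn: "x \<in> Rn (m + n) \<Longrightarrow> tailc m x \<in> Rn n"
  by (auto simp: tailc_def)

lemma head_join [simp]: "y \<in> Rn m \<Longrightarrow> headc m (joinc m y z) = y"
  by (auto simp: headc_def joinc_def)

lemma tail_join [simp]: "tailc m (joinc m y z) = z"
  by (auto simp: tailc_def joinc_def)

lemma join_head_tail [simp]: "joinc m (headc m x) (tailc m x) = x"
  by (auto simp: headc_def tailc_def joinc_def fun_eq_iff)

lemma join_in_Rn [simp]: "z \<in> Rn n \<Longrightarrow> joinc m y z \<in> Rn (m + n)"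
  by (auto simp: joinc_def)

lemma head_upd: "headc m (x(i := t)) = (if i < m then (headc m x)(i := t) else headc m x)"
  by (auto simp: headc_def)

lemma tail_upd: "tailc m (x(i := t)) = (if i < m then tailc m x else (tailc m x)(i - m := t))"
  by (auto simp: tailc_def fun_eq_iff)

lemma continuous_on_head: "continuous_on A (headc m)"
proof (rule continuous_on_coordinatewise_then_product)
  show "continuous_on A (\<lambda>x. headc m x i)" for i
    unfolding headc_def
    by (cases "i < m") (auto intro: continuous_on_subset[OF continuous_on_product_coordinates])
qed

lemma continuous_on_tail: "continuous_on A (tailc m)"
proof (rule continuous_on_coordinatewise_then_product)
  show "continuous_on A (\<lambda>x. tailc m x i)" for i
    unfolding tailc_def by (auto intro: continuous_on_subset[OF continuous_on_product_coordinates])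
qed

lemma openin_head:
  assumes "openin (Euclidean_space m) U"
  shows "openin (Euclidean_space (m + n)) {x \<in> Rn (m + n). headc m x \<in> U}"
proof -
  have "continuous_map (Euclidean_space (m + n)) (Euclidean_space m) (headc m)"
    by (simp add: Euclidean_space_eq continuous_on_head Pi_iff) (simp add: headc_def)
  from openin_continuous_map_preimage[OF this assms] show ?thesis
    by (simp add: topspace_Euclidean_space)
qed

lemma openin_tail:
  assumes "openin (Euclidean_space n) U"
  shows "openin (Euclidean_space (m + n)) {x \<in> Rn (m + n). tailc m x \<in> U}"
proof -
  have "continuous_map (Euclidean_space (m + n)) (Euclidean_space n) (tailc m)"
    using tail_in_Rn by (auto simp add: Euclidean_space_eq continuous_on_tail)
  from openin_continuous_map_preimage[OF this assms] show ?thesis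
    by (simp add: topspace_Euclidean_space)
qed

text \<open>A coordinate line is mapped to a coordinate line or to a point, so each partial
  derivative is one of \<open>f\<close> or zero and the induction closes.\<close>

lemma Ck_head:
  assumes "openin (Euclidean_space m) U" "Ck k m U f"
  shows "Ck k (m + n) {x \<in> Rn (m + n). headc m x \<in> U} (\<lambda>x. f (headc m x))"
  using assms(2)
proof (induction k arbitrary: f)
  case 0
  then show ?case
    using openin_Rn_subset[OF assms(1)] openin_Rn_subset[OF openin_head[OF assms(1), of n]]
    by (auto simp: continuous_map_Rn_subset intro!: continuous_on_compose2[OF _ continuous_on_head])
next
  case (Suc k)
  let ?V = "{x \<in> Rn (m + n). headc m x \<in> U}"
  have V: "openin (Euclidean_space (m + n)) ?V"
    by (rule openin_head[OF assms(1)])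
  show ?case
  proof (rule Ck_SucI[OF V, where d="\<lambda>i x. if i < m then pd U i f (headc m x) else 0"])
    show "continuous_on ?V (\<lambda>x. f (headc m x))"
      using Ck_continuous[OF Suc.prems] openin_Rn_subset[OF assms(1)]
      by (auto intro!: continuous_on_compose2[OF _ continuous_on_head])
    show "((\<lambda>t. f (headc m (x(i := t)))) has_real_derivative (if i < m then pd U i f (headc m x) else 0)) (at (x i))"
      if "i < m + n" "x \<in> ?V" for i x
    proof (cases "i < m")
      case True
      then show ?thesis
        using Ck_has_derivative[OF assms(1) Suc.prems True, of "headc m x"] that head_nth[OF True]
        by (simp only: head_upd if_True mem_Collect_eq)
    next
      case False
      then show ?thesis
        by (simp add: head_upd)
    qed
    show "Ck k (m + n) ?V (\<lambda>x. if i < m then pd U i f (headc m x) else 0)" for i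
      using Suc.IH[of "pd U i f"] Suc.prems Ck_const[OF V] by (cases "i < m") auto
  qed
qed

lemma Ck_tail:
  assumes "openin (Euclidean_space n) U" "Ck k n U f"
  shows "Ck k (m + n) {x \<in> Rn (m + n). tailc m x \<in> U} (\<lambda>x. f (tailc m x))"
  using assms(2)
proof (induction k arbitrary: f)
  case 0
  then show ?case
    using openin_Rn_subset[OF assms(1)] openin_Rn_subset[OF openin_tail[OF assms(1), of m]]
    by (auto simp: continuous_map_Rn_subset intro!: continuous_on_compose2[OF _ continuous_on_tail])
next
  case (Suc k)
  let ?V = "{x \<in> Rn (m + n). tailc m x \<in> U}"
  have V: "openin (Euclidean_space (m + n)) ?V"
    by (rule openin_tail[OF assms(1)])
  show ?case
  proof (rule Ck_SucI[OF V, where d="\<lambda>i x. if i < m then 0 else pd U (i - m) f (tailc m x)"])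
    show "continuous_on ?V (\<lambda>x. f (tailc m x))"
      using Ck_continuous[OF Suc.prems] openin_Rn_subset[OF assms(1)]
      by (auto intro!: continuous_on_compose2[OF _ continuous_on_tail])
    show "((\<lambda>t. f (tailc m (x(i := t)))) has_real_derivative (if i < m then 0 else pd U (i - m) f (tailc m x))) (at (x i))"
      if "i < m + n" "x \<in> ?V" for i x
    proof (cases "i < m")
      case False
      have im: "i - m < n"
        using False that by linarith
      show ?thesis
        using Ck_has_derivative[OF assms(1) Suc.prems im, of "tailc m x"] that tail_nth[OF False]
        by (simp only: tail_upd False if_False mem_Collect_eq)
    next
      case True
      then show ?thesis
        by (simp add: tail_upd)
    qed
    show "Ck k (m + n) ?V (\<lambda>x. if i < m then 0 else pd U (i - m) f (tailc m x))" if "i < m + n" for i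
      using Suc.IH[of "pd U (i - m) f"] Suc.prems Ck_const[OF V] that by (cases "i < m") auto
  qed
qed

lemma smooth_on_head:
  assumes "smooth_on m S f" "T \<subseteq> Rn (m + n)" "\<And>x. x \<in> T \<Longrightarrow> headc m x \<in> S"
  shows "smooth_on (m + n) T (\<lambda>x. f (headc m x))"
proof (rule smooth_onI)
  fix x assume x: "x \<in> T"
  obtain U h where U: "openin (Euclidean_space m) U" "headc m x \<in> U" "\<And>k. Ck k m U h"
      "\<And>y. y \<in> U \<Longrightarrow> y \<in> S \<Longrightarrow> h y = f y"
    by (rule smooth_onE[OF assms(1) assms(3)[OF x]]) blast
  show "smooth_germ (m + n) T (\<lambda>y. f (headc m y)) x"
    by (rule smooth_germI[OF openin_head[OF U(1)] _ Ck_head[OF U(1) U(3)]]) (use U(2,4) assms(2,3) x in auto)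
qed

lemma smooth_on_tail:
  assumes "smooth_on n S f" "T \<subseteq> Rn (m + n)" "\<And>x. x \<in> T \<Longrightarrow> tailc m x \<in> S"
  shows "smooth_on (m + n) T (\<lambda>x. f (tailc m x))"
proof (rule smooth_onI)
  fix x assume x: "x \<in> T"
  obtain U h where U: "openin (Euclidean_space n) U" "tailc m x \<in> U" "\<And>k. Ck k n U h"
      "\<And>y. y \<in> U \<Longrightarrow> y \<in> S \<Longrightarrow> h y = f y"
    by (rule smooth_onE[OF assms(1) assms(3)[OF x]]) blast
  show "smooth_germ (m + n) T (\<lambda>y. f (tailc m y)) x"
    by (rule smooth_germI[OF openin_tail[OF U(1)] _ Ck_tail[OF U(1) U(3)]]) (use U(2,4) assms(2,3) x in auto)
qed

section \<open>Block matrices and inverses\<close>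

text \<open>Sizes are left open: the same definition gives metrics, nested ones with three blocks,
  and Jacobians of product maps whose second block is rectangular.\<close>

definition block :: "nat \<Rightarrow> (nat \<Rightarrow> nat \<Rightarrow> real) \<Rightarrow> (nat \<Rightarrow> nat \<Rightarrow> real) \<Rightarrow> nat \<Rightarrow> nat \<Rightarrow> real" where
  "block m Y Z i j =
     (if i < m \<and> j < m then Y i j else if m \<le> i \<and> m \<le> j then Z (i - m) (j - m) else 0)"

definition nondegenerate :: "nat \<Rightarrow> (nat \<Rightarrow> nat \<Rightarrow> real) \<Rightarrow> bool" where
  "nondegenerate n A \<longleftrightarrow>
     (\<forall>v :: nat \<Rightarrow> real. (\<forall>j<n. (\<Sum>i<n. v i * A i j) = 0) \<longrightarrow> (\<forall>i<n. v i = 0))"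

definition symm_matrix :: "nat \<Rightarrow> (nat \<Rightarrow> nat \<Rightarrow> real) \<Rightarrow> bool" where
  "symm_matrix n A \<longleftrightarrow> (\<forall>i<n. \<forall>j<n. A i j = A j i)"

lemma symm_matrixD: "symm_matrix n A \<Longrightarrow> i < n \<Longrightarrow> j < n \<Longrightarrow> A i j = A j i"
  by (simp add: symm_matrix_def)

lemma sum_lessThan_add:
  fixes F :: "nat \<Rightarrow> 'c::comm_monoid_add"
  shows "(\<Sum>i<m + n. F i) = (\<Sum>i<m. F i) + (\<Sum>i<n. F (m + i))"
  by (induction n) (simp_all add: add.assoc)

lemma all_less_add: "(\<forall>i<m + n. P i) \<longleftrightarrow> (\<forall>i<m. P i) \<and> (\<forall>i<n. P (m + i))" for m n :: nat
proof (intro iffI conjI allI impI)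
  fix i assume *: "(\<forall>i<m. P i) \<and> (\<forall>i<n. P (m + i))" and i: "i < m + n"
  show "P i"
  proof (cases "i < m")
    case False
    then show ?thesis
      using *[THEN conjunct2, rule_format, of "i - m"] i by simp
  qed (use * in simp)
qed auto

lemma block_simps [simp]:
  "i < m \<Longrightarrow> j < m \<Longrightarrow> block m Y Z i j = Y i j"
  "i < m \<Longrightarrow> block m Y Z i (m + l) = 0"
  "j < m \<Longrightarrow> block m Y Z (m + k) j = 0"
  "block m Y Z (m + k) (m + l) = Z k l"
  by (simp_all add: block_def)

lemma nondegenerate_block:
  assumes "nondegenerate m Y" "nondegenerate n Z"
  shows "nondegenerate (m + n) (block m Y Z)"
  unfolding nondegenerate_def
proof (intro allI impI)
  fix v :: "nat \<Rightarrow> real" and i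
  assume v: "\<forall>j<m + n. (\<Sum>i<m + n. v i * block m Y Z i j) = 0" and i: "i < m + n"
  have "\<forall>j<m. (\<Sum>i<m. v i * Y i j) = 0" "\<forall>j<n. (\<Sum>i<n. v (m + i) * Z i j) = 0"
    using v by (simp_all add: all_less_add sum_lessThan_add)
  then have "\<forall>i<m. v i = 0" "\<forall>i<n. v (m + i) = 0"
    using assms[unfolded nondegenerate_def] by auto
  then have "\<forall>i<m + n. v i = 0"
    by (simp add: all_less_add)
  then show "v i = 0"
    using i by blast
qed

lemma nondegenerate_scale:
  assumes "nondegenerate n A" "c \<noteq> 0"
  shows "nondegenerate n (\<lambda>i j. c * A i j)"
proof -
  have "(\<Sum>i<n. v i * (c * A i j)) = c * (\<Sum>i<n. v i * A i j)" for v :: "nat \<Rightarrow> real" and j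
    by (simp add: sum_distrib_left algebra_simps)
  then show ?thesis
    using assms by (simp add: nondegenerate_def)
qed

lemma nondegenerate_cong:
  assumes "nondegenerate n A" "\<And>i j. i < n \<Longrightarrow> j < n \<Longrightarrow> A i j = B i j"
  shows "nondegenerate n B"
proof -
  have "(\<Sum>i<n. v i * A i j) = (\<Sum>i<n. v i * B i j)" if "j < n" for v :: "nat \<Rightarrow> real" and j
    using assms(2) that by (intro sum.cong) auto
  then show ?thesis
    using assms(1) by (simp add: nondegenerate_def cong: imp_cong)
qed

text \<open>\<open>matrix_inverse\<close> is a choice, so a right inverse must exist before anything
  is known about it. A singular matrix would have a kernel vector, which symmetry turns into the
  left null vector that nondegeneracy excludes.\<close>

lemma right_inverse_exists:
  assumes sym: "symm_matrix n A" and nd: "nondegenerate n A"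
  shows "\<exists>B. \<forall>i<n. \<forall>j<n. (\<Sum>k<n. A i k * B k j) = (if i = j then 1 else (0::real))"
proof -
  define M where "M = mat n n (\<lambda>(i, j). A i j)"
  have M: "M \<in> carrier_mat n n"
    by (simp add: M_def)
  have "det M \<noteq> 0"
  proof
    assume "det M = 0"
    then obtain v where v: "v \<in> carrier_vec n" "v \<noteq> 0\<^sub>v n" "M *\<^sub>v v = 0\<^sub>v n"
      using det_0_iff_vec_prod_zero_field[OF M] by blast
    have "(\<Sum>i<n. vec_index v i * A i j) = 0" if j: "j < n" for j
    proof -
      have "(\<Sum>i<n. vec_index v i * A i j) = (\<Sum>i<n. A j i * vec_index v i)"
        using j symm_matrixD[OF sym] by (intro sum.cong) auto
      also have "\<dots> = vec_index (M *\<^sub>v v) j"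
        using j v(1) by (simp add: M_def scalar_prod_def atLeast0LessThan)
      finally have "(\<Sum>i<n. vec_index v i * A i j) = vec_index (M *\<^sub>v v) j" .
      then show ?thesis
        using v(3) j by simp
    qed
    then have "\<forall>i<n. vec_index v i = 0"
      using nd by (simp add: nondegenerate_def)
    then have "v = 0\<^sub>v n"
      using v(1) by (intro eq_vecI) auto
    then show False
      using v(2) by simp
  qed
  then have "M \<in> Units (ring_mat TYPE(real) n ())"
    by (rule det_non_zero_imp_unit[OF M])
  then obtain B where B: "B \<in> carrier_mat n n" "M * B = 1\<^sub>m n"
    by (auto simp: Units_def ring_mat_def)
  have "(\<Sum>k<n. A i k * B $$ (k, j)) = (if i = j then 1 else 0)" if "i < n" "j < n" for i j
  proof -
    have "(\<Sum>k<n. A i k * B $$ (k, j)) = (M * B) $$ (i, j)"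
      using that B(1) by (simp add: M_def times_mat_def scalar_prod_def row_def col_def atLeast0LessThan)
    then show ?thesis
      using that B(2) by simp
  qed
  then show ?thesis
    by (intro exI[of _ "\<lambda>k j. B $$ (k, j)"]) simp
qed

lemma matrix_inverse_right:
  assumes "symm_matrix n A" "nondegenerate n A" "i < n" "j < n"
  shows "(\<Sum>k<n. A i k * matrix_inverse n A k j) = (if i = j then 1 else 0)"
  using someI_ex[OF right_inverse_exists[OF assms(1,2)]] assms(3,4)
  unfolding matrix_inverse_def by blast

text \<open>For symmetric \<open>A\<close> with right inverse \<open>B\<close> the transpose of
  \<open>B\<close> is a left inverse, and \<open>B^T = B^T (A B) = B\<close>.\<close>

lemma matrix_inverse_left:
  assumes "symm_matrix n A" "nondegenerate n A" "i < n" "j < n"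
  shows "(\<Sum>k<n. matrix_inverse n A i k * A k j) = (if i = j then 1 else 0)"
proof -
  define B where "B = matrix_inverse n A"
  note R = matrix_inverse_right[OF assms(1,2), folded B_def]
  have L: "(\<Sum>k<n. B k i * A k j) = (if i = j then 1 else 0)" if "i < n" "j < n" for i j
  proof -
    have "(\<Sum>k<n. B k i * A k j) = (\<Sum>k<n. A j k * B k i)"
      using that symm_matrixD[OF assms(1)] by (intro sum.cong) (auto simp: mult.commute)
    then show ?thesis
      using R[OF that(2,1)] by auto
  qed
  have "B j i = B i j" if "i < n" "j < n" for i j
  proof -
    have "B j i = (\<Sum>k<n. B k i * (if k = j then 1 else 0))"
      using that by (simp add: if_distrib cong: if_cong)
    also have "\<dots> = (\<Sum>k<n. B k i * (\<Sum>l<n. A k l * B l j))"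
      using that by (intro sum.cong) (simp_all add: R)
    also have "\<dots> = (\<Sum>l<n. (\<Sum>k<n. B k i * A k l) * B l j)"
      unfolding sum_distrib_left sum_distrib_right by (subst sum.swap) (simp add: mult.assoc)
    also have "\<dots> = (\<Sum>l<n. (if i = l then 1 else 0) * B l j)"
      using that by (intro sum.cong) (simp_all add: L)
    also have "\<dots> = B i j"
      using that by (simp add: if_distrib[of "\<lambda>x. x * _"] cong: if_cong)
    finally show ?thesis .
  qed
  then have "(\<Sum>k<n. B i k * A k j) = (\<Sum>k<n. B k i * A k j)"
    using assms(3) by (intro sum.cong) auto
  then show ?thesis
    using L[OF assms(3,4)] by (simp add: B_def)
qed

lemma matrix_inverse_solve:
  assumes "symm_matrix n A" "nondegenerate n A"
    and "\<And>l. l < n \<Longrightarrow> (\<Sum>k<n. A l k * c k) = d l" "i < n"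
  shows "(\<Sum>l<n. matrix_inverse n A i l * d l) = c i"
proof -
  have "(\<Sum>l<n. matrix_inverse n A i l * d l) = (\<Sum>l<n. matrix_inverse n A i l * (\<Sum>k<n. A l k * c k))"
    using assms(3) by (intro sum.cong) auto
  also have "\<dots> = (\<Sum>k<n. (\<Sum>l<n. matrix_inverse n A i l * A l k) * c k)"
    unfolding sum_distrib_left sum_distrib_right by (subst sum.swap) (simp add: mult.assoc)
  also have "\<dots> = (\<Sum>k<n. (if i = k then 1 else 0) * c k)"
    using assms(4) by (intro sum.cong refl) (simp only: matrix_inverse_left[OF assms(1,2)] lessThan_iff)
  also have "\<dots> = c i"
    using assms(4) by (simp add: if_distrib[of "\<lambda>x. x * _"] cong: if_cong)
  finally show ?thesis .
qed

section \<open>The Ricci tensor of a warped product in coordinates\<close>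

text \<open>Christoffel symbols of the first kind, with the index \<open>l\<close> lowered.\<close>

definition christoffel1 ::
  "(nat \<Rightarrow> real) set \<Rightarrow> (nat \<Rightarrow> nat \<Rightarrow> (nat \<Rightarrow> real) \<Rightarrow> real) \<Rightarrow>
   nat \<Rightarrow> nat \<Rightarrow> nat \<Rightarrow> (nat \<Rightarrow> real) \<Rightarrow> real" where
  "christoffel1 S G l i j x = (pd S i (G j l) x + pd S j (G i l) x - pd S l (G i j) x) / 2"

lemma christoffel_eq_christoffel1:
  "christoffel n S G k i j x = (\<Sum>l<n. matrix_inverse n (\<lambda>a b. G a b x) k l * christoffel1 S G l i j x)"
  by (simp add: christoffel_def christoffel1_def sum_divide_distrib)

text \<open>A guess for the Christoffel symbols is verified after lowering the index, which avoids inverting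
  the metric.\<close>

lemma christoffel_eqI:
  assumes "symm_matrix n (\<lambda>i j. G i j x)" "nondegenerate n (\<lambda>i j. G i j x)"
    and "\<And>l. l < n \<Longrightarrow> (\<Sum>k<n. G l k x * c k) = christoffel1 S G l i j x" "k < n"
  shows "christoffel n S G k i j x = c k"
  unfolding christoffel_eq_christoffel1 by (rule matrix_inverse_solve) (use assms in auto)

text \<open>The passage back: the symbols of the two factors are not explicit and are accessible
  through this identity.\<close>

lemma lower_christoffel:
  assumes "symm_matrix n (\<lambda>i j. G i j x)" "nondegenerate n (\<lambda>i j. G i j x)" "l < n"
  shows "(\<Sum>k<n. G l k x * christoffel n S G k i j x) = christoffel1 S G l i j x"
proof -
  let ?B = "matrix_inverse n (\<lambda>a b. G a b x)" and ?d = "\<lambda>l. christoffel1 S G l i j x"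
  have "(\<Sum>k<n. G l k x * (\<Sum>p<n. ?B k p * ?d p)) = (\<Sum>p<n. (\<Sum>k<n. G l k x * ?B k p) * ?d p)"
    unfolding sum_distrib_left sum_distrib_right by (subst sum.swap) (simp add: mult.assoc)
  also have "\<dots> = (\<Sum>p<n. (if l = p then 1 else 0) * ?d p)"
    using assms(3) by (intro sum.cong refl)
      (simp only: matrix_inverse_right[where A="\<lambda>i j. G i j x", OF assms(1,2)] lessThan_iff)
  also have "\<dots> = ?d l"
    using assms(3) by (simp add: if_distrib[of "\<lambda>x. x * _"] cong: if_cong)
  finally show ?thesis
    by (simp add: christoffel_eq_christoffel1)
qed

lemma christoffel_cong:
  assumes "\<And>i j y. i < n \<Longrightarrow> j < n \<Longrightarrow> y \<in> S \<Longrightarrow> G i j y = G' i j y" "x \<in> S" "i < n" "j < n"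
  shows "christoffel n S G k i j x = christoffel n S G' k i j x"
proof -
  \<comment> \<open>The predicate behind the choice reads only entries below \<open>n\<close>, so
    both matrices lead to the same chosen function and the upper index \<open>k\<close> may be
    arbitrary.\<close>
  have "(\<Sum>k<n. G i k x * B k j) = (\<Sum>k<n. G' i k x * B k j)" if "i < n" for i j and B :: "nat \<Rightarrow> nat \<Rightarrow> real"
    using assms(1)[OF _ _ assms(2)] that by (intro sum.cong) auto
  then have "matrix_inverse n (\<lambda>a b. G a b x) = matrix_inverse n (\<lambda>a b. G' a b x)"
    unfolding matrix_inverse_def by (simp cong: imp_cong)
  moreover have "pd S i (G a b) x = pd S i (G' a b) x" if "a < n" "b < n" for i a b
    using assms(1,2) that by (intro pd_cong) auto
  ultimately show ?thesis
    using assms(3,4) unfolding christoffel_def by (intro arg_cong2[where f="(/)"] sum.cong refl) auto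
qed

lemma christoffel_sym:
  assumes "\<And>i j y. i < n \<Longrightarrow> j < n \<Longrightarrow> y \<in> S \<Longrightarrow> G i j y = G j i y" "x \<in> S" "i < n" "j < n"
  shows "christoffel n S G k i j x = christoffel n S G k j i x"
proof -
  have "pd S l (G i j) x = pd S l (G j i) x" for l
    using assms by (intro pd_cong) auto
  then show ?thesis
    by (simp add: christoffel_def add.commute)
qed

lemma ricci_coord_alt:
  "ricci_coord n S G j k x =
     (\<Sum>i<n. pd S i (christoffel n S G i j k) x) - (\<Sum>i<n. pd S j (christoffel n S G i i k) x) +
     (\<Sum>i<n. \<Sum>m<n. christoffel n S G i i m x * christoffel n S G m j k x) -
     (\<Sum>i<n. \<Sum>m<n. christoffel n S G i j m x * christoffel n S G m i k x)"
  by (simp add: ricci_coord_def riemann_def sum.distrib sum_subtractf)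

lemma ricci_coord_cong:
  assumes "\<And>i j y. i < n \<Longrightarrow> j < n \<Longrightarrow> y \<in> S \<Longrightarrow> G i j y = G' i j y" "x \<in> S" "j < n" "k < n"
  shows "ricci_coord n S G j k x = ricci_coord n S G' j k x"
proof -
  have C: "christoffel n S G l a b y = christoffel n S G' l a b y" if "y \<in> S" "a < n" "b < n" for l a b y
    using assms(1) that by (rule christoffel_cong)
  have "pd S i (christoffel n S G l a b) x = pd S i (christoffel n S G' l a b) x" if "a < n" "b < n" for i l a b
    using C that assms(2) by (intro pd_cong) auto
  then show ?thesis
    using assms(2-4) C[OF assms(2)] unfolding ricci_coord_alt
    by (intro arg_cong2[where f="(+)"] arg_cong2[where f="(-)"] sum.cong refl arg_cong2[where f="(*)"]) auto
qed

text \<open>The metric is \<open>f(r) A + h(r) B + e(r) dr\<^sup>2\<close>, where \<open>r\<close> is the last coordinate. The functions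
  \<open>u\<close>, \<open>v\<close>, \<open>w\<close> are half the logarithmic derivatives of \<open>f\<close>, \<open>h\<close>, \<open>e\<close>, and \<open>\<phi> A\<close>, \<open>\<psi> B\<close> are the
  Christoffel symbols with upper index \<open>r\<close>.\<close>

locale warped_metric =
  fixes m1 m2 :: nat and S1 S2 :: "(nat \<Rightarrow> real) set" and K :: "real set"
    and A B :: "nat \<Rightarrow> nat \<Rightarrow> (nat \<Rightarrow> real) \<Rightarrow> real"
    and f h e u v w \<phi> \<psi> u' v' \<phi>' \<psi>' :: "real \<Rightarrow> real"
  assumes S1: "openin (Euclidean_space m1) S1" and S2: "openin (Euclidean_space m2) S2"
    and K: "open K"
    and A_sym: "\<And>x. x \<in> S1 \<Longrightarrow> symm_matrix m1 (\<lambda>i j. A i j x)"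
    and B_sym: "\<And>x. x \<in> S2 \<Longrightarrow> symm_matrix m2 (\<lambda>i j. B i j x)"
    and A_nd: "\<And>x. x \<in> S1 \<Longrightarrow> nondegenerate m1 (\<lambda>i j. A i j x)"
    and B_nd: "\<And>x. x \<in> S2 \<Longrightarrow> nondegenerate m2 (\<lambda>i j. B i j x)"
    and A_deriv: "\<And>x i a b. x \<in> S1 \<Longrightarrow> i < m1 \<Longrightarrow> a < m1 \<Longrightarrow> b < m1 \<Longrightarrow>
      ((\<lambda>t. A a b (x(i := t))) has_real_derivative pd S1 i (A a b) x) (at (x i))"
    and B_deriv: "\<And>x i a b. x \<in> S2 \<Longrightarrow> i < m2 \<Longrightarrow> a < m2 \<Longrightarrow> b < m2 \<Longrightarrow>
      ((\<lambda>t. B a b (x(i := t))) has_real_derivative pd S2 i (B a b) x) (at (x i))"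
    and nonzero: "\<And>s. s \<in> K \<Longrightarrow> f s \<noteq> 0" "\<And>s. s \<in> K \<Longrightarrow> h s \<noteq> 0" "\<And>s. s \<in> K \<Longrightarrow> e s \<noteq> 0"
    and f_deriv: "\<And>s. s \<in> K \<Longrightarrow> (f has_real_derivative 2 * u s * f s) (at s)"
    and h_deriv: "\<And>s. s \<in> K \<Longrightarrow> (h has_real_derivative 2 * v s * h s) (at s)"
    and e_deriv: "\<And>s. s \<in> K \<Longrightarrow> (e has_real_derivative 2 * w s * e s) (at s)"
    and phi: "\<And>s. s \<in> K \<Longrightarrow> \<phi> s * e s = - (u s * f s)"
    and psi: "\<And>s. s \<in> K \<Longrightarrow> \<psi> s * e s = - (v s * h s)"
    and u_deriv: "\<And>s. s \<in> K \<Longrightarrow> (u has_real_derivative u' s) (at s)"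
    and v_deriv: "\<And>s. s \<in> K \<Longrightarrow> (v has_real_derivative v' s) (at s)"
    and phi_deriv: "\<And>s. s \<in> K \<Longrightarrow> (\<phi> has_real_derivative \<phi>' s) (at s)"
    and psi_deriv: "\<And>s. s \<in> K \<Longrightarrow> (\<psi> has_real_derivative \<psi>' s) (at s)"
begin

abbreviation "n \<equiv> m1 + (m2 + 1)"

definition "p1 x = headc m1 x"
definition "p2 x = headc m2 (tailc m1 x)"
definition "S = {x \<in> Rn n. p1 x \<in> S1 \<and> p2 x \<in> S2 \<and> x (m1 + m2) \<in> K}"

definition G :: "nat \<Rightarrow> nat \<Rightarrow> (nat \<Rightarrow> real) \<Rightarrow> real" where
  "G i j x = block m1 (\<lambda>i j. f (x (m1 + m2)) * A i j (p1 x))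
     (block m2 (\<lambda>i j. h (x (m1 + m2)) * B i j (p2 x)) (\<lambda>i j. e (x (m1 + m2)))) i j"

abbreviation "\<Gamma>1 \<equiv> christoffel m1 S1 A"
abbreviation "\<Gamma>2 \<equiv> christoffel m2 S2 B"

lemma all_n: "(\<forall>i<n. P i) \<longleftrightarrow> (\<forall>i<m1. P i) \<and> (\<forall>b<m2. P (m1 + b)) \<and> P (m1 + m2)"
  by (simp only: all_less_add) auto

lemma sum_n: "(\<Sum>i<n. F i) = (\<Sum>i<m1. F i) + (\<Sum>i<m2. F (m1 + i)) + F (m1 + m2)" for F :: "nat \<Rightarrow> real"
  by (simp add: sum_lessThan_add)

lemma p1_upd: "p1 (x(i := t)) = (if i < m1 then (p1 x)(i := t) else p1 x)"
  by (simp add: p1_def head_upd)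

lemma p2_upd:
  "i < m1 \<Longrightarrow> p2 (x(i := t)) = p2 x"
  "b < m2 \<Longrightarrow> p2 (x(m1 + b := t)) = (p2 x)(b := t)"
  "p2 (x(m1 + m2 := t)) = p2 x"
  by (simp_all add: p2_def tail_upd head_upd)

lemma p1_nth: "i < m1 \<Longrightarrow> p1 x i = x i"
  by (simp add: p1_def headc_def)

lemma p2_nth: "b < m2 \<Longrightarrow> p2 x b = x (m1 + b)"
  by (simp add: p2_def headc_def tailc_def add.commute)

lemma S_D: "x \<in> S \<Longrightarrow> p1 x \<in> S1" "x \<in> S \<Longrightarrow> p2 x \<in> S2" "x \<in> S \<Longrightarrow> x (m1 + m2) \<in> K" "x \<in> S \<Longrightarrow> x \<in> Rn n"
  by (auto simp: S_def)

lemma open_S: "openin (Euclidean_space n) S"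
proof -
  have "openin (Euclidean_space (m2 + 1)) {x \<in> Rn (m2 + 1). headc m2 x \<in> S2}"
    by (rule openin_head[OF S2])
  from openin_tail[OF this, of m1]
  have 2: "openin (Euclidean_space n) {x \<in> Rn n. p2 x \<in> S2}"
    by (rule back_subst[where P="openin _"]) (auto simp: p2_def tailc_def)
  have "continuous_map (Euclidean_space n) euclideanreal (\<lambda>x. x (m1 + m2))"
    using continuous_on_subset[OF continuous_on_product_coordinates]
    by (simp add: continuous_map_Euclidean_space_iff)
  from openin_continuous_map_preimage[OF this] K
  have 3: "openin (Euclidean_space n) {x \<in> Rn n. x (m1 + m2) \<in> K}"
    by (simp add: topspace_Euclidean_space)
  have "S = {x \<in> Rn n. headc m1 x \<in> S1} \<inter> {x \<in> Rn n. p2 x \<in> S2} \<inter> {x \<in> Rn n. x (m1 + m2) \<in> K}"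
    by (auto simp: S_def p1_def)
  then show ?thesis
    using openin_Int[OF openin_Int[OF openin_head[OF S1] 2] 3] by simp
qed

text \<open>The slices of \<open>S\<close> and \<open>S1\<close> are the same set, so both sides are
  the same choice of a derivative. This applies to the Christoffel symbols of \<open>A\<close>
  without any differentiability at hand.\<close>

lemma pd_p1:
  assumes "x \<in> S" "i < m1"
  shows "pd S i (\<lambda>x. F (p1 x)) x = pd S1 i F (p1 x)"
proof -
  have "{t. x(i := t) \<in> S} = {t. (p1 x)(i := t) \<in> S1}"
    using assms by (auto simp: S_def p1_upd p2_upd)
  then show ?thesis
    using assms by (simp add: pd_def p1_upd p1_nth)
qed

lemma pd_p2:
  assumes "x \<in> S" "b < m2"
  shows "pd S (m1 + b) (\<lambda>x. F (p2 x)) x = pd S2 b F (p2 x)"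
proof -
  have "{t. x(m1 + b := t) \<in> S} = {t. (p2 x)(b := t) \<in> S2}"
    using assms by (auto simp: S_def p1_upd p2_upd)
  then show ?thesis
    using assms by (simp add: pd_def p2_upd p2_nth)
qed

lemma pd_eq: "x \<in> S \<Longrightarrow> i < n \<Longrightarrow> ((\<lambda>t. F (x(i := t))) has_real_derivative d) (at (x i)) \<Longrightarrow> pd S i F x = d"
  using pd_eqI[OF open_S] by blast

lemma pd_indep: "x \<in> S \<Longrightarrow> i < n \<Longrightarrow> (\<And>t. F (x(i := t)) = F x) \<Longrightarrow> pd S i F x = 0"
  by (rule pd_eq) simp_all

text \<open>Intended value of \<open>\<partial>_i G_jl\<close>, according to the factors to which
  the indices belong.\<close>

definition "dG i j l x =
  (if j < m1 \<and> l < m1 then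
     (if i < m1 then f (x (m1 + m2)) * pd S1 i (A j l) (p1 x)
      else if i = m1 + m2 then 2 * u (x (m1 + m2)) * f (x (m1 + m2)) * A j l (p1 x) else 0)
   else if m1 \<le> j \<and> j < m1 + m2 \<and> m1 \<le> l \<and> l < m1 + m2 then
     (if i < m1 then 0 else if i < m1 + m2 then h (x (m1 + m2)) * pd S2 (i - m1) (B (j - m1) (l - m1)) (p2 x)
      else 2 * v (x (m1 + m2)) * h (x (m1 + m2)) * B (j - m1) (l - m1) (p2 x))
   else if j = m1 + m2 \<and> l = m1 + m2 \<and> i = m1 + m2 then 2 * w (x (m1 + m2)) * e (x (m1 + m2)) else 0)"

lemma G_simps [simp]:
  "a < m1 \<Longrightarrow> b < m1 \<Longrightarrow> G a b x = f (x (m1 + m2)) * A a b (p1 x)"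
  "a < m1 \<Longrightarrow> G a (m1 + l) x = 0"
  "b < m1 \<Longrightarrow> G (m1 + k) b x = 0"
  "c < m2 \<Longrightarrow> d < m2 \<Longrightarrow> G (m1 + c) (m1 + d) x = h (x (m1 + m2)) * B c d (p2 x)"
  "c < m2 \<Longrightarrow> G (m1 + c) (m1 + m2) x = 0"
  "c < m2 \<Longrightarrow> G (m1 + m2) (m1 + c) x = 0"
  "G (m1 + m2) (m1 + m2) x = e (x (m1 + m2))"
  by (simp_all add: G_def) (simp_all add: block_def)

lemma pd_G:
  assumes "x \<in> S" "i < n" "j < n" "l < n"
  shows "pd S i (G j l) x = dG i j l x"
proof -
  let ?r = "m1 + m2"
  have K: "x ?r \<in> K" "p1 x \<in> S1" "p2 x \<in> S2"
    using assms S_D by auto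
  have A: "((\<lambda>t. f (x ?r) * A a b ((p1 x)(i := t))) has_real_derivative f (x ?r) * pd S1 i (A a b) (p1 x)) (at (x i))"
    if "i < m1" "a < m1" "b < m1" for i a b
    using DERIV_cmult[OF A_deriv[OF K(2) that]] by (simp only: p1_nth[OF that(1)])
  have B: "((\<lambda>t. h (x ?r) * B a b ((p2 x)(i := t))) has_real_derivative h (x ?r) * pd S2 i (B a b) (p2 x)) (at (x (m1 + i)))"
    if "i < m2" "a < m2" "b < m2" for i a b
    using DERIV_cmult[OF B_deriv[OF K(3) that]] by (simp only: p2_nth[OF that(1)])
  \<comment> \<open>Splitting three indices by \<open>all_n\<close> gives 27 goals, each a
    derivative along one coordinate line.\<close>
  have "\<forall>i<n. \<forall>j<n. \<forall>l<n. ((\<lambda>t. G j l (x(i := t))) has_real_derivative dG i j l x) (at (x i))"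
    unfolding all_n
    by (intro conjI allI impI; simp add: p1_upd p2_upd dG_def A B e_deriv[OF K(1)]
        DERIV_cmult_right[OF f_deriv[OF K(1)]] DERIV_cmult_right[OF h_deriv[OF K(1)]]
        fun_upd_same fun_upd_other del: fun_upd_apply)
  then show ?thesis
    using assms by (intro pd_eq) auto
qed

lemma G_sym: "x \<in> S \<Longrightarrow> symm_matrix n (\<lambda>i j. G i j x)"
  using symm_matrixD[OF A_sym] symm_matrixD[OF B_sym] S_D
  by (simp add: symm_matrix_def G_def block_def)

lemma G_nd: "x \<in> S \<Longrightarrow> nondegenerate n (\<lambda>i j. G i j x)"
proof -
  assume x: "x \<in> S"
  have "nondegenerate 1 (\<lambda>i j. e (x (m1 + m2)))"
    using nonzero S_D[OF x] by (simp add: nondegenerate_def)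
  then show ?thesis
    unfolding G_def by (intro nondegenerate_block nondegenerate_scale A_nd B_nd nonzero S_D x)
qed

text \<open>The guess for \<open>\<Gamma>^k_ij\<close>, upper index first: the symbols of the
  factors, multiples \<open>u\<close> and \<open>v\<close> of the identity when one lower index is
  \<open>r\<close>, the second fundamental forms \<open>\<phi> A\<close> and \<open>\<psi> B\<close>
  when the upper one is, and \<open>w\<close> for \<open>r\<close> alone.\<close>

definition gam :: "nat \<Rightarrow> nat \<Rightarrow> nat \<Rightarrow> (nat \<Rightarrow> real) \<Rightarrow> real" where
  "gam k i j x =
    (let r = m1 + m2; s = x r in
     if k < m1 then
       (if i < m1 \<and> j < m1 then \<Gamma>1 k i j (p1 x)
        else if i < m1 \<and> j = r then (if k = i then u s else 0)
        else if i = r \<and> j < m1 then (if k = j then u s else 0) else 0)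
     else if k < r then
       (if i < m1 \<or> j < m1 then 0
        else if i < r \<and> j < r then \<Gamma>2 (k - m1) (i - m1) (j - m1) (p2 x)
        else if i < r then (if k = i then v s else 0)
        else if j < r then (if k = j then v s else 0) else 0)
     else
       (if i < m1 then if j < m1 then \<phi> s * A i j (p1 x) else 0
        else if j < m1 then 0
        else if i < r then if j < r then \<psi> s * B (i - m1) (j - m1) (p2 x) else 0
        else if j < r then 0 else w s))"

lemma gam_simps [simp]:
  "a < m1 \<Longrightarrow> b < m1 \<Longrightarrow> c < m1 \<Longrightarrow> gam a b c x = \<Gamma>1 a b c (p1 x)"
  "a < m1 \<Longrightarrow> b < m1 \<Longrightarrow> \<beta> < m2 \<Longrightarrow> gam a b (m1 + \<beta>) x = 0"
  "a < m1 \<Longrightarrow> b < m1 \<Longrightarrow> \<beta> < m2 \<Longrightarrow> gam a (m1 + \<beta>) b x = 0"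
  "a < m1 \<Longrightarrow> \<beta> < m2 \<Longrightarrow> \<gamma> < m2 \<Longrightarrow> gam a (m1 + \<beta>) (m1 + \<gamma>) x = 0"
  "a < m1 \<Longrightarrow> b < m1 \<Longrightarrow> gam a b (m1 + m2) x = (if a = b then u (x (m1 + m2)) else 0)"
  "a < m1 \<Longrightarrow> b < m1 \<Longrightarrow> gam a (m1 + m2) b x = (if a = b then u (x (m1 + m2)) else 0)"
  "a < m1 \<Longrightarrow> \<beta> < m2 \<Longrightarrow> gam a (m1 + \<beta>) (m1 + m2) x = 0"
  "a < m1 \<Longrightarrow> \<beta> < m2 \<Longrightarrow> gam a (m1 + m2) (m1 + \<beta>) x = 0"
  "a < m1 \<Longrightarrow> gam a (m1 + m2) (m1 + m2) x = 0"
  "b < m1 \<Longrightarrow> c < m1 \<Longrightarrow> \<alpha> < m2 \<Longrightarrow> gam (m1 + \<alpha>) b c x = 0"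
  "b < m1 \<Longrightarrow> \<alpha> < m2 \<Longrightarrow> gam (m1 + \<alpha>) b (m1 + l) x = 0"
  "b < m1 \<Longrightarrow> \<alpha> < m2 \<Longrightarrow> gam (m1 + \<alpha>) (m1 + l) b x = 0"
  "\<alpha> < m2 \<Longrightarrow> \<beta> < m2 \<Longrightarrow> \<gamma> < m2 \<Longrightarrow> gam (m1 + \<alpha>) (m1 + \<beta>) (m1 + \<gamma>) x = \<Gamma>2 \<alpha> \<beta> \<gamma> (p2 x)"
  "\<alpha> < m2 \<Longrightarrow> \<beta> < m2 \<Longrightarrow> gam (m1 + \<alpha>) (m1 + \<beta>) (m1 + m2) x = (if \<alpha> = \<beta> then v (x (m1 + m2)) else 0)"
  "\<alpha> < m2 \<Longrightarrow> \<beta> < m2 \<Longrightarrow> gam (m1 + \<alpha>) (m1 + m2) (m1 + \<beta>) x = (if \<alpha> = \<beta> then v (x (m1 + m2)) else 0)"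
  "\<alpha> < m2 \<Longrightarrow> gam (m1 + \<alpha>) (m1 + m2) (m1 + m2) x = 0"
  "b < m1 \<Longrightarrow> c < m1 \<Longrightarrow> gam (m1 + m2) b c x = \<phi> (x (m1 + m2)) * A b c (p1 x)"
  "b < m1 \<Longrightarrow> gam (m1 + m2) b (m1 + l) x = 0"
  "b < m1 \<Longrightarrow> gam (m1 + m2) (m1 + l) b x = 0"
  "\<beta> < m2 \<Longrightarrow> \<gamma> < m2 \<Longrightarrow> gam (m1 + m2) (m1 + \<beta>) (m1 + \<gamma>) x = \<psi> (x (m1 + m2)) * B \<beta> \<gamma> (p2 x)"
  "\<beta> < m2 \<Longrightarrow> gam (m1 + m2) (m1 + \<beta>) (m1 + m2) x = 0"
  "\<beta> < m2 \<Longrightarrow> gam (m1 + m2) (m1 + m2) (m1 + \<beta>) x = 0"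
  "gam (m1 + m2) (m1 + m2) (m1 + m2) x = w (x (m1 + m2))"
  by (simp_all add: gam_def)

lemma dG_simps [simp]:
  "a < m1 \<Longrightarrow> b < m1 \<Longrightarrow> c < m1 \<Longrightarrow> dG a b c x = f (x (m1 + m2)) * pd S1 a (A b c) (p1 x)"
  "b < m1 \<Longrightarrow> c < m1 \<Longrightarrow> \<alpha> < m2 \<Longrightarrow> dG (m1 + \<alpha>) b c x = 0"
  "b < m1 \<Longrightarrow> c < m1 \<Longrightarrow> dG (m1 + m2) b c x = 2 * u (x (m1 + m2)) * f (x (m1 + m2)) * A b c (p1 x)"
  "b < m1 \<Longrightarrow> dG i b (m1 + l) x = 0"
  "b < m1 \<Longrightarrow> dG i (m1 + l) b x = 0"
  "a < m1 \<Longrightarrow> \<beta> < m2 \<Longrightarrow> \<gamma> < m2 \<Longrightarrow> dG a (m1 + \<beta>) (m1 + \<gamma>) x = 0"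
  "\<alpha> < m2 \<Longrightarrow> \<beta> < m2 \<Longrightarrow> \<gamma> < m2 \<Longrightarrow> dG (m1 + \<alpha>) (m1 + \<beta>) (m1 + \<gamma>) x = h (x (m1 + m2)) * pd S2 \<alpha> (B \<beta> \<gamma>) (p2 x)"
  "\<beta> < m2 \<Longrightarrow> \<gamma> < m2 \<Longrightarrow> dG (m1 + m2) (m1 + \<beta>) (m1 + \<gamma>) x = 2 * v (x (m1 + m2)) * h (x (m1 + m2)) * B \<beta> \<gamma> (p2 x)"
  "\<beta> < m2 \<Longrightarrow> dG i (m1 + \<beta>) (m1 + m2) x = 0"
  "\<beta> < m2 \<Longrightarrow> dG i (m1 + m2) (m1 + \<beta>) x = 0"
  "a < m1 \<Longrightarrow> dG a (m1 + m2) (m1 + m2) x = 0"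
  "\<alpha> < m2 \<Longrightarrow> dG (m1 + \<alpha>) (m1 + m2) (m1 + m2) x = 0"
  "dG (m1 + m2) (m1 + m2) (m1 + m2) x = 2 * w (x (m1 + m2)) * e (x (m1 + m2))"
  by (simp_all add: dG_def)

lemma sum_delta_simps [simp]:
  fixes F :: "nat \<Rightarrow> real"
  shows "(\<Sum>k<m. F k * (if k = b then c else 0)) = (if b < m then F b * c else 0)"
    "(\<Sum>k<m. F k * (if b = k then c else 0)) = (if b < m then F b * c else 0)"
    "(\<Sum>k<m. (if k = b then c else 0) * F k) = (if b < m then c * F b else 0)"
    "(\<Sum>k<m. (if b = k then c else 0) * F k) = (if b < m then c * F b else 0)"
  by (simp_all add: if_distrib[of "\<lambda>x. x * _"] if_distrib[of "\<lambda>x. _ * x"] cong: if_cong)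

text \<open>The guess is checked with lowered index. Where the lowered index is \<open>r\<close>,
  the check comes down to \<open>\<phi> e = - u f\<close> and \<open>\<psi> e = - v h\<close>;
  within a factor it is the factor's own identity.\<close>

lemma lower_gam:
  assumes x: "x \<in> S"
  shows "\<forall>l<n. \<forall>i<n. \<forall>j<n. (\<Sum>k<n. G l k x * gam k i j x) = christoffel1 S G l i j x"
proof -
  let ?r = "m1 + m2"
  have K: "x ?r \<in> K" "p1 x \<in> S1" "p2 x \<in> S2"
    using x S_D by auto
  have 1: "(\<Sum>k<m1. f (x ?r) * A a k (p1 x) * \<Gamma>1 k b c (p1 x)) = f (x ?r) * christoffel1 S1 A a b c (p1 x)"
    if "a < m1" for a b c
    using lower_christoffel[where G=A, OF A_sym[OF K(2)] A_nd[OF K(2)] that]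
    by (simp add: mult.assoc flip: sum_distrib_left)
  have 2: "(\<Sum>k<m2. h (x ?r) * B a k (p2 x) * \<Gamma>2 k b c (p2 x)) = h (x ?r) * christoffel1 S2 B a b c (p2 x)"
    if "a < m2" for a b c
    using lower_christoffel[where G=B, OF B_sym[OF K(3)] B_nd[OF K(3)] that]
    by (simp add: mult.assoc flip: sum_distrib_left)
  have ch: "christoffel1 S G l i j x = (dG i j l x + dG j i l x - dG l i j x) / 2"
    if "l < n" "i < n" "j < n" for l i j
    using x that by (simp add: christoffel1_def pd_G)
  have sA: "A a b (p1 x) = A b a (p1 x)" if "a < m1" "b < m1" for a b
    using symm_matrixD[OF A_sym[OF K(2)] that] .
  have sB: "B a b (p2 x) = B b a (p2 x)" if "a < m2" "b < m2" for a b
    using symm_matrixD[OF B_sym[OF K(3)] that] .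
  note ph = phi[OF K(1)] psi[OF K(1)]
  \<comment> \<open>The same relations in the shape in which they meet the simplifier, with a metric
    entry \<open>z\<close> as a further factor.\<close>
  have 3: "e (x ?r) * (\<phi> (x ?r) * z) = - (u (x ?r) * f (x ?r) * z)"
    "e (x ?r) * (\<psi> (x ?r) * z) = - (v (x ?r) * h (x ?r) * z)" for z
    using ph by (metis mult.assoc mult.commute mult_minus_left)+
  have "\<forall>l<n. \<forall>i<n. \<forall>j<n. (\<Sum>k<n. G l k x * gam k i j x) = (dG i j l x + dG j i l x - dG l i j x) / 2"
    unfolding all_n sum_n
    by (intro conjI allI impI)
      (simp_all add: 1 2 3 sA sB christoffel1_def distrib_left right_diff_distrib cong: sum.cong_simp)
  then show ?thesis
    using ch by (intro allI impI) (simp only:)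
qed

lemma christoffel_G:
  assumes "x \<in> S" "k < n" "i < n" "j < n"
  shows "christoffel n S G k i j x = gam k i j x"
  using assms lower_gam[OF assms(1)] by (intro christoffel_eqI G_sym G_nd) blast+

text \<open>The other derivatives of Christoffel symbols that enter the Ricci tensor vanish by
  \<open>pd_indep\<close>.\<close>

lemma pd_gam:
  assumes x: "x \<in> S"
  shows "a < m1 \<Longrightarrow> i < m1 \<Longrightarrow> j < m1 \<Longrightarrow> k < m1 \<Longrightarrow> pd S i (gam a j k) x = pd S1 i (\<Gamma>1 a j k) (p1 x)"
    "a < m2 \<Longrightarrow> i < m2 \<Longrightarrow> j < m2 \<Longrightarrow> k < m2 \<Longrightarrow>
      pd S (m1 + i) (gam (m1 + a) (m1 + j) (m1 + k)) x = pd S2 i (\<Gamma>2 a j k) (p2 x)"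
    "a < m1 \<Longrightarrow> b < m1 \<Longrightarrow> pd S (m1 + m2) (gam a b (m1 + m2)) x = (if a = b then u' (x (m1 + m2)) else 0)"
    "a < m2 \<Longrightarrow> b < m2 \<Longrightarrow> pd S (m1 + m2) (gam (m1 + a) (m1 + b) (m1 + m2)) x = (if a = b then v' (x (m1 + m2)) else 0)"
    "a < m1 \<Longrightarrow> b < m1 \<Longrightarrow> pd S (m1 + m2) (gam (m1 + m2) a b) x = \<phi>' (x (m1 + m2)) * A a b (p1 x)"
    "a < m2 \<Longrightarrow> b < m2 \<Longrightarrow> pd S (m1 + m2) (gam (m1 + m2) (m1 + a) (m1 + b)) x = \<psi>' (x (m1 + m2)) * B a b (p2 x)"
proof -
  show "a < m1 \<Longrightarrow> i < m1 \<Longrightarrow> j < m1 \<Longrightarrow> k < m1 \<Longrightarrow> pd S i (gam a j k) x = pd S1 i (\<Gamma>1 a j k) (p1 x)"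
    using pd_p1[OF x] by (subst pd_cong[OF x gam_simps(1)]) auto
  show "a < m2 \<Longrightarrow> i < m2 \<Longrightarrow> j < m2 \<Longrightarrow> k < m2 \<Longrightarrow>
      pd S (m1 + i) (gam (m1 + a) (m1 + j) (m1 + k)) x = pd S2 i (\<Gamma>2 a j k) (p2 x)"
    using pd_p2[OF x] by (subst pd_cong[OF x gam_simps(13)]) auto
qed (rule pd_eq[OF x]; use S_D(3)[OF x] u_deriv v_deriv DERIV_cmult_right[OF phi_deriv] DERIV_cmult_right[OF psi_deriv]
      in \<open>simp add: p1_upd p2_upd if_distrib\<close>)+

lemma ricci_coord_gam:
  assumes x: "x \<in> S" and "j < n" "k < n"
  shows "ricci_coord n S G j k x =
     (\<Sum>i<n. pd S i (gam i j k) x) - (\<Sum>i<n. pd S j (gam i i k) x) +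
     (\<Sum>i<n. \<Sum>m<n. gam i i m x * gam m j k x) - (\<Sum>i<n. \<Sum>m<n. gam i j m x * gam m i k x)"
proof -
  have "pd S i (christoffel n S G l a b) x = pd S i (gam l a b) x" if "l < n" "a < n" "b < n" for i l a b
    using x that by (intro pd_cong christoffel_G)
  then show ?thesis
    using assms christoffel_G[OF x] unfolding ricci_coord_alt
    by (intro arg_cong2[where f="(+)"] arg_cong2[where f="(-)"] sum.cong refl arg_cong2[where f="(*)"]) auto
qed

text \<open>Here \<open>t\<close> is the trace \<open>\<Gamma>^i_ir\<close>. In the first block
  \<open>\<phi>'\<close> comes from differentiating \<open>\<Gamma>^r_ab\<close>,
  \<open>t \<phi>\<close> from the trace term, and \<open>- 2 u \<phi>\<close> from the two index
  pairs with one \<open>r\<close> in the last sum. In the \<open>r\<close> block the derivative of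
  \<open>w\<close> cancels between the two derivative sums.\<close>

theorem ricci_coord_G:
  assumes x: "x \<in> S"
  defines "s \<equiv> x (m1 + m2)"
  defines "t \<equiv> real m1 * u s + real m2 * v s + w s"
  shows "\<forall>j<n. \<forall>k<n. ricci_coord n S G j k x =
     block m1 (\<lambda>j k. ricci_coord m1 S1 A j k (p1 x) + (\<phi>' s + (t - 2 * u s) * \<phi> s) * A j k (p1 x))
       (block m2 (\<lambda>j k. ricci_coord m2 S2 B j k (p2 x) + (\<psi>' s + (t - 2 * v s) * \<psi> s) * B j k (p2 x))
         (\<lambda>j k. - (real m1 * (u' s + (u s)\<^sup>2 - u s * w s)) - real m2 * (v' s + (v s)\<^sup>2 - v s * w s))) j k"
proof -
  have K: "p1 x \<in> S1" "p2 x \<in> S2"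
    using x S_D by auto
  \<comment> \<open>In the mixed component of \<open>a\<close> and \<open>r\<close> the traces
    \<open>\<Gamma>^c_ca\<close> and \<open>\<Gamma>^c_ac\<close> of a factor have to
    cancel.\<close>
  have sg1: "\<Gamma>1 k i j (p1 x) = \<Gamma>1 k j i (p1 x)" if "i < m1" "j < m1" for i j k
    using symm_matrixD[OF A_sym] that K(1) by (intro christoffel_sym) auto
  have sg2: "\<Gamma>2 k i j (p2 x) = \<Gamma>2 k j i (p2 x)" if "i < m2" "j < m2" for i j k
    using symm_matrixD[OF B_sym] that K(2) by (intro christoffel_sym) auto
  \<comment> \<open>The last index appears as \<open>m1 + m2\<close>, so the inner block is met at
    \<open>m2\<close> and not at the \<open>m2 + 0\<close> of \<open>block_simps\<close>.\<close>
  have B: "block m2 Y Z a m2 = 0" "block m2 Y Z m2 a = 0" if "a < m2" for Y Z a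
    using that by (simp_all add: block_def)
  have B': "block m2 Y Z m2 m2 = Z 0 0" for Y Z
    by (simp add: block_def)
  have "\<forall>j<n. \<forall>k<n. 
      (\<Sum>i<n. pd S i (gam i j k) x) - (\<Sum>i<n. pd S j (gam i i k) x) +
     (\<Sum>i<n. \<Sum>m<n. gam i i m x * gam m j k x) - (\<Sum>i<n. \<Sum>m<n. gam i j m x * gam m i k x) =
     block m1 (\<lambda>j k. ricci_coord m1 S1 A j k (p1 x) + (\<phi>' s + (t - 2 * u s) * \<phi> s) * A j k (p1 x))
       (block m2 (\<lambda>j k. ricci_coord m2 S2 B j k (p2 x) + (\<psi>' s + (t - 2 * v s) * \<psi> s) * B j k (p2 x))
         (\<lambda>j k. - (real m1 * (u' s + (u s)\<^sup>2 - u s * w s)) - real m2 * (v' s + (v s)\<^sup>2 - v s * w s))) j k"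
    unfolding all_n sum_n
    by (intro conjI allI impI)
      (simp_all add: pd_gam[OF x] pd_indep[OF x] p1_upd p2_upd ricci_coord_alt t_def s_def B B' sg1 sg2
          sum.distrib ring_distribs power2_eq_square cong: sum.cong_simp, simp_all add: mult.commute)
  then show ?thesis
    using ricci_coord_gam[OF x] by (intro allI impI) (simp only:)
qed

end

section \<open>Product charts\<close>

text \<open>The last condition makes the (possibly one-sided) partial derivatives unique.\<close>

definition regular_chart :: "nat \<Rightarrow> 'a chart \<Rightarrow> bool" where
  "regular_chart n c \<longleftrightarrow>
     inj_on (snd c) (fst c) \<and> snd c ` fst c \<subseteq> Rn n \<and>
     (\<forall>p\<in>fst c. \<forall>i<n. at (snd c p i) within {t. (snd c p)(i := t) \<in> snd c ` fst c} \<noteq> bot)"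

lemma regular_chartD:
  assumes "regular_chart n c"
  shows "inj_on (snd c) (fst c)" "snd c ` fst c \<subseteq> Rn n" "p \<in> fst c \<Longrightarrow> snd c p \<in> Rn n"
    "p \<in> fst c \<Longrightarrow> i < n \<Longrightarrow> at (snd c p i) within {t. (snd c p)(i := t) \<in> snd c ` fst c} \<noteq> bot"
  using assms unfolding regular_chart_def by blast+

lemma chart_inv_eq [simp]: "inj_on (snd c) (fst c) \<Longrightarrow> p \<in> fst c \<Longrightarrow> chart_inv c (snd c p) = p"
  by (simp add: chart_inv_def)

lemma chart_inv_in: "x \<in> snd c ` fst c \<Longrightarrow> chart_inv c x \<in> fst c"
  unfolding chart_inv_def by (rule inv_into_into)

lemma snd_chart_inv: "x \<in> snd c ` fst c \<Longrightarrow> snd c (chart_inv c x) = x"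
  unfolding chart_inv_def by (rule f_inv_into_f)

lemma fst_prod_chart [simp]: "fst (prod_chart m c d) = fst c \<times> fst d"
  by (simp add: prod_chart_def)

lemma snd_prod_chart: "snd (prod_chart m c d) Q = joinc m (snd c (fst Q)) (snd d (snd Q))"
  by (cases Q) (simp add: prod_chart_def joinc_def)

lemma head_prod_chart: "snd c p \<in> Rn m \<Longrightarrow> headc m (snd (prod_chart m c d) (p, q)) = snd c p"
  using head_join[of "snd c p" m] by (simp add: snd_prod_chart)

lemma tail_prod_chart [simp]: "tailc m (snd (prod_chart m c d) Q) = snd d (snd Q)"
  by (simp add: snd_prod_chart)

lemma prod_chart_image:
  assumes "snd c ` A \<subseteq> Rn m"
  shows "snd (prod_chart m c d) ` (A \<times> B) = {x. headc m x \<in> snd c ` A \<and> tailc m x \<in> snd d ` B}"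
proof (intro Set.set_eqI iffI)
  fix x assume "x \<in> {x. headc m x \<in> snd c ` A \<and> tailc m x \<in> snd d ` B}"
  then obtain a b where ab: "a \<in> A" "b \<in> B" "headc m x = snd c a" "tailc m x = snd d b"
    by blast
  then have "x = snd (prod_chart m c d) (a, b)"
    using join_head_tail[of m x] by (simp add: snd_prod_chart)
  then show "x \<in> snd (prod_chart m c d) ` (A \<times> B)"
    using ab by blast
next
  fix x assume "x \<in> snd (prod_chart m c d) ` (A \<times> B)"
  then obtain a b where ab: "a \<in> A" "b \<in> B" "x = joinc m (snd c a) (snd d b)"
    by (auto simp: snd_prod_chart)
  moreover have "snd c a \<in> Rn m"
    using assms ab by blast
  ultimately show "x \<in> {x. headc m x \<in> snd c ` A \<and> tailc m x \<in> snd d ` B}"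
    by (simp del: mem_Collect_eq) simp
qed

lemma inj_on_prod_chart:
  assumes "inj_on (snd c) (fst c)" "snd c ` fst c \<subseteq> Rn m" "inj_on (snd d) (fst d)"
  shows "inj_on (snd (prod_chart m c d)) (fst (prod_chart m c d))"
proof (rule inj_onI)
  fix P Q assume *: "P \<in> fst (prod_chart m c d)" "Q \<in> fst (prod_chart m c d)"
    "snd (prod_chart m c d) P = snd (prod_chart m c d) Q"
  have "snd c (fst P) \<in> Rn m" "snd c (fst Q) \<in> Rn m"
    using * assms(2) by auto
  then have "snd c (fst P) = snd c (fst Q)" "snd d (snd P) = snd d (snd Q)"
    using arg_cong[OF *(3), of "headc m"] arg_cong[OF *(3), of "tailc m"] by (simp_all add: snd_prod_chart)
  then show "P = Q"
    using * assms(1,3) by (auto simp: inj_on_def prod_eq_iff mem_Times_iff)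
qed

lemma chart_inv_prod_chart:
  assumes "inj_on (snd c) (fst c)" "snd c ` fst c \<subseteq> Rn m" "inj_on (snd d) (fst d)"
    and "x \<in> snd (prod_chart m c d) ` fst (prod_chart m c d)"
  shows "chart_inv (prod_chart m c d) x = (chart_inv c (headc m x), chart_inv d (tailc m x))"
proof -
  obtain Q where Q: "Q \<in> fst (prod_chart m c d)" "x = snd (prod_chart m c d) Q"
    using assms(4) by blast
  moreover have "snd c (fst Q) \<in> Rn m"
    using Q assms(2) by auto
  ultimately show ?thesis
    using assms(1,3) inj_on_prod_chart[OF assms(1-3)]
    by (simp only: chart_inv_eq) (auto simp: mem_Times_iff snd_prod_chart)
qed

text \<open>Moving a coordinate of the first factor leaves the tail, hence the point of the second
  factor, where it is.\<close>

lemma slice_prod_fst: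
  assumes "snd c ` fst c \<subseteq> Rn m" "p \<in> fst c" "q \<in> fst d" "i < m"
  defines "x \<equiv> snd (prod_chart m c d) (p, q)"
  shows "{t. x(i := t) \<in> snd (prod_chart m c d) ` fst (prod_chart m c d)} =
    {t. (snd c p)(i := t) \<in> snd c ` fst c}"
proof -
  have "snd c p \<in> Rn m"
    using assms by blast
  then have "headc m (x(i := t)) = (snd c p)(i := t)" "tailc m (x(i := t)) = snd d q" for t
    using assms(4) by (simp_all add: x_def head_upd tail_upd head_prod_chart del: mem_Collect_eq)
  then show ?thesis
    using assms(3) by (simp add: prod_chart_image[OF assms(1)])
qed

lemma slice_prod_snd:
  assumes "snd c ` fst c \<subseteq> Rn m" "p \<in> fst c" "q \<in> fst d" "\<not> i < m"
  defines "x \<equiv> snd (prod_chart m c d) (p, q)"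
  shows "{t. x(i := t) \<in> snd (prod_chart m c d) ` fst (prod_chart m c d)} =
    {t. (snd d q)(i - m := t) \<in> snd d ` fst d}"
proof -
  have "snd c p \<in> Rn m"
    using assms by blast
  then have "headc m (x(i := t)) = snd c p" "tailc m (x(i := t)) = (snd d q)(i - m := t)" for t
    using assms(4) by (simp_all add: x_def head_upd tail_upd head_prod_chart del: mem_Collect_eq)
  then show ?thesis
    using assms(2) by (simp add: prod_chart_image[OF assms(1)])
qed

lemma regular_prod_chart:
  assumes "regular_chart m c" "regular_chart n d"
  shows "regular_chart (m + n) (prod_chart m c d)"
  unfolding regular_chart_def
proof (intro conjI ballI allI impI)
  note c = regular_chartD[OF assms(1)] and d = regular_chartD[OF assms(2)]
  show "inj_on (snd (prod_chart m c d)) (fst (prod_chart m c d))"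
    by (rule inj_on_prod_chart[OF c(1,2) d(1)])
  show "snd (prod_chart m c d) ` fst (prod_chart m c d) \<subseteq> Rn (m + n)"
    using join_in_Rn[OF d(3)] by (auto simp: snd_prod_chart)
  fix Q i assume Q: "Q \<in> fst (prod_chart m c d)" and i: "i < m + n"
  obtain p q where pq: "Q = (p, q)" "p \<in> fst c" "q \<in> fst d"
    using Q by auto
  show "at (snd (prod_chart m c d) Q i) within
      {t. (snd (prod_chart m c d) Q)(i := t) \<in> snd (prod_chart m c d) ` fst (prod_chart m c d)} \<noteq> bot"
  proof (cases "i < m")
    case True
    then show ?thesis
      unfolding pq slice_prod_fst[OF c(2) pq(2,3) True] using c(4)[OF pq(2) True] by (simp add: snd_prod_chart joinc_def)
  next
    case False
    have "i - m < n"
      using False i by linarith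
    from d(4)[OF pq(3) this] show ?thesis
      unfolding pq slice_prod_snd[OF c(2) pq(2,3) False] using False by (simp add: snd_prod_chart joinc_def)
  qed
qed

text \<open>At an isolated point of the slice every number would be a derivative and
  \<open>vector_derivative\<close> an arbitrary choice; regularity of the chart excludes
  this.\<close>

lemma differential_const:
  assumes "regular_chart n c" "p \<in> fst c" "i < n"
    and "\<And>t. (snd c p)(i := t) \<in> snd c ` fst c \<Longrightarrow> f (chart_inv c ((snd c p)(i := t))) = a"
  shows "differential c f i p = 0"
proof -
  have "differential c f i p =
      vector_derivative (\<lambda>t. a) (at (snd c p i) within {t. (snd c p)(i := t) \<in> snd c ` fst c})"
    unfolding differential_def pd_def using assms(2,4) by (intro vector_derivative_cong_on) auto
  also have "\<dots> = 0"
    by (rule vector_derivative_within[OF regular_chartD(4)[OF assms(1-3)]]) simp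
  finally show ?thesis .
qed

text \<open>Both sides differentiate the same function of \<open>t\<close> on the same slice. Being
  an equality of choices, this covers one-sided and non-existing derivatives alike.\<close>

lemma differential_slice:
  assumes "P \<in> fst C" "snd C P i = snd c p k"
    and "{t. (snd C P)(i := t) \<in> snd C ` fst C} = {t. (snd c p)(k := t) \<in> snd c ` fst c}"
    and "\<And>t. (snd C P)(i := t) \<in> snd C ` fst C \<Longrightarrow>
      F (chart_inv C ((snd C P)(i := t))) = f (chart_inv c ((snd c p)(k := t)))"
  shows "differential C F i P = differential c f k p"
proof -
  have "vector_derivative (\<lambda>t. F (chart_inv C ((snd C P)(i := t)))) (at (snd C P i) within {t. (snd C P)(i := t) \<in> snd C ` fst C}) =
    vector_derivative (\<lambda>t. f (chart_inv c ((snd c p)(k := t)))) (at (snd C P i) within {t. (snd C P)(i := t) \<in> snd C ` fst C})"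
    using assms(1,4) by (intro vector_derivative_cong_on) auto
  then show ?thesis
    unfolding differential_def pd_def by (simp only: assms(2,3))
qed

lemma differential_prod_fst:
  assumes "regular_chart m c" "regular_chart n d" "p \<in> fst c" "q \<in> fst d" "i < m + n"
  shows "differential (prod_chart m c d) (\<lambda>Q. F (fst Q)) i (p, q) = (if i < m then differential c F i p else 0)"
proof (cases "i < m")
  note c = regular_chartD[OF assms(1)] and d = regular_chartD[OF assms(2)]
  case True
  have "differential (prod_chart m c d) (\<lambda>Q. F (fst Q)) i (p, q) = differential c F i p"
  proof (rule differential_slice[OF _ _ slice_prod_fst[OF c(2) assms(3,4) True]])
    fix t assume "(snd (prod_chart m c d) (p, q))(i := t) \<in> snd (prod_chart m c d) ` fst (prod_chart m c d)"
    from chart_inv_prod_chart[OF c(1,2) d(1) this]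
    show "F (fst (chart_inv (prod_chart m c d) ((snd (prod_chart m c d) (p, q))(i := t)))) =
        F (chart_inv c ((snd c p)(i := t)))"
      using True head_prod_chart[OF c(3)[OF assms(3)], of d q] by (simp only: head_upd if_True fst_conv snd_conv)
  qed (use assms True in \<open>simp_all add: snd_prod_chart joinc_def\<close>)
  then show ?thesis
    using True by simp
next
  note c = regular_chartD[OF assms(1)] and d = regular_chartD[OF assms(2)]
  case False
  have "differential (prod_chart m c d) (\<lambda>Q. F (fst Q)) i (p, q) = 0"
  proof (rule differential_const[OF regular_prod_chart[OF assms(1,2)] _ assms(5)])
    fix t assume *: "(snd (prod_chart m c d) (p, q))(i := t) \<in> snd (prod_chart m c d) ` fst (prod_chart m c d)"
    show "F (fst (chart_inv (prod_chart m c d) ((snd (prod_chart m c d) (p, q))(i := t)))) = F p"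
      using False c(1) assms(3) head_prod_chart[OF c(3)[OF assms(3)], of d q]
      unfolding chart_inv_prod_chart[OF c(1,2) d(1) *] by (simp add: head_upd del: mem_Collect_eq)
  qed (use assms in simp)
  then show ?thesis
    using False by simp
qed

lemma differential_prod_snd:
  assumes "regular_chart m c" "regular_chart n d" "p \<in> fst c" "q \<in> fst d" "i < m + n"
  shows "differential (prod_chart m c d) (\<lambda>Q. F (snd Q)) i (p, q) = (if i < m then 0 else differential d F (i - m) q)"
proof (cases "i < m")
  note c = regular_chartD[OF assms(1)] and d = regular_chartD[OF assms(2)]
  case False
  have "differential (prod_chart m c d) (\<lambda>Q. F (snd Q)) i (p, q) = differential d F (i - m) q"
  proof (rule differential_slice[OF _ _ slice_prod_snd[OF c(2) assms(3,4) False]])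
    fix t assume "(snd (prod_chart m c d) (p, q))(i := t) \<in> snd (prod_chart m c d) ` fst (prod_chart m c d)"
    from chart_inv_prod_chart[OF c(1,2) d(1) this]
    show "F (snd (chart_inv (prod_chart m c d) ((snd (prod_chart m c d) (p, q))(i := t)))) =
        F (chart_inv d ((snd d q)(i - m := t)))"
      using False by (simp only: tail_upd if_False fst_conv snd_conv tail_prod_chart)
  qed (use assms False in \<open>simp_all add: snd_prod_chart joinc_def\<close>)
  then show ?thesis
    using False by simp
next
  note c = regular_chartD[OF assms(1)] and d = regular_chartD[OF assms(2)]
  case True
  have "differential (prod_chart m c d) (\<lambda>Q. F (snd Q)) i (p, q) = 0"
  proof (rule differential_const[OF regular_prod_chart[OF assms(1,2)] _ assms(5)])
    fix t assume *: "(snd (prod_chart m c d) (p, q))(i := t) \<in> snd (prod_chart m c d) ` fst (prod_chart m c d)"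
    show "F (snd (chart_inv (prod_chart m c d) ((snd (prod_chart m c d) (p, q))(i := t)))) = F q"
      using True d(1) assms(4)
      unfolding chart_inv_prod_chart[OF c(1,2) d(1) *] by (simp add: tail_upd)
  qed (use assms in simp)
  then show ?thesis
    using True by simp
qed

text \<open>The Jacobian of a product map is block diagonal; \<open>k\<close> numbers target
  coordinates and \<open>i\<close> source coordinates.\<close>

lemma differential_prod_chart:
  assumes "regular_chart m c" "regular_chart n d" "p \<in> fst c" "q \<in> fst d" "i < m + n"
  shows "differential (prod_chart m c d) (\<lambda>Q. snd (prod_chart m c' d') (F (fst Q), F' (snd Q)) k) i (p, q) =
    block m (\<lambda>k i. differential c (\<lambda>p. snd c' (F p) k) i p)
      (\<lambda>k i. differential d (\<lambda>q. snd d' (F' q) k) i q) k i"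
proof (cases "k < m")
  case True
  then show ?thesis
    using differential_prod_fst[OF assms, of "\<lambda>p. snd c' (F p) k"] by (simp add: snd_prod_chart joinc_def block_def)
next
  case False
  then show ?thesis
    using differential_prod_snd[OF assms, of "\<lambda>q. snd d' (F' q) (k - m)"]
    by (simp add: snd_prod_chart joinc_def block_def)
qed

section \<open>Pullbacks and metrics on products\<close>

text \<open>\<open>pullback\<close> with an explicit target chart \<open>c'\<close> in place of the
  chosen one.\<close>

definition pull ::
  "nat \<Rightarrow> 'a chart \<Rightarrow> 'b chart \<Rightarrow> ('a \<Rightarrow> 'b) \<Rightarrow> 'b tensor2 \<Rightarrow> nat \<Rightarrow> nat \<Rightarrow> 'a \<Rightarrow> real" where
  "pull n c c' F g i j p =
     (\<Sum>k<n. \<Sum>l<n. differential c (\<lambda>q. snd c' (F q) k) i p * differential c (\<lambda>q. snd c' (F q) l) j p *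
        g c' k l (F p))"

text \<open>\<open>c0\<close> shows that the choice in \<open>pullback\<close> is made from a
  non-empty set. Since the chosen chart is unknown, the value has to be \<open>X\<close> for all
  candidates.\<close>

lemma pullback_eqI:
  assumes "c0 \<in> atlas N" "F p \<in> fst c0"
    and "\<And>c'. c' \<in> atlas N \<Longrightarrow> F p \<in> fst c' \<Longrightarrow> pull (mdim N) c c' F g i j p = X"
  shows "pullback N F g c i j p = X"
proof -
  have "(SOME c'. c' \<in> atlas N \<and> F p \<in> fst c') \<in> atlas N \<and> F p \<in> fst (SOME c'. c' \<in> atlas N \<and> F p \<in> fst c')"
    by (rule someI_ex) (use assms in blast)
  then show ?thesis
    using assms(3) by (simp add: pullback_def pull_def Let_def)
qed

lemma smooth_tensor2_pull:
  assumes "smooth_tensor2 M g" "c \<in> atlas M" "c' \<in> atlas M" "p \<in> fst c" "p \<in> fst c'" "i < mdim M" "j < mdim M"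
  shows "pull (mdim M) c c' (\<lambda>q. q) g i j p = g c i j p"
  using assms(1)[unfolded smooth_tensor2_def, THEN conjunct2, rule_format, OF assms(2,3) _ assms(6,7), of p] assms(4,5)
  by (simp only: pull_def Int_iff)

lemma pullback_id:
  assumes "smooth_tensor2 M g" "c \<in> atlas M" "p \<in> fst c" "i < mdim M" "j < mdim M"
  shows "pullback M (\<lambda>q. q) g c i j p = g c i j p"
  using assms by (intro pullback_eqI[of c] smooth_tensor2_pull)

lemma pullback_fst:
  assumes "regular_chart m c" "regular_chart n d" "p \<in> fst c" "q \<in> fst d" "i < m + n" "j < m + n"
  shows "pullback N (\<lambda>Q. F (fst Q)) g (prod_chart m c d) i j (p, q) =
    (if i < m \<and> j < m then pullback N F g c i j p else 0)"
proof -
  \<comment> \<open>Both sides choose the same chart around \<open>F p\<close>; naming it leaves a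
    computation with one fixed chart.\<close>
  define c' where "c' = (SOME c'. c' \<in> atlas N \<and> F p \<in> fst c')"
  show ?thesis
    using differential_prod_fst[OF assms(1-4), of _ "\<lambda>p. snd c' (F p) k" for k] assms(5,6)
    by (auto simp: pullback_def Let_def simp flip: c'_def)
qed

lemma pullback_snd:
  assumes "regular_chart m c" "regular_chart n d" "p \<in> fst c" "q \<in> fst d" "i < m + n" "j < m + n"
  shows "pullback N (\<lambda>Q. F (snd Q)) g (prod_chart m c d) i j (p, q) =
    (if i < m \<or> j < m then 0 else pullback N F g d (i - m) (j - m) q)"
proof -
  define c' where "c' = (SOME c'. c' \<in> atlas N \<and> F q \<in> fst c')"
  show ?thesis
    using differential_prod_snd[OF assms(1-4), of _ "\<lambda>q. snd c' (F q) k" for k] assms(5,6)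
    by (auto simp: pullback_def Let_def simp flip: c'_def)
qed

text \<open>The congruence \<open>D^T B D\<close> for block diagonal \<open>D\<close> and
  \<open>B\<close>, in which the second block of \<open>D\<close> has size \<open>n\<close> by
  \<open>n'\<close>.\<close>

lemma block_transform:
  assumes "i < m + n'" "j < m + n'"
  shows "(\<Sum>k<m + n. \<Sum>l<m + n. block m D1 D2 k i * block m D1 D2 l j * block m Y Z k l) =
    block m (\<lambda>i j. \<Sum>k<m. \<Sum>l<m. D1 k i * D1 l j * Y k l) (\<lambda>i j. \<Sum>k<n. \<Sum>l<n. D2 k i * D2 l j * Z k l) i j"
proof -
  have "\<forall>i<m + n'. \<forall>j<m + n'. (\<Sum>k<m + n. \<Sum>l<m + n. block m D1 D2 k i * block m D1 D2 l j * block m Y Z k l) =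
    block m (\<lambda>i j. \<Sum>k<m. \<Sum>l<m. D1 k i * D1 l j * Y k l) (\<lambda>i j. \<Sum>k<n. \<Sum>l<n. D2 k i * D2 l j * Z k l) i j"
    unfolding all_less_add sum_lessThan_add by simp
  then show ?thesis
    using assms by blast
qed

text \<open>The second factor has separate dimensions \<open>n'\<close> in the source and
  \<open>n\<close> in the target, which admits the inclusion of the boundary. The scalar
  \<open>\<alpha>\<close> will be the warping function at the given point.\<close>

lemma pull_prod:
  assumes "regular_chart m c" "regular_chart n' d" "p \<in> fst c" "q \<in> fst d" "i < m + n'" "j < m + n'"
    and T: "\<And>k l. k < m + n \<Longrightarrow> l < m + n \<Longrightarrow> T (prod_chart m c' d') k l (F p, F' q) =
      block m (\<lambda>k l. \<alpha> * g c' k l (F p)) (\<lambda>k l. h d' k l (F' q)) k l"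
  shows "pull (m + n) (prod_chart m c d) (prod_chart m c' d') (\<lambda>Q. (F (fst Q), F' (snd Q))) T i j (p, q) =
    block m (\<lambda>i j. \<alpha> * pull m c c' F g i j p) (\<lambda>i j. pull n d d' F' h i j q) i j"
proof -
  let ?D = "block m (\<lambda>k i. differential c (\<lambda>p. snd c' (F p) k) i p) (\<lambda>k i. differential d (\<lambda>q. snd d' (F' q) k) i q)"
  have "pull (m + n) (prod_chart m c d) (prod_chart m c' d') (\<lambda>Q. (F (fst Q), F' (snd Q))) T i j (p, q) =
    (\<Sum>k<m + n. \<Sum>l<m + n. ?D k i * ?D l j * block m (\<lambda>k l. \<alpha> * g c' k l (F p)) (\<lambda>k l. h d' k l (F' q)) k l)"
    unfolding pull_def
    by (intro sum.cong refl arg_cong2[where f="(*)"] differential_prod_chart[OF assms(1-4)] assms(5,6))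
       (simp_all add: T)
  also have "\<dots> = block m (\<lambda>i j. \<alpha> * pull m c c' F g i j p) (\<lambda>i j. pull n d d' F' h i j q) i j"
    unfolding block_transform[OF assms(5,6)]
    by (simp add: block_def pull_def sum_distrib_left algebra_simps)
  finally show ?thesis .
qed

definition regular_atlas :: "'a atlas_space \<Rightarrow> bool" where
  "regular_atlas M \<longleftrightarrow> (\<forall>c\<in>atlas M. regular_chart (mdim M) c)"

lemma regular_atlasD: "regular_atlas M \<Longrightarrow> c \<in> atlas M \<Longrightarrow> regular_chart (mdim M) c"
  by (simp add: regular_atlas_def)

lemma mdim_prod_mfd [simp]: "mdim (prod_mfd M N) = mdim M + mdim N"
  by (simp add: prod_mfd_def)

lemma mtop_prod_mfd [simp]: "mtop (prod_mfd M N) = prod_topology (mtop M) (mtop N)"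
  by (simp add: prod_mfd_def)

lemma atlas_prod_mfd:
  "C \<in> atlas (prod_mfd M N) \<longleftrightarrow> (\<exists>c\<in>atlas M. \<exists>d\<in>atlas N. C = prod_chart (mdim M) c d)"
  by (auto simp: prod_mfd_def)

lemma regular_atlas_prod_mfd: "regular_atlas M \<Longrightarrow> regular_atlas N \<Longrightarrow> regular_atlas (prod_mfd M N)"
  unfolding regular_atlas_def by (auto simp only: atlas_prod_mfd mdim_prod_mfd intro!: regular_prod_chart)

lemma smooth_fun_snd:
  assumes "regular_atlas M" "regular_atlas N" "smooth_fun N a"
  shows "smooth_fun (prod_mfd M N) (\<lambda>P. a (snd P))"
  unfolding smooth_fun_def
proof
  fix C assume "C \<in> atlas (prod_mfd M N)"
  then obtain c d where C: "c \<in> atlas M" "d \<in> atlas N" "C = prod_chart (mdim M) c d"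
    by (auto simp: atlas_prod_mfd)
  note c = regular_chartD[OF regular_atlasD[OF assms(1) C(1)]]
  note d = regular_chartD[OF regular_atlasD[OF assms(2) C(2)]]
  have "snd C ` fst C \<subseteq> Rn (mdim M + mdim N)"
    unfolding C(3) by (intro regular_chartD(2) regular_prod_chart regular_atlasD assms C)
  moreover have "smooth_on (mdim N) (snd d ` fst d) (\<lambda>x. a (chart_inv d x))"
    using assms(3) C(2) by (simp add: smooth_fun_def)
  ultimately have "smooth_on (mdim M + mdim N) (snd C ` fst C) (\<lambda>x. a (chart_inv d (tailc (mdim M) x)))"
    using prod_chart_image[OF c(2)] by (intro smooth_on_tail) (auto simp: C(3))
  then show "smooth_on (mdim (prod_mfd M N)) (snd C ` fst C) (\<lambda>x. a (snd (chart_inv C x)))"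
    using chart_inv_prod_chart[OF c(1,2) d(1)]
    by (auto simp: C(3) simp del: fst_prod_chart elim: smooth_on_cong)
qed

lemma pseudo_metric_iff:
  "pseudo_metric M g \<longleftrightarrow> smooth_tensor2 M g \<and>
     (\<forall>c\<in>atlas M. \<forall>p\<in>fst c. symm_matrix (mdim M) (\<lambda>i j. g c i j p) \<and> nondegenerate (mdim M) (\<lambda>i j. g c i j p))"
  unfolding pseudo_metric_def symm_matrix_def nondegenerate_def ..

lemma pseudo_metricD:
  assumes "pseudo_metric M g"
  shows "smooth_tensor2 M g" "c \<in> atlas M \<Longrightarrow> p \<in> fst c \<Longrightarrow> symm_matrix (mdim M) (\<lambda>i j. g c i j p)"
    "c \<in> atlas M \<Longrightarrow> p \<in> fst c \<Longrightarrow> nondegenerate (mdim M) (\<lambda>i j. g c i j p)"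
  using assms unfolding pseudo_metric_iff by blast+

lemma smooth_tensor2D:
  assumes "smooth_tensor2 M g" "c \<in> atlas M" "i < mdim M" "j < mdim M"
  shows "smooth_on (mdim M) (snd c ` fst c) (\<lambda>x. g c i j (chart_inv c x))"
  using assms by (simp add: smooth_tensor2_def)

lemma symm_block: "symm_matrix m Y \<Longrightarrow> symm_matrix n Z \<Longrightarrow> symm_matrix (m + n) (block m Y Z)"
  by (auto simp: symm_matrix_def block_def)

text \<open>A metric \<open>a(q) g + h\<close> known by its components in product charts. Two
  applications give a doubly warped product, and \<open>a = 1\<close> gives the plain
  product.\<close>

lemma pseudo_metric_prod:
  assumes M: "regular_atlas M" "pseudo_metric M g" and N: "regular_atlas N" "pseudo_metric N h"
    and a: "smooth_fun N a" "\<And>d q. d \<in> atlas N \<Longrightarrow> q \<in> fst d \<Longrightarrow> a q \<noteq> 0"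
    and T: "\<And>c d p q i j. c \<in> atlas M \<Longrightarrow> d \<in> atlas N \<Longrightarrow> p \<in> fst c \<Longrightarrow> q \<in> fst d \<Longrightarrow>
      i < mdim M + mdim N \<Longrightarrow> j < mdim M + mdim N \<Longrightarrow>
      T (prod_chart (mdim M) c d) i j (p, q) = block (mdim M) (\<lambda>i j. a q * g c i j p) (\<lambda>i j. h d i j q) i j"
  shows "pseudo_metric (prod_mfd M N) T"
proof -
  let ?m = "mdim M" and ?n = "mdim N"
  have 1: "smooth_on (?m + ?n) (snd (prod_chart ?m c d) ` fst (prod_chart ?m c d))
      (\<lambda>x. T (prod_chart ?m c d) i j (chart_inv (prod_chart ?m c d) x))"
    if cd: "c \<in> atlas M" "d \<in> atlas N" and ij: "i < ?m + ?n" "j < ?m + ?n" for c d i j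
  proof -
    note rc = regular_chartD[OF regular_atlasD[OF M(1) cd(1)]]
    note rd = regular_chartD[OF regular_atlasD[OF N(1) cd(2)]]
    let ?C = "prod_chart ?m c d"
    let ?S = "snd ?C ` fst ?C"
    have S: "?S \<subseteq> Rn (?m + ?n)"
      using cd M(1) N(1) by (intro regular_chartD(2) regular_prod_chart regular_atlasD)
    have hS: "headc ?m x \<in> snd c ` fst c" and tS: "tailc ?m x \<in> snd d ` fst d" if "x \<in> ?S" for x
      using that prod_chart_image[OF rc(2), of d "fst d"] by (auto)
    have al: "smooth_on (?m + ?n) ?S (\<lambda>x. a (chart_inv d (tailc ?m x)))"
      using a(1) cd by (intro smooth_on_tail[OF _ S tS]) (simp_all add: smooth_fun_def)
    have gs: "smooth_on (?m + ?n) ?S (\<lambda>x. g c k l (chart_inv c (headc ?m x)))" if "k < ?m" "l < ?m" for k l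
      by (intro smooth_on_head[OF smooth_tensor2D S hS] pseudo_metricD[OF M(2)] cd that)
    have hs: "smooth_on (?m + ?n) ?S (\<lambda>x. h d k l (chart_inv d (tailc ?m x)))" if "k < ?n" "l < ?n" for k l
      by (intro smooth_on_tail[OF smooth_tensor2D S tS] pseudo_metricD[OF N(2)] cd that)
    have "smooth_on (?m + ?n) ?S (\<lambda>x. block ?m (\<lambda>i j. a (chart_inv d (tailc ?m x)) * g c i j (chart_inv c (headc ?m x)))
        (\<lambda>i j. h d i j (chart_inv d (tailc ?m x))) i j)"
    proof -
      consider "i < ?m" "j < ?m" | "?m \<le> i" "?m \<le> j" | "i < ?m \<and> ?m \<le> j \<or> j < ?m \<and> ?m \<le> i"
        by linarith
      then show ?thesis
      proof cases
        case 1
        then show ?thesis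
          using smooth_on_mult[OF al gs] by simp
      next
        case 2
        then show ?thesis
          using hs[of "i - ?m" "j - ?m"] ij by (simp add: block_def)
      next
        case 3
        then show ?thesis
          using smooth_on_const[OF S, of 0] by (auto simp: block_def)
      qed
    qed
    then show ?thesis
    proof (rule smooth_on_cong)
      fix x assume x: "x \<in> ?S"
      show "block ?m (\<lambda>i j. a (chart_inv d (tailc ?m x)) * g c i j (chart_inv c (headc ?m x)))
        (\<lambda>i j. h d i j (chart_inv d (tailc ?m x))) i j = T ?C i j (chart_inv ?C x)"
        unfolding chart_inv_prod_chart[OF rc(1,2) rd(1) x]
        using chart_inv_in[OF hS[OF x]] chart_inv_in[OF tS[OF x]] cd ij by (simp add: T)
    qed
  qed
  \<comment> \<open>The transformation law: the scalar \<open>a q\<close> is the same in all charts,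
    so the law reduces to those of \<open>g\<close> and \<open>h\<close>.\<close>
  have 2: "T (prod_chart ?m c d) i j (p, q) = pull (?m + ?n) (prod_chart ?m c d) (prod_chart ?m c' d') (\<lambda>Q. Q) T i j (p, q)"
    if cd: "c \<in> atlas M" "d \<in> atlas N" "c' \<in> atlas M" "d' \<in> atlas N"
      and pq: "p \<in> fst c" "p \<in> fst c'" "q \<in> fst d" "q \<in> fst d'" and ij: "i < ?m + ?n" "j < ?m + ?n" for c d c' d' p q i j
  proof -
    have "pull (?m + ?n) (prod_chart ?m c d) (prod_chart ?m c' d') (\<lambda>Q. (fst Q, snd Q)) T i j (p, q) =
        block ?m (\<lambda>i j. a q * pull ?m c c' (\<lambda>p. p) g i j p) (\<lambda>i j. pull ?n d d' (\<lambda>q. q) h i j q) i j"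
      by (rule pull_prod) (use regular_atlasD[OF M(1)] regular_atlasD[OF N(1)] cd pq ij T in auto)
    also have "\<dots> = block ?m (\<lambda>i j. a q * g c i j p) (\<lambda>i j. h d i j q) i j"
      using smooth_tensor2_pull[OF pseudo_metricD(1)[OF M(2)] cd(1,3) pq(1,2)]
        smooth_tensor2_pull[OF pseudo_metricD(1)[OF N(2)] cd(2,4) pq(3,4)] ij
      by (auto simp: block_def)
    also have "\<dots> = T (prod_chart ?m c d) i j (p, q)"
      using T cd pq ij by simp
    finally show ?thesis
      by simp
  qed
  have "smooth_tensor2 (prod_mfd M N) T"
    unfolding smooth_tensor2_def
  proof (intro conjI ballI allI impI)
    fix C i j assume "C \<in> atlas (prod_mfd M N)" "i < mdim (prod_mfd M N)" "j < mdim (prod_mfd M N)"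
    then show "smooth_on (mdim (prod_mfd M N)) (snd C ` fst C) (\<lambda>x. T C i j (chart_inv C x))"
      using 1 by (auto simp: atlas_prod_mfd simp del: fst_prod_chart)
  next
    fix C C' P i j
    assume *: "C \<in> atlas (prod_mfd M N)" "C' \<in> atlas (prod_mfd M N)" "P \<in> fst C \<inter> fst C'"
      "i < mdim (prod_mfd M N)" "j < mdim (prod_mfd M N)"
    then obtain c d c' d' p q where C: "c \<in> atlas M" "d \<in> atlas N" "c' \<in> atlas M" "d' \<in> atlas N"
      "C = prod_chart ?m c d" "C' = prod_chart ?m c' d'" "P = (p, q)"
      by (metis atlas_prod_mfd surj_pair)
    show "T C i j P = (\<Sum>k<mdim (prod_mfd M N). \<Sum>l<mdim (prod_mfd M N).
        differential C (\<lambda>q. snd C' q k) i P * differential C (\<lambda>q. snd C' q l) j P * T C' k l P)"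
      using 2[OF C(1-4), of p q i j] * unfolding C(5-7) by (simp add: pull_def)
  qed
  moreover have SN: "symm_matrix (?m + ?n) (\<lambda>i j. T (prod_chart ?m c d) i j (p, q))"
    "nondegenerate (?m + ?n) (\<lambda>i j. T (prod_chart ?m c d) i j (p, q))"
    if "c \<in> atlas M" "d \<in> atlas N" "p \<in> fst c" "q \<in> fst d" for c d p q
  proof -
    let ?B = "block ?m (\<lambda>i j. a q * g c i j p) (\<lambda>i j. h d i j q)"
    have s: "symm_matrix ?m (\<lambda>i j. a q * g c i j p)"
      using pseudo_metricD(2)[OF M(2)] that by (simp add: symm_matrix_def)
    have "symm_matrix (?m + ?n) ?B"
      using pseudo_metricD(2)[OF N(2)] that by (intro symm_block s)
    then show "symm_matrix (?m + ?n) (\<lambda>i j. T (prod_chart ?m c d) i j (p, q))"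
      using T[OF that] by (simp add: symm_matrix_def)
    have "nondegenerate (?m + ?n) ?B"
      using pseudo_metricD(3)[OF M(2)] pseudo_metricD(3)[OF N(2)] a(2) that
      by (intro nondegenerate_block nondegenerate_scale) auto
    then show "nondegenerate (?m + ?n) (\<lambda>i j. T (prod_chart ?m c d) i j (p, q))"
      by (rule nondegenerate_cong) (use T[OF that] in simp)
  qed
  ultimately show ?thesis
    unfolding pseudo_metric_iff
  proof (intro conjI ballI)
    fix C P assume *: "C \<in> atlas (prod_mfd M N)" "P \<in> fst C"
    then obtain c d p q where C: "c \<in> atlas M" "d \<in> atlas N" "C = prod_chart ?m c d" "P = (p, q)"
      by (metis atlas_prod_mfd surj_pair)
    then have "p \<in> fst c" "q \<in> fst d"
      using *(2) by simp_all
    with SN C show "symm_matrix (mdim (prod_mfd M N)) (\<lambda>i j. T C i j P)"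
      "nondegenerate (mdim (prod_mfd M N)) (\<lambda>i j. T C i j P)"
      by simp_all
  qed
qed

text \<open>Tensors are total functions; an iterated pullback agrees with a known metric only on
  chart domains and for indices below the dimension.\<close>

lemma pseudo_metric_cong:
  assumes "pseudo_metric M g"
    and "\<And>c p i j. c \<in> atlas M \<Longrightarrow> p \<in> fst c \<Longrightarrow> i < mdim M \<Longrightarrow> j < mdim M \<Longrightarrow> g c i j p = h c i j p"
  shows "pseudo_metric M h"
proof -
  have "smooth_tensor2 M h"
    unfolding smooth_tensor2_def
  proof (intro conjI ballI allI impI)
    fix c i j assume c: "c \<in> atlas M" "i < mdim M" "j < mdim M"
    show "smooth_on (mdim M) (snd c ` fst c) (\<lambda>x. h c i j (chart_inv c x))"
      by (rule smooth_on_cong[OF smooth_tensor2D[OF pseudo_metricD(1)[OF assms(1)] c]])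
         (rule assms(2)[OF c(1) chart_inv_in c(2,3)])
  next
    fix c c' p i j
    assume *: "c \<in> atlas M" "c' \<in> atlas M" "p \<in> fst c \<inter> fst c'" "i < mdim M" "j < mdim M"
    have "h c i j p = pull (mdim M) c c' (\<lambda>q. q) g i j p"
      using smooth_tensor2_pull[OF pseudo_metricD(1)[OF assms(1)] *(1,2) _ _ *(4,5), of p] assms(2)[OF *(1) _ *(4,5), of p] *(3)
      by simp
    also have "\<dots> = pull (mdim M) c c' (\<lambda>q. q) h i j p"
      using assms(2) * unfolding pull_def by (intro sum.cong arg_cong2[where f="(*)"] refl) simp
    finally show "h c i j p = (\<Sum>k<mdim M. \<Sum>l<mdim M.
        differential c (\<lambda>q. snd c' q k) i p * differential c (\<lambda>q. snd c' q l) j p * h c' k l p)"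
      by (simp add: pull_def)
  qed
  moreover have "symm_matrix (mdim M) (\<lambda>i j. h c i j p)" "nondegenerate (mdim M) (\<lambda>i j. h c i j p)"
    if "c \<in> atlas M" "p \<in> fst c" for c p
    using pseudo_metricD(2)[OF assms(1) that] nondegenerate_cong[OF pseudo_metricD(3)[OF assms(1) that] assms(2)[OF that]]
      assms(2)[OF that] by (simp_all add: symm_matrix_def)
  ultimately show ?thesis
    unfolding pseudo_metric_iff by blast
qed

section \<open>Products of manifolds\<close>

text \<open>Rectangles of basic open sets form a countable base.\<close>

lemma second_countable_prod_topology:
  assumes "second_countable X" "second_countable Y"
  shows "second_countable (prod_topology X Y)"
proof -
  obtain B where B: "countable B" "\<And>V. V \<in> B \<Longrightarrow> openin X V"
    "\<And>U x. openin X U \<and> x \<in> U \<longrightarrow> (\<exists>V\<in>B. x \<in> V \<and> V \<subseteq> U)"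
    using assms(1) by (auto simp: second_countable_def)
  obtain C where C: "countable C" "\<And>V. V \<in> C \<Longrightarrow> openin Y V"
    "\<And>U x. openin Y U \<and> x \<in> U \<longrightarrow> (\<exists>V\<in>C. x \<in> V \<and> V \<subseteq> U)"
    using assms(2) by (auto simp: second_countable_def)
  show ?thesis
    unfolding second_countable_def
  proof (intro exI conjI allI impI)
    show "countable ((\<lambda>(U, V). U \<times> V) ` (B \<times> C))"
      using B(1) C(1) by simp
    show "\<forall>V\<in>(\<lambda>(U, V). U \<times> V) ` (B \<times> C). openin (prod_topology X Y) V"
      using B(2) C(2) by (auto simp: openin_prod_Times_iff)
    fix W P assume W: "openin (prod_topology X Y) W \<and> P \<in> W"
    obtain x y where P: "P = (x, y)"
      by (cases P)
    then obtain U V where UV: "openin X U" "openin Y V" "x \<in> U" "y \<in> V" "U \<times> V \<subseteq> W"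
      using W unfolding openin_prod_topology_alt by blast
    obtain U' where U': "U' \<in> B" "x \<in> U'" "U' \<subseteq> U"
      using B(3) UV by blast
    obtain V' where V': "V' \<in> C" "y \<in> V'" "V' \<subseteq> V"
      using C(3) UV by blast
    have "U' \<times> V' \<in> (\<lambda>(U, V). U \<times> V) ` (B \<times> C)" "P \<in> U' \<times> V'" "U' \<times> V' \<subseteq> W"
      using U' V' UV P by auto
    then show "\<exists>V\<in>(\<lambda>(U, V). U \<times> V) ` (B \<times> C). P \<in> V \<and> V \<subseteq> W"
      by blast
  qed
qed

lemma continuous_map_Rn_iff:
  "continuous_map X (Euclidean_space n) f \<longleftrightarrow>
     (\<forall>k. continuous_map X euclideanreal (\<lambda>x. f x k)) \<and> f \<in> topspace X \<rightarrow> Rn n"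
  unfolding Euclidean_space_def continuous_map_in_subtopology
  by (auto simp: continuous_map_componentwise_UNIV)

lemma continuous_map_joinc:
  assumes "continuous_map X (Euclidean_space m) f" "continuous_map X (Euclidean_space n) g"
  shows "continuous_map X (Euclidean_space (m + n)) (\<lambda>x. joinc m (f x) (g x))"
  unfolding continuous_map_Rn_iff
proof (intro conjI allI)
  show "continuous_map X euclideanreal (\<lambda>x. joinc m (f x) (g x) k)" for k
    using assms by (cases "k < m") (auto simp: joinc_def continuous_map_Rn_iff)
  show "(\<lambda>x. joinc m (f x) (g x)) \<in> topspace X \<rightarrow> Rn (m + n)"
    using assms join_in_Rn unfolding continuous_map_Rn_iff by (fastforce simp: Pi_iff)
qed

lemma continuous_map_headc: "continuous_map (Euclidean_space (m + n)) (Euclidean_space m) (headc m)"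
  by (simp add: Euclidean_space_eq continuous_on_head Pi_iff) (simp add: headc_def)

lemma continuous_map_tailc: "continuous_map (Euclidean_space (m + n)) (Euclidean_space n) (tailc m)"
  by (simp add: Euclidean_space_eq continuous_on_tail Pi_iff) (simp add: tailc_def)

text \<open>Gives names to the clauses of \<open>manifold_modelled_on\<close>, with \<open>H\<close>
  general so as to serve the full space and the half-space.\<close>

locale manifold_on =
  fixes H :: "(nat \<Rightarrow> real) set" and M :: "'a atlas_space"
  assumes modelled: "manifold_modelled_on H M"
begin

lemma Hausdorff: "Hausdorff_space (mtop M)"
  and second_countable: "second_countable (mtop M)"
  and cover: "(\<Union>c\<in>atlas M. fst c) = topspace (mtop M)"
  using modelled by (simp_all add: manifold_modelled_on_def)

lemma
  assumes "c \<in> atlas M"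
  shows open_dom: "openin (mtop M) (fst c)"
    and open_image: "openin (subtopology (Euclidean_space (mdim M)) H) (snd c ` fst c)"
    and homeo: "homeomorphic_map (subtopology (mtop M) (fst c))
       (subtopology (Euclidean_space (mdim M)) (snd c ` fst c)) (snd c)"
  using modelled assms by (simp_all add: manifold_modelled_on_def)

lemma smooth_transition:
  "c \<in> atlas M \<Longrightarrow> c' \<in> atlas M \<Longrightarrow> i < mdim M \<Longrightarrow>
   smooth_on (mdim M) (snd c ` (fst c \<inter> fst c')) (\<lambda>x. snd c' (chart_inv c x) i)"
  using modelled by (simp add: manifold_modelled_on_def)

lemma dom_subset: "c \<in> atlas M \<Longrightarrow> fst c \<subseteq> topspace (mtop M)"
  using open_dom openin_subset by blast

lemma chart_at: "p \<in> topspace (mtop M) \<Longrightarrow> \<exists>c\<in>atlas M. p \<in> fst c"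
  using cover by blast

lemma image_subset: "c \<in> atlas M \<Longrightarrow> snd c ` fst c \<subseteq> Rn (mdim M)"
  using openin_subset[OF open_image] by (auto simp: topspace_Euclidean_space)

lemma inj: "c \<in> atlas M \<Longrightarrow> inj_on (snd c) (fst c)"
  using homeomorphic_imp_injective_map[OF homeo] dom_subset by (simp add: Int_absorb1)

text \<open>The inverse provided by the homeomorphism agrees with \<open>chart_inv\<close> on the
  image, so \<open>chart_inv\<close> is continuous there.\<close>

lemma homeo_inv:
  assumes c: "c \<in> atlas M"
  shows "homeomorphic_maps (subtopology (mtop M) (fst c))
       (subtopology (Euclidean_space (mdim M)) (snd c ` fst c)) (snd c) (chart_inv c)"
proof -
  obtain g where g: "homeomorphic_maps (subtopology (mtop M) (fst c))
       (subtopology (Euclidean_space (mdim M)) (snd c ` fst c)) (snd c) g"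
    using homeo[OF c] homeomorphic_map_maps by blast
  have "g y = chart_inv c y" if y: "y \<in> snd c ` fst c" for y
  proof -
    obtain p where p: "p \<in> fst c" "y = snd c p"
      using y by blast
    then have "g (snd c p) = p"
      using g dom_subset[OF c] unfolding homeomorphic_maps_def by auto
    then show ?thesis
      using p inj[OF c] by simp
  qed
  then show ?thesis
    by (intro homeomorphic_maps_eq[OF g]) auto
qed

end

lemma regular_atlas_manifold:
  assumes "manifold M"
  shows "regular_atlas M"
proof -
  interpret manifold_on "topspace (Euclidean_space (mdim M))" M
    using assms by unfold_locales (simp add: manifold_def)
  have "regular_chart (mdim M) c" if c: "c \<in> atlas M" for c
    unfolding regular_chart_def
  proof (intro conjI ballI allI impI)
    show "inj_on (snd c) (fst c)" "snd c ` fst c \<subseteq> Rn (mdim M)"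
      using inj[OF c] image_subset[OF c] .
    fix p i assume "p \<in> fst c" "i < mdim M"
    moreover have "openin (Euclidean_space (mdim M)) (snd c ` fst c)"
      using open_image[OF c] by simp
    ultimately show "at (snd c p i) within {t. (snd c p)(i := t) \<in> snd c ` fst c} \<noteq> bot"
      using at_within_slice[of "mdim M" "snd c ` fst c" "snd c p" i] by simp
  qed
  then show ?thesis
    by (simp add: regular_atlas_def)
qed

text \<open>Each coordinate of the product map depends on one factor only. \<open>A\<close> and
  \<open>B\<close> will be overlaps, so this yields transition maps, with identities for
  \<open>F\<close> and \<open>F'\<close>, as well as smoothness of maps between products.\<close>

lemma smooth_on_prod_chart:
  assumes "inj_on (snd c) (fst c)" "snd c ` fst c \<subseteq> Rn m" "inj_on (snd d) (fst d)" "snd d ` fst d \<subseteq> Rn n"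
    and "A \<subseteq> fst c" "B \<subseteq> fst d"
    and "k < m \<Longrightarrow> smooth_on m (snd c ` A) (\<lambda>x. snd c' (F (chart_inv c x)) k)"
    and "m \<le> k \<Longrightarrow> smooth_on n (snd d ` B) (\<lambda>x. snd d' (F' (chart_inv d x)) (k - m))"
  shows "smooth_on (m + n) (snd (prod_chart m c d) ` (A \<times> B))
    (\<lambda>x. snd (prod_chart m c' d') (F (fst (chart_inv (prod_chart m c d) x)), F' (snd (chart_inv (prod_chart m c d) x))) k)"
proof -
  let ?S = "snd (prod_chart m c d) ` (A \<times> B)"
  have sub: "?S \<subseteq> snd (prod_chart m c d) ` fst (prod_chart m c d)"
    using assms(5,6) by auto
  have inv: "chart_inv (prod_chart m c d) x = (chart_inv c (headc m x), chart_inv d (tailc m x))" if "x \<in> ?S" for x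
    using chart_inv_prod_chart[OF assms(1-3)] sub that by blast
  have "snd c ` A \<subseteq> Rn m"
    using assms(2,5) by blast
  note im = prod_chart_image[OF this, of d B]
  have S: "?S \<subseteq> Rn (m + n)"
  proof -
    have "snd (prod_chart m c d) (p, q) \<in> Rn (m + n)" if "p \<in> A" "q \<in> B" for p q
      using join_in_Rn[of "snd d q" n m "snd c p"] that assms(4,6) by (auto simp: snd_prod_chart)
    then show ?thesis
      by blast
  qed
  show ?thesis
  proof (cases "k < m")
    case True
    have "smooth_on (m + n) ?S (\<lambda>x. snd c' (F (chart_inv c (headc m x))) k)"
      using im by (intro smooth_on_head[OF assms(7)[OF True] S]) auto
    then show ?thesis
    proof (rule smooth_on_cong)
      fix x assume "x \<in> ?S"
      from inv[OF this] True
      show "snd c' (F (chart_inv c (headc m x))) k = snd (prod_chart m c' d')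
          (F (fst (chart_inv (prod_chart m c d) x)), F' (snd (chart_inv (prod_chart m c d) x))) k"
        by (simp add: snd_prod_chart joinc_def)
    qed
  next
    case False
    then have "smooth_on (m + n) ?S (\<lambda>x. snd d' (F' (chart_inv d (tailc m x))) (k - m))"
      using im by (intro smooth_on_tail[OF assms(8) S]) auto
    then show ?thesis
    proof (rule smooth_on_cong)
      fix x assume "x \<in> ?S"
      from inv[OF this] False
      show "snd d' (F' (chart_inv d (tailc m x))) (k - m) = snd (prod_chart m c' d')
          (F (fst (chart_inv (prod_chart m c d) x)), F' (snd (chart_inv (prod_chart m c d) x))) k"
        by (simp add: snd_prod_chart joinc_def)
    qed
  qed
qed

text \<open>The model set of the second factor becomes a condition on the tail coordinates.\<close>

lemma prod_manifold:
  assumes "manifold M" "manifold_modelled_on H N"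
  shows "manifold_modelled_on {x \<in> Rn (mdim M + mdim N). tailc (mdim M) x \<in> H} (prod_mfd M N)"
proof -
  let ?m = "mdim M" and ?n = "mdim N"
  interpret M: manifold_on "topspace (Euclidean_space ?m)" M
    using assms by unfold_locales (simp add: manifold_def)
  interpret N: manifold_on H N
    using assms by unfold_locales
  let ?H = "{x \<in> Rn (?m + ?n). tailc ?m x \<in> H}"
  have chart: "openin (prod_topology (mtop M) (mtop N)) (fst c \<times> fst d)"
    "openin (subtopology (Euclidean_space (?m + ?n)) ?H) (snd (prod_chart ?m c d) ` (fst c \<times> fst d))"
    "homeomorphic_map (subtopology (prod_topology (mtop M) (mtop N)) (fst c \<times> fst d))
      (subtopology (Euclidean_space (?m + ?n)) (snd (prod_chart ?m c d) ` (fst c \<times> fst d))) (snd (prod_chart ?m c d))"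
    if cd: "c \<in> atlas M" "d \<in> atlas N" for c d
  proof -
    let ?C = "prod_chart ?m c d"
    let ?I = "snd ?C ` (fst c \<times> fst d)"
    note im = prod_chart_image[OF M.image_subset[OF cd(1)], of d "fst d"]
    show "openin (prod_topology (mtop M) (mtop N)) (fst c \<times> fst d)"
      using M.open_dom[OF cd(1)] N.open_dom[OF cd(2)] by (simp add: openin_prod_Times_iff)
    obtain V where V: "openin (Euclidean_space ?n) V" "snd d ` fst d = V \<inter> H"
      using N.open_image[OF cd(2)] by (auto simp: openin_subtopology)
    have U: "openin (Euclidean_space ?m) (snd c ` fst c)"
      using M.open_image[OF cd(1)] by simp
    have "?I = ({x \<in> Rn (?m + ?n). headc ?m x \<in> snd c ` fst c} \<inter> {x \<in> Rn (?m + ?n). tailc ?m x \<in> V}) \<inter> ?H"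
    proof -
      have "x \<in> Rn (?m + ?n)" if "x \<in> ?I" for x
        using that join_in_Rn[of _ ?n ?m] N.image_subset[OF cd(2)] by (auto simp: snd_prod_chart)
      then show ?thesis
        using im V by auto
    qed
    then show "openin (subtopology (Euclidean_space (?m + ?n)) ?H) ?I"
      unfolding openin_subtopology
      using openin_Int[OF openin_head[OF U, of ?n] openin_tail[OF V(1), of ?m]] by (intro exI conjI)
    note hc = M.homeo_inv[OF cd(1), unfolded homeomorphic_maps_def]
    note hd = N.homeo_inv[OF cd(2), unfolded homeomorphic_maps_def]
    have "homeomorphic_maps (prod_topology (subtopology (mtop M) (fst c)) (subtopology (mtop N) (fst d)))
      (subtopology (Euclidean_space (?m + ?n)) ?I) (snd ?C) (\<lambda>x. (chart_inv c (headc ?m x), chart_inv d (tailc ?m x)))"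
      unfolding homeomorphic_maps_def
    proof (intro conjI ballI)
      let ?X = "prod_topology (subtopology (mtop M) (fst c)) (subtopology (mtop N) (fst d))"
      have "continuous_map ?X (Euclidean_space ?m) (\<lambda>P. snd c (fst P))"
        using continuous_map_compose[OF continuous_map_fst, where g="snd c"] hc
        by (auto simp: o_def continuous_map_in_subtopology)
      moreover have "continuous_map ?X (Euclidean_space ?n) (\<lambda>P. snd d (snd P))"
        using continuous_map_compose[OF continuous_map_snd, where g="snd d"] hd
        by (auto simp: o_def continuous_map_in_subtopology)
      ultimately have "continuous_map ?X (Euclidean_space (?m + ?n)) (snd ?C)"
        unfolding snd_prod_chart[abs_def] by (rule continuous_map_joinc)
      then show "continuous_map ?X (subtopology (Euclidean_space (?m + ?n)) ?I) (snd ?C)"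
        using M.dom_subset[OF cd(1)] N.dom_subset[OF cd(2)]
        by (auto simp: continuous_map_in_subtopology)
      have "continuous_map (subtopology (Euclidean_space (?m + ?n)) ?I) (subtopology (Euclidean_space ?m) (snd c ` fst c)) (headc ?m)"
        using continuous_map_from_subtopology[OF continuous_map_headc] im
        by (auto simp: continuous_map_in_subtopology)
      moreover have "continuous_map (subtopology (Euclidean_space (?m + ?n)) ?I) (subtopology (Euclidean_space ?n) (snd d ` fst d)) (tailc ?m)"
        using continuous_map_from_subtopology[OF continuous_map_tailc] im
        by (auto simp: continuous_map_in_subtopology)
      ultimately show "continuous_map (subtopology (Euclidean_space (?m + ?n)) ?I) ?X (\<lambda>x. (chart_inv c (headc ?m x), chart_inv d (tailc ?m x)))"
        using continuous_map_compose[where g="chart_inv c", OF _ hc[THEN conjunct2, THEN conjunct1]]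
          continuous_map_compose[where g="chart_inv d", OF _ hd[THEN conjunct2, THEN conjunct1]]
        unfolding continuous_map_pairwise o_def fst_conv snd_conv by blast
      fix P assume "P \<in> topspace ?X"
      then have P: "fst P \<in> fst c" "snd P \<in> fst d"
        by auto
      then have "headc ?m (snd ?C P) = snd c (fst P)"
        using head_prod_chart[of c "fst P" ?m d "snd P"] M.image_subset[OF cd(1)] by auto
      then show "(chart_inv c (headc ?m (snd ?C P)), chart_inv d (tailc ?m (snd ?C P))) = P"
        using P M.inj[OF cd(1)] N.inj[OF cd(2)] by simp
    next
      fix x assume "x \<in> topspace (subtopology (Euclidean_space (?m + ?n)) ?I)"
      then have "headc ?m x \<in> snd c ` fst c" "tailc ?m x \<in> snd d ` fst d"
        using im by auto
      then show "snd ?C (chart_inv c (headc ?m x), chart_inv d (tailc ?m x)) = x"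
        by (simp add: snd_prod_chart snd_chart_inv)
    qed
    then show "homeomorphic_map (subtopology (prod_topology (mtop M) (mtop N)) (fst c \<times> fst d))
      (subtopology (Euclidean_space (?m + ?n)) ?I) (snd ?C)"
      unfolding subtopology_Times by (rule homeomorphic_maps_imp_map)
  qed
  have trans: "smooth_on (?m + ?n) (snd (prod_chart ?m c d) ` ((fst c \<times> fst d) \<inter> (fst c' \<times> fst d')))
      (\<lambda>x. snd (prod_chart ?m c' d') (chart_inv (prod_chart ?m c d) x) k)"
    if "c \<in> atlas M" "d \<in> atlas N" "c' \<in> atlas M" "d' \<in> atlas N" "k < ?m + ?n" for c d c' d' k
  proof -
    have "smooth_on (?m + ?n) (snd (prod_chart ?m c d) ` ((fst c \<inter> fst c') \<times> (fst d \<inter> fst d')))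
      (\<lambda>x. snd (prod_chart ?m c' d') (fst (chart_inv (prod_chart ?m c d) x), snd (chart_inv (prod_chart ?m c d) x)) k)"
      using that by (intro smooth_on_prod_chart M.inj N.inj M.image_subset N.image_subset
          M.smooth_transition N.smooth_transition) auto
    then show ?thesis
      by (simp add: Times_Int_Times)
  qed
  show ?thesis
    unfolding manifold_modelled_on_def
  proof (intro conjI ballI allI impI)
    show "Hausdorff_space (mtop (prod_mfd M N))" "second_countable (mtop (prod_mfd M N))"
      using M.Hausdorff N.Hausdorff M.second_countable N.second_countable
      by (simp_all add: Hausdorff_space_prod_topology second_countable_prod_topology)
    show "(\<Union>c\<in>atlas (prod_mfd M N). fst c) = topspace (mtop (prod_mfd M N))"
    proof -
      have "(\<Union>C\<in>atlas (prod_mfd M N). fst C) = (\<Union>c\<in>atlas M. fst c) \<times> (\<Union>d\<in>atlas N. fst d)"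
        by (auto simp: prod_mfd_def)
      then show ?thesis
        using M.cover N.cover by simp
    qed
  next
    fix C assume "C \<in> atlas (prod_mfd M N)"
    then obtain c d where C: "c \<in> atlas M" "d \<in> atlas N" "C = prod_chart ?m c d"
      by (meson atlas_prod_mfd)
    show "openin (mtop (prod_mfd M N)) (fst C)"
      "openin (subtopology (Euclidean_space (mdim (prod_mfd M N))) ?H) (snd C ` fst C)"
      "homeomorphic_map (subtopology (mtop (prod_mfd M N)) (fst C))
        (subtopology (Euclidean_space (mdim (prod_mfd M N))) (snd C ` fst C)) (snd C)"
      using chart[OF C(1,2)] by (simp_all add: C(3))
  next
    fix C C' k assume "C \<in> atlas (prod_mfd M N)" "C' \<in> atlas (prod_mfd M N)" "k < mdim (prod_mfd M N)"
    then show "smooth_on (mdim (prod_mfd M N)) (snd C ` (fst C \<inter> fst C')) (\<lambda>x. snd C' (chart_inv C x) k)"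
      using trans by (auto simp only: atlas_prod_mfd mdim_prod_mfd fst_prod_chart)
  qed
qed

lemma prod_manifold_with_boundary:
  assumes "manifold M" "manifold_with_boundary N" "0 < mdim N"
  shows "manifold_with_boundary (prod_mfd M N)"
proof -
  \<comment> \<open>The half-space constrains the last coordinate, which belongs to the tail because
    \<open>mdim N\<close> is positive.\<close>
  have "{x \<in> Rn (mdim M + mdim N). tailc (mdim M) x \<in> half_space (mdim N)} = half_space (mdim M + mdim N)"
    using assms(3) tail_in_Rn[of _ "mdim M" "mdim N"]
    by (auto simp: half_space_def topspace_Euclidean_space) (auto simp: tailc_def add.commute)
  then show ?thesis
    using prod_manifold[of M "half_space (mdim N)" N] assms by (simp add: manifold_with_boundary_def)
qed

section \<open>The half-line\<close>

definition hl_chart :: "real set \<Rightarrow> real chart" where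
  "hl_chart K = (K, \<lambda>r i. if i = 0 then r else 0)"

lemma hl_chart_simps [simp]:
  "fst (hl_chart K) = K" "snd (hl_chart K) r 0 = r" "0 < i \<Longrightarrow> snd (hl_chart K) r i = 0"
  by (simp_all add: hl_chart_def)

lemma snd_hl_chart: "snd (hl_chart K) r = (\<lambda>i. if i = 0 then r else 0)"
  by (simp add: hl_chart_def)

lemma half_line_simps [simp]:
  "mtop (half_line_mfd K) = subtopology euclideanreal K" "mdim (half_line_mfd K) = 1"
  "atlas (half_line_mfd K) = {hl_chart K}"
  by (simp_all add: half_line_mfd_def hl_chart_def)

lemma inj_hl_chart: "inj_on (snd (hl_chart K)) A"
proof (rule inj_onI)
  fix r s assume "snd (hl_chart K) r = snd (hl_chart K) s"
  from arg_cong[OF this, of "\<lambda>x. x 0"] show "r = s"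
    by simp
qed

lemma hl_chart_image: "snd (hl_chart K) ` A = {x \<in> Rn 1. x 0 \<in> A}"
proof (intro Set.set_eqI iffI)
  fix x assume "x \<in> {x \<in> Rn 1. x 0 \<in> A}"
  then have "x = snd (hl_chart K) (x 0)" "x 0 \<in> A"
    by (auto simp: snd_hl_chart fun_eq_iff)
  then show "x \<in> snd (hl_chart K) ` A"
    by blast
qed (auto simp: snd_hl_chart)

lemma chart_inv_hl_chart: "x \<in> Rn 1 \<Longrightarrow> x 0 \<in> K \<Longrightarrow> chart_inv (hl_chart K) x = x 0"
proof -
  assume "x \<in> Rn 1" "x 0 \<in> K"
  then have "x = snd (hl_chart K) (x 0)"
    by (auto simp: snd_hl_chart fun_eq_iff)
  then show ?thesis
    using chart_inv_eq[OF inj_hl_chart, of "x 0" K] \<open>x 0 \<in> K\<close> by simp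
qed

definition perfect :: "real set \<Rightarrow> bool" where
  "perfect K \<longleftrightarrow> (\<forall>s\<in>K. at s within K \<noteq> bot)"

lemma slice_hl_chart: "{t. (snd (hl_chart K) s)(0 := t) \<in> snd (hl_chart K) ` K} = K"
  unfolding hl_chart_image by (auto simp: snd_hl_chart)

lemma regular_hl_chart: "perfect K \<Longrightarrow> regular_chart 1 (hl_chart K)"
  unfolding regular_chart_def
proof (intro conjI ballI allI impI)
  show "inj_on (snd (hl_chart K)) (fst (hl_chart K))"
    by (rule inj_hl_chart)
  show "snd (hl_chart K) ` fst (hl_chart K) \<subseteq> Rn 1"
    unfolding hl_chart_image by blast
  fix s and i :: nat assume *: "perfect K" "s \<in> fst (hl_chart K)" "i < 1"
  then show "at (snd (hl_chart K) s i) within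
      {t. (snd (hl_chart K) s)(i := t) \<in> snd (hl_chart K) ` fst (hl_chart K)} \<noteq> bot"
    using slice_hl_chart[of K s] by (simp add: perfect_def)
qed

text \<open>The point 0 is sent to the zero vector, which lies in \<open>Rn 0\<close>; this chart is
  the third factor of boundary charts.\<close>

lemma regular_hl_chart_0: "regular_chart 0 (hl_chart {0})"
  unfolding regular_chart_def by (simp add: inj_hl_chart) (simp add: snd_hl_chart)

lemma perfect_half_line:
  assumes "openin (top_of_set {0..}) K"
  shows "perfect K"
  unfolding perfect_def
proof
  fix s assume s: "s \<in> K"
  obtain T where T: "open T" "K = {0..} \<inter> T"
    using assms by (auto simp: openin_open)
  then obtain e where e: "e > 0" "ball s e \<subseteq> T"
    using s open_contains_ball by blast
  \<comment> \<open>Points to the right of \<open>s\<close> are available even at the endpoint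
    0.\<close>
  have "{s<..<s + e} \<subseteq> K"
    using T e s by (auto simp: dist_real_def subset_iff)
  moreover have "s islimpt {s<..<s + e}"
    using e(1) by (simp add: islimpt_greaterThanLessThan1)
  ultimately have "s islimpt K"
    using islimpt_subset by blast
  then show "at s within K \<noteq> bot"
    by (simp add: trivial_limit_within)
qed

lemma differential_hl_chart:
  assumes "perfect K" "s \<in> K"
  shows "differential (hl_chart K) (\<lambda>r. r) 0 s = 1"
proof -
  have "differential (hl_chart K) (\<lambda>r. r) 0 s =
      vector_derivative (\<lambda>t. chart_inv (hl_chart K) ((snd (hl_chart K) s)(0 := t))) (at s within K)"
    unfolding differential_def pd_def using slice_hl_chart[of K s] by simp
  also have "\<dots> = vector_derivative (\<lambda>t. t) (at s within K)"
  proof (rule vector_derivative_cong_on[OF assms(2)])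
    fix t assume "t \<in> K"
    then show "chart_inv (hl_chart K) ((snd (hl_chart K) s)(0 := t)) = t"
      using chart_inv_hl_chart[of "(snd (hl_chart K) s)(0 := t)" K] by simp
  qed
  also have "\<dots> = 1"
    using assms by (intro vector_derivative_within has_vector_derivative_id) (simp add: perfect_def)
  finally show ?thesis .
qed

lemma half_line_manifold:
  assumes K: "openin (top_of_set {0..}) K"
  shows "manifold_with_boundary (half_line_mfd K)"
proof -
  let ?\<phi> = "snd (hl_chart K)"
  obtain T where T: "open T" "K = {0..} \<inter> T"
    using K by (auto simp: openin_open)
  have c0: "continuous_map (Euclidean_space 1) euclideanreal (\<lambda>x. x 0)"
    using continuous_on_subset[OF continuous_on_product_coordinates]
    by (simp add: continuous_map_Euclidean_space_iff)
  have "openin (Euclidean_space 1) {x \<in> Rn 1. x 0 \<in> T}"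
    using openin_continuous_map_preimage[OF c0] T(1) by (simp add: topspace_Euclidean_space)
  moreover have "?\<phi> ` K = {x \<in> Rn 1. x 0 \<in> T} \<inter> half_space 1"
    unfolding hl_chart_image T(2) by (auto simp: half_space_def topspace_Euclidean_space)
  ultimately have op: "openin (subtopology (Euclidean_space 1) (half_space 1)) (?\<phi> ` K)"
    unfolding openin_subtopology by (intro exI conjI)
  have "homeomorphic_maps (top_of_set K) (subtopology (Euclidean_space 1) (?\<phi> ` K)) ?\<phi> (\<lambda>x. x 0)"
    unfolding homeomorphic_maps_def
  proof (intro conjI ballI)
    have "continuous_map (top_of_set K) euclideanreal (\<lambda>r. ?\<phi> r k)" for k
      by (cases "k = 0") (simp_all add: snd_hl_chart)
    then show "continuous_map (top_of_set K) (subtopology (Euclidean_space 1) (?\<phi> ` K)) ?\<phi>"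
      unfolding continuous_map_in_subtopology continuous_map_Rn_iff by (auto simp: snd_hl_chart)
    show "continuous_map (subtopology (Euclidean_space 1) (?\<phi> ` K)) (top_of_set K) (\<lambda>x. x 0)"
      unfolding continuous_map_in_subtopology
      using continuous_map_from_subtopology[OF c0] by auto
    show "?\<phi> x 0 = x" for x
      by simp
    show "?\<phi> (x 0) = x" if "x \<in> topspace (subtopology (Euclidean_space 1) (?\<phi> ` K))" for x
      using that by auto
  qed
  then have ho: "homeomorphic_map (top_of_set K) (subtopology (Euclidean_space 1) (?\<phi> ` K)) ?\<phi>"
    by (rule homeomorphic_maps_imp_map)
  have "smooth_on 1 (?\<phi> ` K) (\<lambda>x. ?\<phi> (chart_inv (hl_chart K) x) 0)"
  proof (rule smooth_on_cong)
    show "smooth_on 1 (?\<phi> ` K) (\<lambda>x. x 0)"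
      by (rule smooth_on_coordinate) (unfold hl_chart_image, blast)
  qed (unfold hl_chart_image, simp add: chart_inv_hl_chart)
  moreover have "second_countable (top_of_set K)"
  proof (rule second_countable_subtopology)
    show "second_countable euclideanreal"
      unfolding second_countable_def
      using ex_countable_basis[where 'a=real] topological_basisE topological_basis_open by (metis open_openin)
  qed
  ultimately show ?thesis
    using op ho unfolding manifold_with_boundary_def manifold_modelled_on_def
    by (auto simp: Hausdorff_space_subtopology Hausdorff_space_euclidean subtopology_subtopology)
qed

lemma smooth_fun_half_line:
  assumes "smooth_on 1 {x \<in> Rn 1. x 0 \<in> K} (\<lambda>x. a (x 0))"
  shows "smooth_fun (half_line_mfd K) a"
  unfolding smooth_fun_def
proof
  fix c assume "c \<in> atlas (half_line_mfd K)"
  then have c: "c = hl_chart K"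
    by simp
  show "smooth_on (mdim (half_line_mfd K)) (snd c ` fst c) (\<lambda>x. a (chart_inv c x))"
    unfolding c half_line_simps hl_chart_simps hl_chart_image
    by (rule smooth_on_cong[OF assms]) (simp add: chart_inv_hl_chart)
qed

text \<open>The metric \<open>e dr^2\<close>. With a single chart the transformation law says that
  \<open>dr\<close> has component 1, at the endpoint as a one-sided derivative.\<close>

lemma pseudo_metric_half_line:
  assumes "perfect K" "smooth_fun (half_line_mfd K) e" "\<And>s. s \<in> K \<Longrightarrow> e s \<noteq> 0"
  shows "pseudo_metric (half_line_mfd K) (\<lambda>c i j s. e s)"
  unfolding pseudo_metric_iff
proof (intro conjI ballI)
  show "smooth_tensor2 (half_line_mfd K) (\<lambda>c i j s. e s)"
    using assms(2) differential_hl_chart[OF assms(1)]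
    by (simp add: smooth_tensor2_def smooth_fun_def)
qed (use assms(3) in \<open>simp_all add: symm_matrix_def nondegenerate_def\<close>)

section \<open>Doubly warped products\<close>

locale two_factors =
  fixes M1 :: "'a atlas_space" and g1 :: "'a tensor2" and M2 :: "'b atlas_space" and g2 :: "'b tensor2"
  assumes M1: "manifold M1" and M2: "manifold M2"
    and g1: "pseudo_metric M1 g1" and g2: "pseudo_metric M2 g2"
begin

abbreviation "m1 \<equiv> mdim M1"
abbreviation "m2 \<equiv> mdim M2"

definition "triple c1 c2 K = prod_chart m1 c1 (prod_chart m2 c2 (hl_chart K))"

definition "warped_mfd K = prod_mfd M1 (prod_mfd M2 (half_line_mfd K))"

definition "warped_block f h e c1 c2 p q s =
  block m1 (\<lambda>i j. f s * g1 c1 i j p) (block m2 (\<lambda>i j. h s * g2 c2 i j q) (\<lambda>i j. e s :: real))"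

text \<open>\<open>T\<close> is \<open>f g1 + h g2 + e dr^2\<close>. All charts of
  \<open>warped_mfd K\<close> are triples, so this fixes every component that counts.\<close>

definition "warped f h e K T \<longleftrightarrow>
  (\<forall>c1\<in>atlas M1. \<forall>c2\<in>atlas M2. \<forall>p\<in>fst c1. \<forall>q\<in>fst c2. \<forall>s\<in>K. \<forall>i<m1 + (m2 + 1). \<forall>j<m1 + (m2 + 1).
     T (triple c1 c2 K) i j (p, q, s) = warped_block f h e c1 c2 p q s i j)"

lemma warpedD:
  "warped f h e K T \<Longrightarrow> c1 \<in> atlas M1 \<Longrightarrow> c2 \<in> atlas M2 \<Longrightarrow> p \<in> fst c1 \<Longrightarrow> q \<in> fst c2 \<Longrightarrow> s \<in> K \<Longrightarrow>
   i < m1 + (m2 + 1) \<Longrightarrow> j < m1 + (m2 + 1) \<Longrightarrow>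
   T (triple c1 c2 K) i j (p, q, s) = warped_block f h e c1 c2 p q s i j"
  by (simp add: warped_def)

lemma mdim_warped [simp]: "mdim (warped_mfd K) = m1 + (m2 + 1)"
  by (simp add: warped_mfd_def)

lemma atlas_warped: "C \<in> atlas (warped_mfd K) \<longleftrightarrow> (\<exists>c1\<in>atlas M1. \<exists>c2\<in>atlas M2. C = triple c1 c2 K)"
  unfolding warped_mfd_def triple_def Bex_def atlas_prod_mfd half_line_simps singleton_iff by blast

lemma regular_M1: "c \<in> atlas M1 \<Longrightarrow> regular_chart m1 c"
  and regular_M2: "d \<in> atlas M2 \<Longrightarrow> regular_chart m2 d"
  using regular_atlas_manifold M1 M2 regular_atlasD by blast+

lemma regular_inner:
  "d \<in> atlas M2 \<Longrightarrow> perfect K \<Longrightarrow> regular_chart (m2 + 1) (prod_chart m2 d (hl_chart K))"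
  by (intro regular_prod_chart regular_hl_chart regular_M2)

text \<open>The metric \<open>h g2 + e dr^2\<close> on the last two factors. It splits the triple
  product into two products of two factors.\<close>

definition inner :: "(real \<Rightarrow> real) \<Rightarrow> (real \<Rightarrow> real) \<Rightarrow> ('b \<times> real) tensor2" where
  "inner h e c i j Q = h (snd Q) * pullback M2 fst g2 c i j Q + e (snd Q) * differential c snd i Q * differential c snd j Q"

lemma inner_chart:
  assumes "d \<in> atlas M2" "q \<in> fst d" "perfect K" "s \<in> K" "i < m2 + 1" "j < m2 + 1"
  shows "inner h e (prod_chart m2 d (hl_chart K)) i j (q, s) = block m2 (\<lambda>i j. h s * g2 d i j q) (\<lambda>i j. e s) i j"
proof -
  note r = regular_M2[OF assms(1)] regular_hl_chart[OF assms(3)] assms(2)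
  have s: "s \<in> fst (hl_chart K)"
    using assms(4) by simp
  have "pullback M2 fst g2 (prod_chart m2 d (hl_chart K)) i j (q, s) = (if i < m2 \<and> j < m2 then g2 d i j q else 0)"
    using pullback_fst[OF r s assms(5,6), of M2 "\<lambda>q. q" g2] pullback_id[OF pseudo_metricD(1)[OF g2] assms(1,2)]
    by (simp add: eta_contract_eq cong: if_cong)
  moreover have "differential (prod_chart m2 d (hl_chart K)) snd i (q, s) = (if i < m2 then 0 else 1)"
    if "i < m2 + 1" for i
    using differential_prod_snd[OF r s that, of "\<lambda>r. r"] differential_hl_chart[OF assms(3,4)] that
    by (auto simp: less_Suc_eq)
  ultimately show ?thesis
    using assms(5,6) by (auto simp: inner_def block_def)
qed

text \<open>One statement for both restrictions of a metric over \<open>J\<close>: to the interior,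
  with \<open>k = 1\<close> and \<open>K = J - {0}\<close>, and to the boundary, with
  \<open>k = 0\<close> and \<open>K = {0}\<close>, where no index for \<open>dr\<close>
  remains.\<close>

lemma pull_warped:
  assumes "warped f h e J T"
    and c: "c \<in> atlas M1" "c' \<in> atlas M1" "d \<in> atlas M2" "d' \<in> atlas M2"
    and pq: "p \<in> fst c" "p \<in> fst c'" "q \<in> fst d" "q \<in> fst d'"
    and s: "s \<in> K" "s \<in> J" and J: "perfect J"
    and K: "regular_chart k (hl_chart K)" "k \<le> 1" "k = 1 \<Longrightarrow> perfect K"
    and ij: "i < m1 + (m2 + k)" "j < m1 + (m2 + k)"
  shows "pull (m1 + (m2 + 1)) (triple c d K) (triple c' d' J) (\<lambda>P. P) T i j (p, q, s) =
    warped_block f h e c d p q s i j"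
proof -
  let ?D = "prod_chart m2 d (hl_chart K)" and ?D' = "prod_chart m2 d' (hl_chart J)"
  have rD: "regular_chart (m2 + k) ?D"
    by (rule regular_prod_chart[OF regular_M2[OF c(3)] K(1)])
  have inn: "pull (m2 + 1) ?D ?D' (\<lambda>Q. (fst Q, snd Q)) (inner h e) i j (q, s) =
      block m2 (\<lambda>i j. h s * g2 d i j q) (\<lambda>i j. e s) i j" if ij: "i < m2 + k" "j < m2 + k" for i j
  proof -
    have "pull (m2 + 1) ?D ?D' (\<lambda>Q. (fst Q, snd Q)) (inner h e) i j (q, s) =
      block m2 (\<lambda>i j. h s * pull m2 d d' (\<lambda>q. q) g2 i j q)
        (\<lambda>i j. pull 1 (hl_chart K) (hl_chart J) (\<lambda>s. s) (\<lambda>c i j s. e s) i j s) i j"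
      by (rule pull_prod[OF regular_M2[OF c(3)] K(1) pq(3) _ ij])
         (use inner_chart[OF c(4) pq(4) J s(2)] s(1) in simp_all)
    also have "\<dots> = block m2 (\<lambda>i j. h s * g2 d i j q) (\<lambda>i j. e s) i j"
    proof -
      have "pull m2 d d' (\<lambda>q. q) g2 a b q = g2 d a b q" if "a < m2" "b < m2" for a b
        using smooth_tensor2_pull[OF pseudo_metricD(1)[OF g2] c(3,4) pq(3,4) that] .
      \<comment> \<open>The coordinate \<open>r\<close> is the same over \<open>K\<close> and over
        \<open>J\<close>, so \<open>dr\<close> pulls back to \<open>dr\<close>; for
        \<open>k = 0\<close> this index is out of range.\<close>
      moreover have "pull 1 (hl_chart K) (hl_chart J) (\<lambda>s. s) (\<lambda>c i j s. e s) 0 0 s = e s" if "k = 1"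
        using differential_hl_chart[OF K(3)[OF that] s(1)] by (simp add: pull_def)
      moreover have "k = 0 \<or> k = 1"
        using K(2) by linarith
      ultimately show ?thesis
        using ij by (auto simp: block_def less_Suc_eq)
    qed
    finally show ?thesis .
  qed
  have "pull (m1 + (m2 + 1)) (triple c d K) (triple c' d' J) (\<lambda>P. (fst P, snd P)) T i j (p, q, s) =
      block m1 (\<lambda>i j. f s * pull m1 c c' (\<lambda>p. p) g1 i j p)
        (\<lambda>i j. pull (m2 + 1) ?D ?D' (\<lambda>Q. Q) (inner h e) i j (q, s)) i j"
    unfolding triple_def
  proof (rule pull_prod[OF regular_M1[OF c(1)] rD pq(1) _ ij])
    fix a b assume ab: "a < m1 + (m2 + 1)" "b < m1 + (m2 + 1)"
    have "T (triple c' d' J) a b (p, q, s) = warped_block f h e c' d' p q s a b"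
      by (rule warpedD[OF assms(1) c(2,4) pq(2,4) s(2) ab])
    also have "\<dots> = block m1 (\<lambda>k l. f s * g1 c' k l p) (\<lambda>k l. inner h e ?D' k l (q, s)) a b"
      unfolding warped_block_def block_def[of m1]
      using inner_chart[OF c(4) pq(4) J s(2), of "a - m1" "b - m1"] ab by auto
    finally show "T (prod_chart m1 c' ?D') a b (p, q, s) =
        block m1 (\<lambda>k l. f s * g1 c' k l p) (\<lambda>k l. inner h e ?D' k l (q, s)) a b"
      by (simp add: triple_def)
  qed (use pq s in simp)
  also have "\<dots> = warped_block f h e c d p q s i j"
    unfolding warped_block_def block_def[of m1]
    using inn[of "i - m1" "j - m1"] ij smooth_tensor2_pull[OF pseudo_metricD(1)[OF g1] c(1,2) pq(1,2)]
    by auto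
  finally show ?thesis
    by simp
qed

text \<open>\<open>pseudo_metric_prod\<close> is applied twice: with warping function
  \<open>h\<close> for \<open>M2\<close> over the half-line, then with \<open>f\<close> for
  \<open>M1\<close> over that product.\<close>

lemma warped_pseudo_metric:
  assumes T: "warped f h e K T" and K: "perfect K"
    and sm: "smooth_fun (half_line_mfd K) f" "smooth_fun (half_line_mfd K) h" "smooth_fun (half_line_mfd K) e"
    and nz: "\<And>s. s \<in> K \<Longrightarrow> f s \<noteq> 0" "\<And>s. s \<in> K \<Longrightarrow> h s \<noteq> 0" "\<And>s. s \<in> K \<Longrightarrow> e s \<noteq> 0"
  shows "pseudo_metric (warped_mfd K) T"
proof -
  have rK: "regular_atlas (half_line_mfd K)"
    using regular_hl_chart[OF K] by (simp add: regular_atlas_def)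
  note r1 = regular_atlas_manifold[OF M1] and r2 = regular_atlas_manifold[OF M2]
  have "pseudo_metric (prod_mfd M2 (half_line_mfd K)) (inner h e)"
  proof (rule pseudo_metric_prod[OF r2 g2 rK pseudo_metric_half_line[OF K sm(3) nz(3)] sm(2)])
    fix d q assume "d \<in> atlas (half_line_mfd K)" "q \<in> fst d"
    then show "h q \<noteq> 0"
      using nz by simp
  qed (use inner_chart K in auto)
  then show ?thesis
    unfolding warped_mfd_def
  proof (rule pseudo_metric_prod[OF r1 g1 regular_atlas_prod_mfd[OF r2 rK] _ smooth_fun_snd[OF r2 rK sm(1)]])
    fix D Q assume "D \<in> atlas (prod_mfd M2 (half_line_mfd K))" "Q \<in> fst D"
    then show "f (snd Q) \<noteq> 0"
      using nz by (auto simp: atlas_prod_mfd)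
  next
    fix c D p Q i j
    assume *: "c \<in> atlas M1" "D \<in> atlas (prod_mfd M2 (half_line_mfd K))" "p \<in> fst c" "Q \<in> fst D"
      "i < m1 + mdim (prod_mfd M2 (half_line_mfd K))" "j < m1 + mdim (prod_mfd M2 (half_line_mfd K))"
    then obtain d where d: "d \<in> atlas M2" "D = prod_chart m2 d (hl_chart K)"
      by (auto simp: atlas_prod_mfd)
    obtain q s where Q: "Q = (q, s)" "q \<in> fst d" "s \<in> K"
      using * d by auto
    have ij: "i < m1 + (m2 + 1)" "j < m1 + (m2 + 1)"
      using * by simp_all
    have "T (prod_chart m1 c D) i j (p, Q) = warped_block f h e c d p q s i j"
      using warpedD[OF T *(1) d(1) *(3) Q(2,3) ij] by (simp add: triple_def d(2) Q(1))
    also have "\<dots> = block m1 (\<lambda>i j. f (snd Q) * g1 c i j p) (\<lambda>i j. inner h e D i j Q) i j"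
      unfolding warped_block_def block_def[of m1] d(2) Q(1)
      using inner_chart[OF d(1) Q(2) K Q(3), of "i - m1" "j - m1"] ij by auto
    finally show "T (prod_chart m1 c D) i j (p, Q) =
        block m1 (\<lambda>i j. f (snd Q) * g1 c i j p) (\<lambda>i j. inner h e D i j Q) i j" .
  qed
qed

end

section \<open>Interior, boundary and explicit metric of the warped product\<close>

context two_factors
begin

text \<open>For \<open>m2 = 0\<close> the \<open>g2\<close> block is empty, so its coefficient may
  be exchanged, in particular for one without zeros.\<close>

lemma warped_block_cong:
  assumes "f s = f' s" "m2 \<noteq> 0 \<Longrightarrow> h s = h' s" "e s = e' s"
  shows "warped_block f h e c d p q s = warped_block f' h' e' c d p q s"
  using assms by (cases "m2 = 0") (simp_all add: warped_block_def block_def fun_eq_iff)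

lemma fst_triple [simp]: "fst (triple c d K) = fst c \<times> fst d \<times> K"
  by (simp add: triple_def)

lemma snd_triple_indep: "snd (triple c d J) = snd (triple c d K)"
  by (simp only: triple_def prod_chart_def hl_chart_def fst_conv snd_conv)

text \<open>The coordinate map of a triple does not mention \<open>K\<close>, so cutting down the
  domain of a triple gives a triple again. This is why interior and boundary are equal to
  products.\<close>

lemma triple_restrict: "X = fst c \<times> fst d \<times> K \<Longrightarrow> (X, snd (triple c d J)) = triple c d K"
  using snd_triple_indep[of c d J K] by (simp add: prod_eq_iff)

lemma snd_triple_last [simp]: "snd (triple c d K) (p, q, s) (m1 + m2) = s"
  by (simp add: triple_def snd_prod_chart joinc_def)

sublocale M1: manifold_on "topspace (Euclidean_space m1)" M1
  using M1 by unfold_locales (simp add: manifold_def)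

sublocale M2: manifold_on "topspace (Euclidean_space m2)" M2
  using M2 by unfold_locales (simp add: manifold_def)

lemma atlas_warped_image: "atlas (warped_mfd K) = (\<lambda>(c, d). triple c d K) ` (atlas M1 \<times> atlas M2)"
  by (intro Set.set_eqI) (simp add: atlas_warped image_iff)

lemma topspace_warped: "topspace (mtop (warped_mfd K)) = topspace (mtop M1) \<times> topspace (mtop M2) \<times> K"
  by (simp add: warped_mfd_def)

text \<open>The last coordinate of a product chart is \<open>r\<close>.\<close>

lemma boundary_points_warped:
  assumes "0 \<in> J"
  shows "boundary_points (warped_mfd J) = topspace (mtop M1) \<times> topspace (mtop M2) \<times> {0}"
proof (intro Set.set_eqI iffI)
  fix P assume "P \<in> boundary_points (warped_mfd J)"
  then obtain C where "C \<in> atlas (warped_mfd J)" "P \<in> fst C" "snd C P (m1 + m2) = 0"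
    unfolding boundary_points_def by auto
  then obtain c d where cd: "c \<in> atlas M1" "d \<in> atlas M2" "P \<in> fst (triple c d J)"
    "snd (triple c d J) P (m1 + m2) = 0"
    using atlas_warped by metis
  obtain p q s where "P = (p, q, s)"
    by (cases P)
  then show "P \<in> topspace (mtop M1) \<times> topspace (mtop M2) \<times> {0}"
    using cd M1.dom_subset[OF cd(1)] M2.dom_subset[OF cd(2)] by auto
next
  fix P assume "P \<in> topspace (mtop M1) \<times> topspace (mtop M2) \<times> {0 :: real}"
  then obtain p q where P: "P = (p, q, 0)" "p \<in> topspace (mtop M1)" "q \<in> topspace (mtop M2)"
    by auto
  obtain c d where cd: "c \<in> atlas M1" "p \<in> fst c" "d \<in> atlas M2" "q \<in> fst d"
    using P M1.chart_at M2.chart_at by blast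
  have "triple c d J \<in> atlas (warped_mfd J)" "P \<in> fst (triple c d J) \<and> snd (triple c d J) P (m1 + m2) = 0"
    using cd P assms atlas_warped by (blast, simp_all)
  then show "P \<in> boundary_points (warped_mfd J)"
    unfolding boundary_points_def by (simp del: fst_triple) blast
qed

lemma mfd_interior_warped:
  assumes J: "0 \<in> J"
  shows "mfd_interior (warped_mfd J) = warped_mfd (J - {0})"
proof -
  let ?b = "boundary_points (warped_mfd J)"
  note b = boundary_points_warped[OF J]
  have d: "topspace (mtop (warped_mfd J)) - ?b = topspace (mtop M1) \<times> topspace (mtop M2) \<times> (J - {0})"
    unfolding b topspace_warped by auto
  have "mtop (mfd_interior (warped_mfd J)) = mtop (warped_mfd (J - {0}))"
    unfolding mfd_interior_def atlas_space.simps d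
    by (simp add: warped_mfd_def subtopology_Times subtopology_subtopology Int_absorb1)
  moreover have "atlas (mfd_interior (warped_mfd J)) = atlas (warped_mfd (J - {0}))"
    unfolding mfd_interior_def atlas_space.simps atlas_warped_image image_image
  proof (rule image_cong[OF refl], clarsimp)
    fix c1 f1 c2 f2 assume "(c1, f1) \<in> atlas M1" "(c2, f2) \<in> atlas M2"
    then have "c1 \<subseteq> topspace (mtop M1)" "c2 \<subseteq> topspace (mtop M2)"
      using M1.dom_subset M2.dom_subset by fastforce+
    then have "c1 \<times> c2 \<times> J - ?b = fst (c1, f1) \<times> fst (c2, f2) \<times> (J - {0})"
      unfolding b by auto
    then show "(c1 \<times> c2 \<times> J - ?b, snd (triple (c1, f1) (c2, f2) J)) = triple (c1, f1) (c2, f2) (J - {0})"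
      by (rule triple_restrict)
  qed
  moreover have "mdim (mfd_interior (warped_mfd J)) = mdim (warped_mfd (J - {0}))"
    by (simp add: mfd_interior_def)
  ultimately show ?thesis
    by (intro atlas_space.equality) simp_all
qed

text \<open>\<open>mfd_boundary\<close> keeps the coordinate maps and lowers the dimension by one.
  With the dimension of the point 0 reset to 0 the boundary is literally
  \<open>M1 x M2 x origin\<close>.\<close>

definition "origin = half_line_mfd {0}\<lparr>mdim := 0\<rparr>"

definition "boundary_mfd = prod_mfd M1 (prod_mfd M2 origin)"

lemma origin_simps [simp]: "mtop origin = subtopology euclideanreal {0}" "atlas origin = {hl_chart {0}}" "mdim origin = 0"
  by (simp_all add: origin_def half_line_mfd_def hl_chart_def)

lemma atlas_boundary: "C \<in> atlas boundary_mfd \<longleftrightarrow> (\<exists>c\<in>atlas M1. \<exists>d\<in>atlas M2. C = triple c d {0})"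
  unfolding boundary_mfd_def triple_def Bex_def atlas_prod_mfd origin_simps singleton_iff by blast

lemma mdim_boundary [simp]: "mdim boundary_mfd = m1 + (m2 + 0)"
  by (simp add: boundary_mfd_def)

lemma mfd_boundary_warped:
  assumes J: "0 \<in> J"
  shows "mfd_boundary (warped_mfd J) = boundary_mfd"
proof -
  note b = boundary_points_warped[OF J]
  have "mtop (mfd_boundary (warped_mfd J)) = mtop boundary_mfd"
    unfolding mfd_boundary_def atlas_space.simps b
    using J by (simp add: warped_mfd_def boundary_mfd_def subtopology_Times subtopology_subtopology Int_absorb1)
  moreover have "atlas (mfd_boundary (warped_mfd J)) = atlas boundary_mfd"
  proof -
    have "atlas boundary_mfd = (\<lambda>(c, d). triple c d {0}) ` (atlas M1 \<times> atlas M2)"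
      by (intro Set.set_eqI) (simp add: atlas_boundary image_iff)
    then show ?thesis
      unfolding mfd_boundary_def atlas_space.simps atlas_warped_image image_image
    proof (elim ssubst, intro image_cong[OF refl], clarsimp)
      fix c1 f1 c2 f2 assume "(c1, f1) \<in> atlas M1" "(c2, f2) \<in> atlas M2"
      then have "c1 \<subseteq> topspace (mtop M1)" "c2 \<subseteq> topspace (mtop M2)"
        using M1.dom_subset M2.dom_subset by fastforce+
      then have "c1 \<times> c2 \<times> J \<inter> boundary_points (warped_mfd J) = fst (c1, f1) \<times> fst (c2, f2) \<times> {0}"
        unfolding b using J by auto
      then show "(c1 \<times> c2 \<times> J \<inter> boundary_points (warped_mfd J), snd (triple (c1, f1) (c2, f2) J)) = triple (c1, f1) (c2, f2) {0}"
        by (rule triple_restrict)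
    qed
  qed
  moreover have "mdim (mfd_boundary (warped_mfd J)) = mdim boundary_mfd"
    by (simp add: mfd_boundary_def)
  ultimately show ?thesis
    by (intro atlas_space.equality) simp_all
qed

lemma warped_mfd_with_boundary:
  assumes "openin (top_of_set {0..}) J"
  shows "manifold_with_boundary (warped_mfd J)"
  unfolding warped_mfd_def
  by (intro prod_manifold_with_boundary M1 M2 half_line_manifold assms) simp_all

definition emb :: "'a \<times> 'b \<Rightarrow> 'a \<times> 'b \<times> real" where
  "emb = (\<lambda>(p, q). (p, q, 0))"

lemma diffeo_boundary: "diffeo (prod_mfd M1 M2) boundary_mfd emb"
proof -
  let ?G = "\<lambda>(p, q, s :: real). (p, q)"
  have tr1: "smooth_on m1 (snd c ` (fst c \<inter> fst c')) (\<lambda>x. snd c' (chart_inv c x) k)"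
    if "c \<in> atlas M1" "c' \<in> atlas M1" "k < m1" for c c' k
    using M1.smooth_transition that by blast
  have tr2: "smooth_on m2 (snd d ` (fst d \<inter> fst d')) (\<lambda>x. snd d' (chart_inv d x) k)"
    if "d \<in> atlas M2" "d' \<in> atlas M2" "k < m2" for d d' k
    using M2.smooth_transition that by blast
  note r1 = regular_chartD(1,2)[OF regular_M1] and r2 = regular_chartD(1,2)[OF regular_M2]
  have "smooth_map (prod_mfd M1 M2) boundary_mfd emb"
    unfolding smooth_map_def
  proof (intro conjI ballI allI impI)
    show "continuous_map (mtop (prod_mfd M1 M2)) (mtop boundary_mfd) emb"
      unfolding emb_def boundary_mfd_def mtop_prod_mfd origin_simps case_prod_beta
      by (intro continuous_map_pairedI continuous_map_fst continuous_map_snd) simp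
    fix C C' k assume C: "C \<in> atlas (prod_mfd M1 M2)" "C' \<in> atlas boundary_mfd" and k: "k < mdim boundary_mfd"
    then obtain c d c' d' where cd: "c \<in> atlas M1" "d \<in> atlas M2" "C = prod_chart m1 c d"
      "c' \<in> atlas M1" "d' \<in> atlas M2" "C' = triple c' d' {0}"
      by (metis atlas_prod_mfd atlas_boundary)
    have dom: "fst C \<inter> emb -` fst C' = (fst c \<inter> fst c') \<times> (fst d \<inter> fst d')"
      by (auto simp: cd emb_def)
    have "smooth_on (m1 + m2) (snd C ` (fst C \<inter> emb -` fst C'))
       (\<lambda>x. snd (prod_chart m1 c' d') (fst (chart_inv C x), snd (chart_inv C x)) k)"
      unfolding dom unfolding cd(3) using k cd
      by (intro smooth_on_prod_chart r1 r2 tr1 tr2) auto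
    \<comment> \<open>The third factor would contribute the index \<open>m1 + m2\<close>, which is
      out of range; the remaining coordinates are those of \<open>Q\<close>.\<close>
    moreover have "snd C' (emb Q) k = snd (prod_chart m1 c' d') (fst Q, snd Q) k" for Q
      using k by (auto simp: cd(6) triple_def snd_prod_chart joinc_def emb_def case_prod_beta)
    ultimately show "smooth_on (mdim (prod_mfd M1 M2)) (snd C ` (fst C \<inter> emb -` fst C')) (\<lambda>x. snd C' (emb (chart_inv C x)) k)"
      by simp
  qed
  moreover have "smooth_map boundary_mfd (prod_mfd M1 M2) ?G"
    unfolding smooth_map_def
  proof (intro conjI ballI allI impI)
    show "continuous_map (mtop boundary_mfd) (mtop (prod_mfd M1 M2)) ?G"
      unfolding boundary_mfd_def mtop_prod_mfd case_prod_beta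
      by (intro continuous_map_pairedI continuous_map_fst continuous_map_compose[OF continuous_map_snd continuous_map_fst, unfolded o_def])
    fix C C' k assume C: "C \<in> atlas boundary_mfd" "C' \<in> atlas (prod_mfd M1 M2)" and k: "k < mdim (prod_mfd M1 M2)"
    then obtain c d c' d' where cd: "c \<in> atlas M1" "d \<in> atlas M2" "C = triple c d {0}"
      "c' \<in> atlas M1" "d' \<in> atlas M2" "C' = prod_chart m1 c' d'"
      by (metis atlas_prod_mfd atlas_boundary)
    let ?d = "prod_chart m2 d (hl_chart {0})"
    have dom: "fst C \<inter> ?G -` fst C' = (fst c \<inter> fst c') \<times> ((fst d \<inter> fst d') \<times> {0})"
      by (auto simp: cd)
    have rd: "regular_chart (m2 + 0) ?d"
      using cd by (intro regular_prod_chart regular_M2 regular_hl_chart_0)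
    have 2: "smooth_on (m2 + 0) (snd ?d ` ((fst d \<inter> fst d') \<times> {0})) (\<lambda>x. snd d' (fst (chart_inv ?d x)) l)" if l: "l < m2" for l
    proof -
      have "smooth_on (m2 + 0) (snd ?d ` ((fst d \<inter> fst d') \<times> {0}))
         (\<lambda>x. snd (prod_chart m2 d' (hl_chart {0})) (fst (chart_inv ?d x), snd (chart_inv ?d x)) l)"
        using l cd by (intro smooth_on_prod_chart r2 tr2 regular_chartD(1,2)[OF regular_hl_chart_0]) auto
      then show ?thesis
        using l by (simp add: snd_prod_chart joinc_def)
    qed
    have "smooth_on (m1 + (m2 + 0)) (snd C ` (fst C \<inter> ?G -` fst C'))
       (\<lambda>x. snd (prod_chart m1 c' d') (fst (chart_inv C x), fst (snd (chart_inv C x))) k)"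
      unfolding dom unfolding cd(3) triple_def using k cd
      by (intro smooth_on_prod_chart r1 regular_chartD(1,2)[OF rd] tr1 2) auto
    then show "smooth_on (mdim boundary_mfd) (snd C ` (fst C \<inter> ?G -` fst C')) (\<lambda>x. snd C' (?G (chart_inv C x)) k)"
      by (simp add: cd(6) case_prod_beta)
  qed
  ultimately show ?thesis
    unfolding diffeo_def by (intro conjI exI[of _ ?G]) (auto simp: emb_def boundary_mfd_def)
qed

text \<open>\<open>r^2 g12\<close> without the division, hence meaningful on the boundary.\<close>

definition gbar :: "real \<Rightarrow> ('a \<times> 'b \<times> real) tensor2" where
  "gbar \<mu> c i j P =
     (let r = (\<lambda>(p, q, r). r) in
        differential c r i P * differential c r j P
         + (1 - \<mu> * (r P)\<^sup>2 / 2)\<^sup>2 * pullback M1 fst g1 c i j P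
         + (1 + \<mu> * (r P)\<^sup>2 / 2)\<^sup>2 * pullback M2 (\<lambda>(p, q, r). q) g2 c i j P)"

lemma g12_gbar: "g12 M1 g1 M2 g2 \<mu> c i j P = gbar \<mu> c i j P / (snd (snd P))\<^sup>2"
  by (simp add: g12_def gbar_def Let_def case_prod_beta)

lemma differential_triple:
  assumes "c \<in> atlas M1" "d \<in> atlas M2" "p \<in> fst c" "q \<in> fst d" "perfect K" "s \<in> K" "i < m1 + (m2 + 1)"
  shows "differential (triple c d K) (\<lambda>(p, q, r). r) i (p, q, s) = (if i = m1 + m2 then 1 else 0)"
proof -
  have s: "s \<in> fst (hl_chart K)" and qs: "(q, s) \<in> fst (prod_chart m2 d (hl_chart K))"
    using assms by simp_all
  have 1: "differential (triple c d K) (\<lambda>P. snd (snd P)) i (p, q, s) =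
     (if i < m1 then 0 else differential (prod_chart m2 d (hl_chart K)) (\<lambda>Q. snd Q) (i - m1) (q, s))"
    unfolding triple_def
    by (rule differential_prod_snd[OF regular_M1[OF assms(1)] regular_inner[OF assms(2,5)] assms(3) qs assms(7)])
  have 2: "differential (prod_chart m2 d (hl_chart K)) (\<lambda>Q. snd Q) (i - m1) (q, s) = (if i - m1 < m2 then 0 else 1)" if "\<not> i < m1"
  proof -
    have i: "i - m1 < m2 + 1"
      using assms(7) that by linarith
    show ?thesis
      using differential_prod_snd[OF regular_M2[OF assms(2)] regular_hl_chart[OF assms(5)] assms(4) s i, of "\<lambda>r. r"]
        differential_hl_chart[OF assms(5,6)] i by (auto simp: less_Suc_eq)
  qed
  have "differential (triple c d K) (\<lambda>P. snd (snd P)) i (p, q, s) = (if i = m1 + m2 then 1 else 0)"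
    using assms(7) 1 2 by (cases "i < m1") auto
  moreover have "(\<lambda>P. snd (snd P)) = (\<lambda>(p :: 'a, q :: 'b, r :: real). r)"
    by auto
  ultimately show ?thesis
    by simp
qed

lemma warped_gbar:
  assumes K: "perfect K"
  shows "warped (\<lambda>s. (1 - \<mu> * s\<^sup>2 / 2)\<^sup>2) (\<lambda>s. (1 + \<mu> * s\<^sup>2 / 2)\<^sup>2) (\<lambda>s. 1) K (gbar \<mu>)"
  unfolding warped_def
proof (intro ballI allI impI)
  fix c d p q s i j
  assume c: "c \<in> atlas M1" and d: "d \<in> atlas M2" and p: "p \<in> fst c" and q: "q \<in> fst d" and s: "s \<in> K"
    and i: "i < m1 + (m2 + 1)" and j: "j < m1 + (m2 + 1)"
  let ?d = "prod_chart m2 d (hl_chart K)"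
  have s': "s \<in> fst (hl_chart K)" and qs: "(q, s) \<in> fst ?d"
    using q s by simp_all
  have 1: "pullback M1 fst g1 (triple c d K) i j (p, q, s) = (if i < m1 \<and> j < m1 then g1 c i j p else 0)"
    using pullback_fst[OF regular_M1[OF c] regular_inner[OF d K] p qs i j, of M1 "\<lambda>p. p" g1]
      pullback_id[OF pseudo_metricD(1)[OF g1] c p] by (simp add: triple_def cong: if_cong)
  have 2: "pullback M2 (\<lambda>(p, q, r). q) g2 (triple c d K) i j (p, q, s) =
      (if m1 \<le> i \<and> i < m1 + m2 \<and> m1 \<le> j \<and> j < m1 + m2 then g2 d (i - m1) (j - m1) q else 0)"
  proof -
    have 3: "pullback M2 (\<lambda>P. fst (snd P)) g2 (triple c d K) i j (p, q, s) =
        (if i < m1 \<or> j < m1 then 0 else pullback M2 (\<lambda>Q. fst Q) g2 ?d (i - m1) (j - m1) (q, s))"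
      unfolding triple_def by (rule pullback_snd[OF regular_M1[OF c] regular_inner[OF d K] p qs i j])
    have 4: "pullback M2 (\<lambda>Q. fst Q) g2 ?d (i - m1) (j - m1) (q, s) =
        (if i - m1 < m2 \<and> j - m1 < m2 then g2 d (i - m1) (j - m1) q else 0)" if "\<not> (i < m1 \<or> j < m1)"
    proof -
      have ij: "i - m1 < m2 + 1" "j - m1 < m2 + 1"
        using i j that by linarith+
      show ?thesis
        using pullback_fst[OF regular_M2[OF d] regular_hl_chart[OF K] q s' ij, of M2 "\<lambda>p. p" g2]
          pullback_id[OF pseudo_metricD(1)[OF g2] d q] by (simp cong: if_cong)
    qed
    have "pullback M2 (\<lambda>P. fst (snd P)) g2 (triple c d K) i j (p, q, s) =
      (if m1 \<le> i \<and> i < m1 + m2 \<and> m1 \<le> j \<and> j < m1 + m2 then g2 d (i - m1) (j - m1) q else 0)"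
      using 3 4 by (cases "i < m1 \<or> j < m1") auto
    moreover have "(\<lambda>P. fst (snd P)) = (\<lambda>(p :: 'a, q :: 'b, r :: real). q)"
      by auto
    ultimately show ?thesis
      by simp
  qed
  show "gbar \<mu> (triple c d K) i j (p, q, s) =
      warped_block (\<lambda>s. (1 - \<mu> * s\<^sup>2 / 2)\<^sup>2) (\<lambda>s. (1 + \<mu> * s\<^sup>2 / 2)\<^sup>2) (\<lambda>s. 1) c d p q s i j"
    unfolding gbar_def Let_def 1 2 differential_triple[OF c d p q K s i] differential_triple[OF c d p q K s j]
    using i j by (auto simp: warped_block_def block_def)
qed

lemma warped_g12:
  assumes K: "perfect K"
  shows "warped (\<lambda>s. (1 - \<mu> * s\<^sup>2 / 2)\<^sup>2 / s\<^sup>2) (\<lambda>s. (1 + \<mu> * s\<^sup>2 / 2)\<^sup>2 / s\<^sup>2) (\<lambda>s. 1 / s\<^sup>2) K (g12 M1 g1 M2 g2 \<mu>)"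
  unfolding warped_def
proof (intro ballI allI impI)
  fix c d p q s i j
  assume "c \<in> atlas M1" "d \<in> atlas M2" "p \<in> fst c" "q \<in> fst d" "s \<in> K" "i < m1 + (m2 + 1)" "j < m1 + (m2 + 1)"
  from warpedD[OF warped_gbar[OF K] this]
  show "g12 M1 g1 M2 g2 \<mu> (triple c d K) i j (p, q, s) =
      warped_block (\<lambda>s. (1 - \<mu> * s\<^sup>2 / 2)\<^sup>2 / s\<^sup>2) (\<lambda>s. (1 + \<mu> * s\<^sup>2 / 2)\<^sup>2 / s\<^sup>2) (\<lambda>s. 1 / s\<^sup>2) c d p q s i j"
    unfolding g12_gbar by (auto simp: warped_block_def block_def)
qed

lemma product_metric_chart:
  assumes "c \<in> atlas M1" "d \<in> atlas M2" "p \<in> fst c" "q \<in> fst d" "i < m1 + m2" "j < m1 + m2"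
  shows "product_metric M1 g1 M2 g2 (prod_chart m1 c d) i j (p, q) =
    block m1 (\<lambda>i j. g1 c i j p) (\<lambda>i j. g2 d i j q) i j"
proof -
  note r = regular_M1[OF assms(1)] regular_M2[OF assms(2)] assms(3-6)
  show ?thesis
    using pullback_fst[OF r, of M1 "\<lambda>p. p" g1] pullback_snd[OF r, of M2 "\<lambda>p. p" g2] assms(5,6)
      pullback_id[OF pseudo_metricD(1)[OF g1] assms(1,3)] pullback_id[OF pseudo_metricD(1)[OF g2] assms(2,4), of "i - m1" "j - m1"]
    by (auto simp: product_metric_def block_def)
qed

end

section \<open>The Poincare-Einstein metric\<close>

text \<open>\<open>F^2\<close> for \<open>F = 1/s - \<mu> s / 2\<close>; replacing
  \<open>\<mu>\<close> by \<open>- \<mu>\<close> gives \<open>H^2\<close>.\<close>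

definition "coef \<mu> s = (1 - \<mu> * s\<^sup>2 / 2)\<^sup>2 / s\<^sup>2" for \<mu> s :: real

text \<open>\<open>F' / F\<close>, half the logarithmic derivative of \<open>coef \<mu>\<close>,
  rewritten by \<open>s F' = - H\<close>.\<close>

definition "dcoef \<mu> s = - ((1 + \<mu> * s\<^sup>2 / 2) / (s * (1 - \<mu> * s\<^sup>2 / 2)))" for \<mu> s :: real

text \<open>\<open>s F H\<close>, the value of \<open>\<phi>\<close> forced by
  \<open>\<phi> e = - u f\<close> with \<open>e = 1 / s^2\<close>. It is even in
  \<open>\<mu>\<close>, so both factors share it.\<close>

definition "ncoef \<mu> s = 1 / s - \<mu>\<^sup>2 * s ^ 3 / 4" for \<mu> s :: real

lemma ncoef_eq: "s \<noteq> 0 \<Longrightarrow> ncoef \<mu> s = (1 - \<mu> * s\<^sup>2 / 2) * (1 + \<mu> * s\<^sup>2 / 2) / s"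
  by (simp add: ncoef_def field_simps power2_eq_square power3_eq_cube)

lemma coef_deriv:
  assumes "s \<noteq> 0" "1 - \<mu> * s\<^sup>2 / 2 \<noteq> 0"
  shows "(coef \<mu> has_real_derivative 2 * dcoef \<mu> s * coef \<mu> s) (at s)"
proof -
  have "((\<lambda>s. (1 - \<mu> * s\<^sup>2 / 2)\<^sup>2 / s\<^sup>2) has_real_derivative
      (2 * (1 - \<mu> * s\<^sup>2 / 2) * (- (\<mu> * s)) * s\<^sup>2 - (1 - \<mu> * s\<^sup>2 / 2)\<^sup>2 * (2 * s)) / (s\<^sup>2 * s\<^sup>2)) (at s)"
    using assms by (auto intro!: derivative_eq_intros)
  \<comment> \<open>In terms of \<open>a\<close> one has \<open>\<mu> s^2 = 2 - 2 a\<close> and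
    \<open>1 + \<mu> s^2 / 2 = 2 - a\<close>.\<close>
  moreover have "(2 * a * (- (\<mu> * s)) * s\<^sup>2 - a\<^sup>2 * (2 * s)) / (s\<^sup>2 * s\<^sup>2) =
      2 * (- ((2 - a) / (s * a))) * (a\<^sup>2 / s\<^sup>2)" if "a \<noteq> 0" "a = 1 - \<mu> * s\<^sup>2 / 2" for a
  proof -
    have m: "\<mu> * s * s = 2 - 2 * a"
      using that(2) by (simp add: power2_eq_square)
    have "2 * a * (- (\<mu> * s)) * s\<^sup>2 - a\<^sup>2 * (2 * s) = - (2 * a * s * (\<mu> * s * s + a))"
      by (simp add: power2_eq_square algebra_simps)
    also have "\<dots> = - (2 * a * s * (2 - a))"
      unfolding m by simp
    finally have eq: "2 * a * (- (\<mu> * s)) * s\<^sup>2 - a\<^sup>2 * (2 * s) = - (2 * a * s * (2 - a))" .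
    show ?thesis
      unfolding eq using that(1) assms(1) by (simp add: power2_eq_square)
  qed
  ultimately show ?thesis
    using assms(2) by (simp add: coef_def[abs_def] dcoef_def)
qed

text \<open>The Riccati form of the linear equation \<open>s (s F')' = F\<close>.\<close>

lemma dcoef_deriv:
  assumes "s \<noteq> 0" "1 - \<mu> * s\<^sup>2 / 2 \<noteq> 0"
  shows "(dcoef \<mu> has_real_derivative 1 / s\<^sup>2 - (dcoef \<mu> s)\<^sup>2 - dcoef \<mu> s / s) (at s)"
proof -
  define a b where "a = 1 - \<mu> * s\<^sup>2 / 2" and "b = 1 + \<mu> * s\<^sup>2 / 2"
  have "(dcoef \<mu> has_real_derivative - (((\<mu> * s) * (s * a) - b * (a + s * (- (\<mu> * s)))) / ((s * a) * (s * a)))) (at s)"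
    unfolding dcoef_def[abs_def] a_def b_def using assms by (auto intro!: derivative_eq_intros)
  moreover have "- (((\<mu> * s) * (s * a) - b * (a + s * (- (\<mu> * s)))) / ((s * a) * (s * a))) =
      1 / s\<^sup>2 - (- (b / (s * a)))\<^sup>2 - (- (b / (s * a))) / s"
  proof -
    have a: "a \<noteq> 0" "b = 2 - a"
      using assms by (simp_all add: a_def b_def)
    have m: "\<mu> * s * s = 2 - 2 * a"
      by (simp add: a_def power2_eq_square)
    have "(\<mu> * s) * (s * a) - b * (a + s * (- (\<mu> * s))) = (\<mu> * s * s) * a - b * (a - \<mu> * s * s)"
      by (simp add: algebra_simps)
    also have "\<dots> = - (a\<^sup>2 - b\<^sup>2 + b * a)"
      unfolding m a(2) by (simp add: power2_eq_square algebra_simps)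
    finally have eq: "(\<mu> * s) * (s * a) - b * (a + s * (- (\<mu> * s))) = - (a\<^sup>2 - b\<^sup>2 + b * a)" .
    have "- (((\<mu> * s) * (s * a) - b * (a + s * (- (\<mu> * s)))) / ((s * a) * (s * a))) =
       (a\<^sup>2 - b\<^sup>2 + b * a) / ((s * a) * (s * a))"
      unfolding eq minus_divide_left minus_minus ..
    also have "\<dots> = 1 / s\<^sup>2 - (- (b / (s * a)))\<^sup>2 - (- (b / (s * a))) / s"
      using a(1) assms(1) by (simp add: field_simps power2_eq_square)
    finally show ?thesis .
  qed
  ultimately show ?thesis
    by (simp add: dcoef_def a_def b_def)
qed

lemma ncoef_deriv: "s \<noteq> 0 \<Longrightarrow> (ncoef \<mu> has_real_derivative - (1 / s\<^sup>2) - 3 * \<mu>\<^sup>2 * s\<^sup>2 / 4) (at s)"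
proof -
  assume "s \<noteq> 0"
  then have "((\<lambda>s. 1 / s - \<mu>\<^sup>2 * s ^ 3 / 4) has_real_derivative (0 * s - 1 * 1) / (s * s) - \<mu>\<^sup>2 * (real 3 * 1 * s ^ (3 - 1)) / 4) (at s)"
    by (intro DERIV_diff DERIV_divide DERIV_const DERIV_ident DERIV_cdivide DERIV_cmult DERIV_power[THEN DERIV_cong]) simp_all
  then show ?thesis
    by (simp add: ncoef_def[abs_def] power2_eq_square mult.assoc mult.left_commute)
qed

text \<open>The product of \<open>- H / (s F)\<close> and \<open>s F H\<close> is
  \<open>- H^2\<close>.\<close>

lemma dcoef_ncoef:
  assumes "s \<noteq> 0" "1 - \<mu> * s\<^sup>2 / 2 \<noteq> 0"
  shows "dcoef \<mu> s * ncoef \<mu> s = - ((1 + \<mu> * s\<^sup>2 / 2)\<^sup>2 / s\<^sup>2)"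
proof -
  have "- (b / (s * a)) * (a * b / s) = - (b\<^sup>2 / s\<^sup>2)" if "a \<noteq> 0" for a b :: real
    using that by (simp add: power2_eq_square)
  from this[OF assms(2)] show ?thesis
    unfolding ncoef_eq[OF assms(1)] dcoef_def .
qed

lemma coef_relation:
  assumes "s \<noteq> 0" "1 - \<mu> * s\<^sup>2 / 2 \<noteq> 0"
  shows "ncoef \<mu> s * (1 / s\<^sup>2) = - (dcoef \<mu> s * coef \<mu> s)"
proof -
  have "(a * b / s) * (1 / s\<^sup>2) = - (- (b / (s * a)) * (a\<^sup>2 / s\<^sup>2))" if "a \<noteq> 0" for a b :: real
    using that by (simp add: power2_eq_square)
  from this[OF assms(2)] show ?thesis
    unfolding ncoef_eq[OF assms(1)] dcoef_def coef_def .
qed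

text \<open>Used for both factors: exchanging them amounts to \<open>\<mu> \<mapsto> - \<mu>\<close>. The last hypothesis is void if
  \<open>N = 0\<close>, where the other factor may be degenerate.\<close>

lemma einstein_coefficient:
  assumes "s \<noteq> 0" "1 - \<mu> * s\<^sup>2 / 2 \<noteq> 0" "N * (v * ncoef \<mu> s) = - (N * coef \<mu> s)"
  shows "2 * (M - 1) * \<mu> + (- (1 / s\<^sup>2) - 3 * \<mu>\<^sup>2 * s\<^sup>2 / 4 +
      (M * dcoef \<mu> s + N * v + - (1 / s) - 2 * dcoef \<mu> s) * ncoef \<mu> s) = - (M + N) * coef \<mu> s"
proof -
  have "(M * dcoef \<mu> s + N * v + - (1 / s) - 2 * dcoef \<mu> s) * ncoef \<mu> s =
      (M - 2) * (dcoef \<mu> s * ncoef \<mu> s) + N * (v * ncoef \<mu> s) - ncoef \<mu> s / s"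
    by (simp add: algebra_simps)
  also have "\<dots> = - ((M - 2) * ((1 + \<mu> * s\<^sup>2 / 2)\<^sup>2 / s\<^sup>2)) - N * coef \<mu> s - (1 / s - \<mu>\<^sup>2 * s ^ 3 / 4) / s"
    unfolding assms(3) dcoef_ncoef[OF assms(1,2)] by (simp add: ncoef_def)
  finally have eq: "(M * dcoef \<mu> s + N * v + - (1 / s) - 2 * dcoef \<mu> s) * ncoef \<mu> s =
      - ((M - 2) * ((1 + \<mu> * s\<^sup>2 / 2)\<^sup>2 / s\<^sup>2)) - N * coef \<mu> s - (1 / s - \<mu>\<^sup>2 * s ^ 3 / 4) / s" .
  \<comment> \<open>With \<open>i = 1/s\<close> and \<open>z = \<mu> s\<close> one has
    \<open>F = i - z/2\<close>, \<open>H = i + z/2\<close> and \<open>\<mu> = z i\<close>, so the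
    claim becomes a polynomial identity.\<close>
  define i z where "i = 1 / s" and "z = \<mu> * s"
  have "i * s = 1"
    using assms(1) by (simp add: i_def)
  then have "\<mu> = z * i"
    by (simp add: z_def mult.commute)
  moreover have "coef \<mu> s = (i - z / 2)\<^sup>2" "(1 + \<mu> * s\<^sup>2 / 2)\<^sup>2 / s\<^sup>2 = (i + z / 2)\<^sup>2"
    unfolding coef_def power_divide[symmetric]
    using assms(1) by (simp_all add: i_def z_def diff_divide_distrib add_divide_distrib power2_eq_square)
  moreover have "(1 / s - \<mu>\<^sup>2 * s ^ 3 / 4) / s = i\<^sup>2 - z\<^sup>2 / 4"
    using assms(1) by (simp add: i_def z_def diff_divide_distrib power2_eq_square power3_eq_cube)
  moreover have "1 / s\<^sup>2 = i\<^sup>2" "3 * \<mu>\<^sup>2 * s\<^sup>2 / 4 = 3 * z\<^sup>2 / 4"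
    by (simp_all add: i_def z_def power_divide power_mult_distrib)
  moreover have "2 * (M - 1) * (z * i) + (- i\<^sup>2 - 3 * z\<^sup>2 / 4 + (- ((M - 2) * (i + z / 2)\<^sup>2) - N * (i - z / 2)\<^sup>2 - (i\<^sup>2 - z\<^sup>2 / 4))) =
      - (M + N) * (i - z / 2)\<^sup>2"
    by (simp add: power2_eq_square field_simps)
  ultimately show ?thesis
    unfolding eq by (simp only:)
qed

lemma smooth_on_quadratic:
  assumes "S \<subseteq> Rn n"
  shows "smooth_on n S (\<lambda>x. (1 - \<mu> * (x i)\<^sup>2 / 2)\<^sup>2)"
proof -
  have "smooth_on n S (\<lambda>x. (1 + (- \<mu> / 2) * (x i)\<^sup>2)\<^sup>2)"
    using assms by (intro smooth_on_power smooth_on_add smooth_on_mult smooth_on_const smooth_on_coordinate)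
  then show ?thesis
    by simp
qed

lemma (in two_factors) atlas_warpedE:
  assumes "C \<in> atlas (warped_mfd A)" "P \<in> fst C"
  obtains c d p q s where "c \<in> atlas M1" "d \<in> atlas M2" "C = triple c d A" "P = (p, q, s)"
    "p \<in> fst c" "q \<in> fst d" "s \<in> A"
proof -
  obtain c d where "c \<in> atlas M1" "d \<in> atlas M2" "C = triple c d A"
    using assms(1) unfolding atlas_warped by blast
  moreover obtain p q s where "P = (p, q, s)"
    by (cases P)
  ultimately show ?thesis
    using that assms(2) by simp
qed

text \<open>The Ricci constants are the quotients \<open>Sc / m\<close> expressed through
  \<open>\<mu>\<close>. In this form the factors differ by the sign of \<open>\<mu>\<close> alone,
  and dimension 0 brings no division by zero.\<close>

locale poincare_product = two_factors +
  fixes \<mu> :: real and J :: "real set"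
  assumes J0: "0 \<in> J" and J_open: "openin (top_of_set {0..}) J"
    and nz1: "\<And>s. s \<in> J \<Longrightarrow> 1 - \<mu> * s\<^sup>2 / 2 \<noteq> 0"
    and nz2: "\<And>s. s \<in> J \<Longrightarrow> m2 \<noteq> 0 \<Longrightarrow> 1 + \<mu> * s\<^sup>2 / 2 \<noteq> 0"
    and ric1: "ricci_eq M1 g1 (2 * (real m1 - 1) * \<mu>)"
    and ric2: "ricci_eq M2 g2 (2 * (real m2 - 1) * (- \<mu>))"
begin

text \<open>If \<open>m2 = 0\<close> and \<open>\<mu> < 0\<close>, then \<open>1 + \<mu> s\<^sup>2 / 2\<close> has a zero in \<open>J\<close>. As \<open>g2\<close> has no components in this
  case, its coefficient can be replaced by a constant.\<close>

definition "bar_coef s = (if m2 = 0 then 1 else (1 - (- \<mu>) * s\<^sup>2 / 2)\<^sup>2)" for s :: real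

text \<open>The same replacement over the interior: for \<open>m2 = 0\<close> it sets
  \<open>h\<close> to 1 and \<open>v\<close>, \<open>\<psi>\<close> and their derivatives to 0,
  which meets the hypotheses of \<open>warped_metric\<close>.\<close>

definition "if_point x y = (if m2 = 0 then x else y)" for x y :: real

abbreviation "K \<equiv> J - {0}"

lemma J_nonneg: "s \<in> J \<Longrightarrow> 0 \<le> s"
  using openin_subset[OF J_open] by auto

lemma open_K: "open K"
proof -
  obtain T where T: "open T" "J = {0..} \<inter> T"
    using J_open by (auto simp: openin_open)
  have "K = {0<..} \<inter> T"
    unfolding T(2) by auto
  then show ?thesis
    by (simp only: open_Int open_greaterThan T(1))
qed

lemma perfect_J: "perfect J"
  by (rule perfect_half_line[OF J_open])

lemma perfect_K: "perfect K"
  unfolding perfect_def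
proof
  show "at s within K \<noteq> bot" if "s \<in> K" for s
    unfolding at_within_open[OF that open_K] by simp
qed

lemma warped_bar: "warped (\<lambda>s. (1 - \<mu> * s\<^sup>2 / 2)\<^sup>2) bar_coef (\<lambda>s. 1) J (gbar \<mu>)"
proof -
  have "warped_block (\<lambda>s. (1 - \<mu> * s\<^sup>2 / 2)\<^sup>2) (\<lambda>s. (1 + \<mu> * s\<^sup>2 / 2)\<^sup>2) (\<lambda>s. 1) c d p q s =
      warped_block (\<lambda>s. (1 - \<mu> * s\<^sup>2 / 2)\<^sup>2) bar_coef (\<lambda>s. 1) c d p q s" for c d p q s
    by (rule warped_block_cong) (simp_all add: bar_coef_def)
  then show ?thesis
    using warped_gbar[OF perfect_J, of \<mu>] unfolding warped_def by (simp only:)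
qed

lemma warped_plus:
  "warped (coef \<mu>) (\<lambda>s. if_point 1 (coef (- \<mu>) s)) (\<lambda>s. 1 / s\<^sup>2) K (g12 M1 g1 M2 g2 \<mu>)"
proof -
  have "warped_block (\<lambda>s. (1 - \<mu> * s\<^sup>2 / 2)\<^sup>2 / s\<^sup>2) (\<lambda>s. (1 + \<mu> * s\<^sup>2 / 2)\<^sup>2 / s\<^sup>2) (\<lambda>s. 1 / s\<^sup>2) c d p q s =
      warped_block (coef \<mu>) (\<lambda>s. if_point 1 (coef (- \<mu>) s)) (\<lambda>s. 1 / s\<^sup>2) c d p q s" for c d p q s
    by (rule warped_block_cong) (simp_all add: coef_def if_point_def)
  then show ?thesis
    using warped_g12[OF perfect_K, of \<mu>] unfolding warped_def by (simp only:)
qed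

lemma half_line_sub: "{x \<in> Rn 1. x 0 \<in> A} \<subseteq> Rn 1"
  by blast

lemma smooth_bar_coef: "smooth_fun (half_line_mfd A) bar_coef"
  unfolding bar_coef_def by (cases "m2 = 0"; simp only: simp_thms if_True if_False)
    (intro smooth_fun_half_line smooth_on_quadratic smooth_on_const half_line_sub)+

lemma smooth_inverse_sq: "smooth_on 1 {x \<in> Rn 1. x 0 \<in> K} (\<lambda>x. inverse ((x 0)\<^sup>2))"
  by (intro smooth_on_inverse smooth_on_power smooth_on_coordinate half_line_sub) auto

lemma smooth_coef: "smooth_on 1 {x \<in> Rn 1. x 0 \<in> K} (\<lambda>x. coef \<nu> (x 0))"
  unfolding coef_def divide_inverse[of "_\<^sup>2" "_\<^sup>2"]
  by (intro smooth_on_mult smooth_inverse_sq smooth_on_quadratic half_line_sub)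

lemma pseudo_metric_bar: "pseudo_metric (warped_mfd J) (gbar \<mu>)"
proof (rule warped_pseudo_metric[OF warped_bar perfect_J])
  show "smooth_fun (half_line_mfd J) (\<lambda>s. (1 - \<mu> * s\<^sup>2 / 2)\<^sup>2)" "smooth_fun (half_line_mfd J) (\<lambda>s. 1)"
    by (intro smooth_fun_half_line smooth_on_quadratic smooth_on_const half_line_sub)+
  show "bar_coef s \<noteq> 0" if "s \<in> J" for s
    using nz2[OF that] by (simp add: bar_coef_def)
qed (use nz1 smooth_bar_coef in auto)

lemma K_D: "s \<in> K \<Longrightarrow> s \<noteq> 0" "s \<in> K \<Longrightarrow> 1 - \<mu> * s\<^sup>2 / 2 \<noteq> 0" "s \<in> K \<Longrightarrow> m2 \<noteq> 0 \<Longrightarrow> 1 - (- \<mu>) * s\<^sup>2 / 2 \<noteq> 0"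
  using nz1 nz2 by auto

lemma coef_nonzero: "s \<in> K \<Longrightarrow> coef \<mu> s \<noteq> 0" "s \<in> K \<Longrightarrow> if_point 1 (coef (- \<mu>) s) \<noteq> 0"
  using K_D[of s] by (simp_all add: coef_def if_point_def)

lemma pseudo_metric_plus: "pseudo_metric (warped_mfd K) (g12 M1 g1 M2 g2 \<mu>)"
proof (rule warped_pseudo_metric[OF warped_plus perfect_K])
  show "smooth_fun (half_line_mfd K) (coef \<mu>)"
    by (intro smooth_fun_half_line smooth_coef)
  show "smooth_fun (half_line_mfd K) (\<lambda>s. if_point 1 (coef (- \<mu>) s))"
    unfolding if_point_def by (cases "m2 = 0"; simp only: simp_thms if_True if_False)
      (intro smooth_fun_half_line smooth_coef smooth_on_const half_line_sub)+
  show "smooth_fun (half_line_mfd K) (\<lambda>s. 1 / s\<^sup>2)"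
    using smooth_inverse_sq by (intro smooth_fun_half_line) (simp add: divide_inverse)
qed (use coef_nonzero in auto)

lemma defining: "defining_function (warped_mfd J) (\<lambda>(p, q, r). r)"
  unfolding defining_function_def
proof (intro conjI ballI)
  have rJ: "regular_atlas (half_line_mfd J)"
    using regular_hl_chart[OF perfect_J] by (simp add: regular_atlas_def)
  note r1 = regular_atlas_manifold[OF M1] and r2 = regular_atlas_manifold[OF M2]
  have "smooth_fun (half_line_mfd J) (\<lambda>s. s)"
    by (intro smooth_fun_half_line smooth_on_coordinate half_line_sub)
  then have "smooth_fun (prod_mfd M1 (prod_mfd M2 (half_line_mfd J))) (\<lambda>P. snd (snd P))"
    by (intro smooth_fun_snd r1 r2 rJ regular_atlas_prod_mfd)
  moreover have "(\<lambda>P. snd (snd P)) = (\<lambda>(p :: 'a, q :: 'b, r :: real). r)"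
    by auto
  ultimately show "smooth_fun (warped_mfd J) (\<lambda>(p, q, r). r)"
    by (simp only: warped_mfd_def)
next
  fix P assume "P \<in> topspace (mtop (warped_mfd J))"
  then show "0 \<le> (case P of (p, q, r) \<Rightarrow> r)" "((case P of (p, q, r) \<Rightarrow> r) = 0) = (P \<in> boundary_points (warped_mfd J))"
    unfolding topspace_warped boundary_points_warped[OF J0] using J_nonneg by auto
next
  fix C P assume CP: "C \<in> atlas (warped_mfd J)" "P \<in> fst C \<inter> boundary_points (warped_mfd J)"
  obtain c d p q s where "c \<in> atlas M1" "d \<in> atlas M2" "C = triple c d J" "P = (p, q, s)"
    "p \<in> fst c" "q \<in> fst d" "s \<in> J"
    by (rule atlas_warpedE[OF CP(1)]) (use CP(2) in auto)
  then show "\<exists>i<mdim (warped_mfd J). differential C (\<lambda>(p, q, r). r) i P \<noteq> 0"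
    using differential_triple[of c d p q J s "m1 + m2"] perfect_J
    by (intro exI[of _ "m1 + m2"]) simp
qed

text \<open>The instances are \<open>A = K\<close> for the interior and \<open>A = {0}\<close> for
  the boundary.\<close>

lemma pullback_bar:
  assumes "c \<in> atlas M1" "d \<in> atlas M2" "p \<in> fst c" "q \<in> fst d" "s \<in> A" "s \<in> J"
    and "regular_chart k (hl_chart A)" "k \<le> 1" "k = 1 \<Longrightarrow> perfect A"
    and "i < m1 + (m2 + k)" "j < m1 + (m2 + k)"
  shows "pullback (warped_mfd J) (\<lambda>P. P) (gbar \<mu>) (triple c d A) i j (p, q, s) =
    warped_block (\<lambda>s. (1 - \<mu> * s\<^sup>2 / 2)\<^sup>2) bar_coef (\<lambda>s. 1) c d p q s i j"
proof (rule pullback_eqI)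
  show "triple c d J \<in> atlas (warped_mfd J)" "(p, q, s) \<in> fst (triple c d J)"
    using assms by (auto simp: atlas_warped)
  fix C assume C: "C \<in> atlas (warped_mfd J)" "(p, q, s) \<in> fst C"
  then obtain c' d' where cd: "c' \<in> atlas M1" "d' \<in> atlas M2" "C = triple c' d' J"
    unfolding atlas_warped by blast
  have "p \<in> fst c'" "q \<in> fst d'"
    using C cd by simp_all
  with cd assms show "pull (mdim (warped_mfd J)) (triple c d A) C (\<lambda>P. P) (gbar \<mu>) i j (p, q, s) =
    warped_block (\<lambda>s. (1 - \<mu> * s\<^sup>2 / 2)\<^sup>2) bar_coef (\<lambda>s. 1) c d p q s i j"
    unfolding cd(3) mdim_warped by (intro pull_warped[OF warped_bar _ _ _ _ _ _ _ _ _ _ perfect_J])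
qed

lemma compactification_bar:
  "compactification (warped_mfd J) (g12 M1 g1 M2 g2 \<mu>) (\<lambda>(p, q, r). r) (gbar \<mu>)"
  unfolding compactification_def mfd_interior_warped[OF J0]
proof (intro conjI ballI allI impI defining pseudo_metric_bar)
  fix C P i j assume CP: "C \<in> atlas (warped_mfd K)" "P \<in> fst C" and ij: "i < mdim (warped_mfd J)" "j < mdim (warped_mfd J)"
  obtain c d p q s where C: "c \<in> atlas M1" "d \<in> atlas M2" "C = triple c d K" "P = (p, q, s)"
    "p \<in> fst c" "q \<in> fst d" "s \<in> K"
    by (rule atlas_warpedE[OF CP])
  have "s \<in> J" "s \<noteq> 0"
    using C by auto
  have ij': "i < m1 + (m2 + 1)" "j < m1 + (m2 + 1)"
    using ij by simp_all
  have "pullback (warped_mfd J) (\<lambda>q. q) (gbar \<mu>) C i j P =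
      warped_block (\<lambda>s. (1 - \<mu> * s\<^sup>2 / 2)\<^sup>2) bar_coef (\<lambda>s. 1) c d p q s i j"
    unfolding C(3,4)
    by (rule pullback_bar[OF C(1,2,5,6,7) \<open>s \<in> J\<close> regular_hl_chart[OF perfect_K] order_refl perfect_K ij'])
  also have "\<dots> = s\<^sup>2 * warped_block (coef \<mu>) (\<lambda>s. if_point 1 (coef (- \<mu>) s)) (\<lambda>s. 1 / s\<^sup>2) c d p q s i j"
    using \<open>s \<noteq> 0\<close> ij' by (auto simp: warped_block_def block_def bar_coef_def if_point_def coef_def)
  also have "\<dots> = s\<^sup>2 * g12 M1 g1 M2 g2 \<mu> C i j P"
    unfolding C(3,4) using warpedD[OF warped_plus C(1,2,5,6,7) ij'] by simp
  finally show "pullback (warped_mfd J) (\<lambda>q. q) (gbar \<mu>) C i j P = (case P of (p, q, r) \<Rightarrow> r)\<^sup>2 * g12 M1 g1 M2 g2 \<mu> C i j P"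
    by (simp add: C(4))
qed

lemma product_pseudo_metric: "pseudo_metric (prod_mfd M1 M2) (product_metric M1 g1 M2 g2)"
proof (rule pseudo_metric_prod[OF regular_atlas_manifold[OF M1] g1 regular_atlas_manifold[OF M2] g2])
  show "smooth_fun M2 (\<lambda>q. 1)"
    unfolding smooth_fun_def by (intro ballI smooth_on_const M2.image_subset)
qed (use product_metric_chart in auto)

text \<open>Two successive pullbacks, to the charts of the boundary and then along
  \<open>emb\<close>; each of them makes its own choice of a chart.\<close>

lemma boundary_pullback:
  assumes cd: "c \<in> atlas M1" "d \<in> atlas M2" and pq: "p \<in> fst c" "q \<in> fst d" and ij: "i < m1 + m2" "j < m1 + m2"
  shows "pullback boundary_mfd emb (pullback (warped_mfd J) (\<lambda>q. q) (gbar \<mu>)) (prod_chart m1 c d) i j (p, q) =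
    block m1 (\<lambda>i j. g1 c i j p) (\<lambda>i j. g2 d i j q) i j"
proof (rule pullback_eqI)
  show "triple c d {0} \<in> atlas boundary_mfd"
    using cd atlas_boundary by blast
  show "emb (p, q) \<in> fst (triple c d {0})"
    using pq by (simp add: emb_def)
  fix C assume C: "C \<in> atlas boundary_mfd" "emb (p, q) \<in> fst C"
  then obtain c' d' where cd': "c' \<in> atlas M1" "d' \<in> atlas M2" "C = triple c' d' {0}"
    unfolding atlas_boundary by blast
  have pq': "p \<in> fst c'" "q \<in> fst d'"
    using C cd' by (simp_all add: emb_def)
  \<comment> \<open>\<open>?h\<close> is \<open>g2\<close> seen on \<open>M2 x {0}\<close>. It
    ignores its chart argument and always takes components in \<open>d'\<close>, the chart of
    \<open>M2\<close> underlying \<open>?D\<close>.\<close>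
  let ?T = "pullback (warped_mfd J) (\<lambda>q. q) (gbar \<mu>)" and ?h = "\<lambda>(D :: ('b \<times> real) chart) i j Q. g2 d' i j (fst Q)"
  let ?D = "prod_chart m2 d' (hl_chart {0})"
  have emb: "emb = (\<lambda>Q. (fst Q, (snd Q, 0)))"
    by (auto simp: emb_def)
  have "pull (m1 + (m2 + 0)) (prod_chart m1 c d) C emb ?T i j (p, q) =
      block m1 (\<lambda>i j. 1 * pull m1 c c' (\<lambda>p. p) g1 i j p) (\<lambda>i j. pull (m2 + 0) d ?D (\<lambda>q. (q, 0)) ?h i j q) i j"
    unfolding cd'(3) triple_def emb
  proof (rule pull_prod[OF regular_M1[OF cd(1)] regular_M2[OF cd(2)] pq ij])
    fix k l assume kl: "k < m1 + (m2 + 0)" "l < m1 + (m2 + 0)"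
    have "?T (triple c' d' {0}) k l (p, q, 0) = warped_block (\<lambda>s. (1 - \<mu> * s\<^sup>2 / 2)\<^sup>2) bar_coef (\<lambda>s. 1) c' d' p q 0 k l"
      using J0 by (intro pullback_bar[OF cd'(1,2) pq' _ _ regular_hl_chart_0 _ _ kl]) simp_all
    \<comment> \<open>At \<open>r = 0\<close> both warping functions are 1, and the index of
      \<open>dr\<close> is out of range.\<close>
    also have "\<dots> = block m1 (\<lambda>k l. 1 * g1 c' k l p) (\<lambda>k l. g2 d' k l (fst (q, 0 :: real))) k l"
      using kl by (auto simp: warped_block_def block_def bar_coef_def)
    finally show "?T (prod_chart m1 c' ?D) k l (p, q, 0) =
        block m1 (\<lambda>k l. 1 * g1 c' k l p) (\<lambda>k l. g2 d' k l (fst (q, 0 :: real))) k l"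
      by (simp add: triple_def)
  qed
  also have "\<dots> = block m1 (\<lambda>i j. g1 c i j p) (\<lambda>i j. g2 d i j q) i j"
  proof -
    have "pull (m2 + 0) d ?D (\<lambda>q. (q, 0)) ?h a b q = pull m2 d d' (\<lambda>q. q) g2 a b q" for a b
      unfolding pull_def add_0_right by (intro sum.cong refl) (simp add: snd_prod_chart joinc_def)
    then show ?thesis
      using ij smooth_tensor2_pull[OF pseudo_metricD(1)[OF g1] cd(1) cd'(1) pq(1) pq'(1)]
        smooth_tensor2_pull[OF pseudo_metricD(1)[OF g2] cd(2) cd'(2) pq(2) pq'(2)]
      by (auto simp: block_def)
  qed
  finally show "pull (mdim boundary_mfd) (prod_chart m1 c d) C emb ?T i j (p, q) =
      block m1 (\<lambda>i j. g1 c i j p) (\<lambda>i j. g2 d i j q) i j"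
    by simp
qed

lemma conformal_infinity_product:
  "conformal_infinity (warped_mfd J) (g12 M1 g1 M2 g2 \<mu>) (prod_mfd M1 M2) (product_metric M1 g1 M2 g2) emb"
proof -
  let ?h = "pullback boundary_mfd emb (pullback (warped_mfd J) (\<lambda>q. q) (gbar \<mu>))"
  have eq: "product_metric M1 g1 M2 g2 C i j P = ?h C i j P"
    if CP: "C \<in> atlas (prod_mfd M1 M2)" "P \<in> fst C" "i < mdim (prod_mfd M1 M2)" "j < mdim (prod_mfd M1 M2)" for C P i j
  proof -
    obtain c d p q where C: "c \<in> atlas M1" "d \<in> atlas M2" "C = prod_chart m1 c d" "P = (p, q)"
      using CP(1) by (metis atlas_prod_mfd surj_pair)
    then have "p \<in> fst c" "q \<in> fst d"
      using CP(2) by simp_all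
    then show ?thesis
      using CP(3,4) C by (simp add: product_metric_chart boundary_pullback)
  qed
  have "?h \<in> conformal_class (prod_mfd M1 M2) (product_metric M1 g1 M2 g2)"
    unfolding conformal_class_def
  \<comment> \<open>The induced metric is the product metric itself, so the conformal factor is
    1.\<close>
  proof (intro CollectI conjI exI[of _ "\<lambda>P. 1"])
    show "pseudo_metric (prod_mfd M1 M2) ?h"
      by (rule pseudo_metric_cong[OF product_pseudo_metric eq])
    have "regular_atlas (prod_mfd M1 M2)"
      by (intro regular_atlas_prod_mfd regular_atlas_manifold M1 M2)
    then show "smooth_fun (prod_mfd M1 M2) (\<lambda>P. 1)"
      unfolding smooth_fun_def regular_atlas_def by (intro ballI smooth_on_const regular_chartD(2)) blast
  qed (simp_all add: eq)
  then show ?thesis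
    unfolding conformal_infinity_def mfd_boundary_warped[OF J0]
    using diffeo_boundary compactification_bar by blast
qed

text \<open>In a product chart the components form an instance of the coordinate model
  \<open>warped_metric\<close>, and the equation is compared block by block.\<close>

lemma ricci_g12: "ricci_eq (warped_mfd K) (g12 M1 g1 M2 g2 \<mu>) (- real (m1 + m2))"
  unfolding ricci_eq_def
proof (intro ballI allI impI)
  fix C P i j assume CP: "C \<in> atlas (warped_mfd K)" "P \<in> fst C" and ij: "i < mdim (warped_mfd K)" "j < mdim (warped_mfd K)"
  obtain c d p q s where C: "c \<in> atlas M1" "d \<in> atlas M2" "C = triple c d K" "P = (p, q, s)"
    and pq: "p \<in> fst c" "q \<in> fst d" and s: "s \<in> K"
    by (rule atlas_warpedE[OF CP])
  have ij': "i < m1 + (m2 + 1)" "j < m1 + (m2 + 1)"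
    using ij by simp_all
  let ?S1 = "snd c ` fst c" and ?S2 = "snd d ` fst d"
  let ?A = "\<lambda>a b x. g1 c a b (chart_inv c x)" and ?B = "\<lambda>a b x. g2 d a b (chart_inv d x)"
  have S1: "openin (Euclidean_space m1) ?S1" and S2: "openin (Euclidean_space m2) ?S2"
    using M1.open_image[OF C(1)] M2.open_image[OF C(2)] by simp_all
  \<comment> \<open>The functions come in the order \<open>f\<close>, \<open>h\<close>,
    \<open>e\<close>, then \<open>u\<close>, \<open>v\<close>, \<open>w\<close>,
    \<open>\<phi>\<close>, \<open>\<psi>\<close>, then four derivatives. The entry
    \<open>- 1/s\<close> is half the logarithmic derivative of \<open>1/s^2\<close>.\<close>
  interpret W: warped_metric m1 m2 ?S1 ?S2 K ?A ?B "coef \<mu>" "\<lambda>s. if_point 1 (coef (- \<mu>) s)" "\<lambda>s. 1 / s\<^sup>2"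
    "dcoef \<mu>" "\<lambda>s. if_point 0 (dcoef (- \<mu>) s)" "\<lambda>s. - (1 / s)" "ncoef \<mu>" "\<lambda>s. if_point 0 (ncoef (- \<mu>) s)"
    "\<lambda>s. 1 / s\<^sup>2 - (dcoef \<mu> s)\<^sup>2 - dcoef \<mu> s / s"
    "\<lambda>s. if_point 0 (1 / s\<^sup>2 - (dcoef (- \<mu>) s)\<^sup>2 - dcoef (- \<mu>) s / s)"
    "\<lambda>s. - (1 / s\<^sup>2) - 3 * \<mu>\<^sup>2 * s\<^sup>2 / 4" "\<lambda>s. if_point 0 (- (1 / s\<^sup>2) - 3 * (- \<mu>)\<^sup>2 * s\<^sup>2 / 4)"
  proof
    fix x assume "x \<in> ?S1"
    then show "symm_matrix m1 (\<lambda>i j. ?A i j x)" "nondegenerate m1 (\<lambda>i j. ?A i j x)"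
      using pseudo_metricD(2,3)[OF g1 C(1) chart_inv_in] by blast+
  next
    fix x assume "x \<in> ?S2"
    then show "symm_matrix m2 (\<lambda>i j. ?B i j x)" "nondegenerate m2 (\<lambda>i j. ?B i j x)"
      using pseudo_metricD(2,3)[OF g2 C(2) chart_inv_in] by blast+
  next
    fix x i a b assume "x \<in> ?S1" "i < m1" "a < m1" "b < m1"
    then show "((\<lambda>t. ?A a b (x(i := t))) has_real_derivative pd ?S1 i (?A a b) x) (at (x i))"
      by (intro smooth_on_has_derivative[OF S1 smooth_tensor2D] pseudo_metricD[OF g1] C)
  next
    fix x i a b assume "x \<in> ?S2" "i < m2" "a < m2" "b < m2"
    then show "((\<lambda>t. ?B a b (x(i := t))) has_real_derivative pd ?S2 i (?B a b) x) (at (x i))"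
      by (intro smooth_on_has_derivative[OF S2 smooth_tensor2D] pseudo_metricD[OF g2] C)
  next
    fix s assume s: "s \<in> K"
    note D = K_D[OF s]
    show "(coef \<mu> has_real_derivative 2 * dcoef \<mu> s * coef \<mu> s) (at s)"
      by (rule coef_deriv[OF D(1,2)])
    show "((\<lambda>s. if_point 1 (coef (- \<mu>) s)) has_real_derivative 2 * if_point 0 (dcoef (- \<mu>) s) * if_point 1 (coef (- \<mu>) s)) (at s)"
      using coef_deriv[OF D(1) D(3)] by (simp add: if_point_def)
    show "((\<lambda>s. 1 / s\<^sup>2) has_real_derivative 2 * - (1 / s) * (1 / s\<^sup>2)) (at s)"
      using D(1) by (auto intro!: derivative_eq_intros simp: field_simps power2_eq_square)
    show "ncoef \<mu> s * (1 / s\<^sup>2) = - (dcoef \<mu> s * coef \<mu> s)"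
      by (rule coef_relation[OF D(1,2)])
    show "if_point 0 (ncoef (- \<mu>) s) * (1 / s\<^sup>2) = - (if_point 0 (dcoef (- \<mu>) s) * if_point 1 (coef (- \<mu>) s))"
      using coef_relation[OF D(1) D(3)] by (simp add: if_point_def)
    show "(dcoef \<mu> has_real_derivative 1 / s\<^sup>2 - (dcoef \<mu> s)\<^sup>2 - dcoef \<mu> s / s) (at s)"
      by (rule dcoef_deriv[OF D(1,2)])
    show "((\<lambda>s. if_point 0 (dcoef (- \<mu>) s)) has_real_derivative
        if_point 0 (1 / s\<^sup>2 - (dcoef (- \<mu>) s)\<^sup>2 - dcoef (- \<mu>) s / s)) (at s)"
      using dcoef_deriv[OF D(1) D(3)] by (simp add: if_point_def)
    show "(ncoef \<mu> has_real_derivative - (1 / s\<^sup>2) - 3 * \<mu>\<^sup>2 * s\<^sup>2 / 4) (at s)"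
      by (rule ncoef_deriv[OF D(1)])
    show "((\<lambda>s. if_point 0 (ncoef (- \<mu>) s)) has_real_derivative if_point 0 (- (1 / s\<^sup>2) - 3 * (- \<mu>)\<^sup>2 * s\<^sup>2 / 4)) (at s)"
      using ncoef_deriv[OF D(1), of "- \<mu>"] by (simp add: if_point_def)
  qed (use S1 S2 open_K coef_nonzero in auto)
  let ?I = "snd C ` fst C"
  \<comment> \<open>\<open>ricci_coord\<close> depends on the coordinate domain through
    \<open>pd\<close>, so the image of the chart has to be exactly \<open>W.S\<close>.\<close>
  have I: "?I = W.S"
  proof -
    note im1 = prod_chart_image[OF M1.image_subset[OF C(1)]] and im2 = prod_chart_image[OF M2.image_subset[OF C(2)]]
    have "?I = {x. headc m1 x \<in> ?S1 \<and> headc m2 (tailc m1 x) \<in> ?S2 \<and> tailc m2 (tailc m1 x) \<in> snd (hl_chart K) ` K}"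
      unfolding C(3) triple_def fst_prod_chart hl_chart_simps(1) im1 im2 by simp
    also have "\<dots> = W.S"
    proof -
      have "tailc m2 (tailc m1 x) \<in> Rn 1 \<longleftrightarrow> x \<in> Rn (m1 + (m2 + 1))" for x
      proof
        assume *: "tailc m2 (tailc m1 x) \<in> Rn 1"
        have "x i = 0" if "i \<ge> m1 + (m2 + 1)" for i
          using *[unfolded tailc_def mem_Collect_eq, rule_format, of "i - (m1 + m2)"] that by (simp add: add.commute)
        then show "x \<in> Rn (m1 + (m2 + 1))"
          by simp
      qed (simp add: tailc_def)
      then show ?thesis
        unfolding W.S_def W.p1_def W.p2_def hl_chart_image
        by (auto simp: tailc_def add.commute)
    qed
    finally show ?thesis .
  qed
  have P: "snd C P \<in> W.S"
    using I C pq s by auto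
  have G: "g12 M1 g1 M2 g2 \<mu> C a b (chart_inv C x) = W.G a b x" if x: "x \<in> W.S" and ab: "a < m1 + (m2 + 1)" "b < m1 + (m2 + 1)" for a b x
  proof -
    note rc = regular_chartD(1,2)[OF regular_M1[OF C(1)]] and rd = regular_chartD(1,2)[OF regular_M2[OF C(2)]]
    let ?D = "prod_chart m2 d (hl_chart K)"
    have rD: "inj_on (snd ?D) (fst ?D)"
      by (rule regular_chartD(1)[OF regular_inner[OF C(2) perfect_K]])
    have x': "x \<in> snd (prod_chart m1 c ?D) ` fst (prod_chart m1 c ?D)"
      using x I unfolding C(3) triple_def by blast
    then have t: "tailc m1 x \<in> snd ?D ` fst ?D"
      using prod_chart_image[OF rc(2), of ?D "fst ?D"] by auto
    then have t2: "tailc m2 (tailc m1 x) \<in> snd (hl_chart K) ` K"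
      using prod_chart_image[OF rd(2), of "hl_chart K" K] by auto
    have "chart_inv (hl_chart K) (tailc m2 (tailc m1 x)) = x (m1 + m2)"
      using t2 chart_inv_hl_chart[of "tailc m2 (tailc m1 x)" K] unfolding hl_chart_image
      by (simp add: tailc_def add.commute)
    then have inv: "chart_inv C x = (chart_inv c (W.p1 x), chart_inv d (W.p2 x), x (m1 + m2))"
      unfolding C(3) triple_def chart_inv_prod_chart[OF rc rD x']
      unfolding chart_inv_prod_chart[OF rd inj_hl_chart t] by (simp add: W.p1_def W.p2_def)
    have "chart_inv c (W.p1 x) \<in> fst c" "chart_inv d (W.p2 x) \<in> fst d" "x (m1 + m2) \<in> K"
      using chart_inv_in[OF W.S_D(1)[OF x]] chart_inv_in[OF W.S_D(2)[OF x]] W.S_D(3)[OF x] .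
    from warpedD[OF warped_plus C(1,2) this ab] show ?thesis
      unfolding inv unfolding C(3) by (simp add: W.G_def warped_block_def)
  qed
  have x: "W.p1 (snd C P) = snd c p" "W.p2 (snd C P) = snd d q" "snd C P (m1 + m2) = s"
    using regular_chartD(3)[OF regular_M1[OF C(1)] pq(1)] regular_chartD(3)[OF regular_M2[OF C(2)] pq(2)]
    by (simp_all add: C(3,4) W.p1_def W.p2_def triple_def head_prod_chart) (simp add: snd_prod_chart joinc_def)
  have i1: "chart_inv c (snd c p) = p" "chart_inv d (snd d q) = q"
    using pq M1.inj[OF C(1)] M2.inj[OF C(2)] by simp_all
  have R1: "ricci_coord m1 ?S1 ?A a b (snd c p) = 2 * (real m1 - 1) * \<mu> * g1 c a b p" if "a < m1" "b < m1" for a b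
    using ric1 C(1) pq(1) that by (simp add: ricci_eq_def ricci_def)
  have R2: "ricci_coord m2 ?S2 ?B a b (snd d q) = 2 * (real m2 - 1) * (- \<mu>) * g2 d a b q" if "a < m2" "b < m2" for a b
    using ric2 C(2) pq(2) that by (simp add: ricci_eq_def ricci_def)
  note D = K_D[OF s]
  let ?t = "real m1 * dcoef \<mu> s + real m2 * if_point 0 (dcoef (- \<mu>) s) + - (1 / s)"
  have "ricci (warped_mfd K) (g12 M1 g1 M2 g2 \<mu>) C i j P = ricci_coord (m1 + (m2 + 1)) W.S W.G i j (snd C P)"
    unfolding ricci_def mdim_warped I by (rule ricci_coord_cong[OF G P ij'])
  note ric = trans[OF this W.ricci_coord_G[OF P, THEN spec, THEN mp, OF ij'(1), THEN spec, THEN mp, OF ij'(2)], unfolded x i1]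
  have c1: "2 * (real m1 - 1) * \<mu> + (- (1 / s\<^sup>2) - 3 * \<mu>\<^sup>2 * s\<^sup>2 / 4 + (?t - 2 * dcoef \<mu> s) * ncoef \<mu> s) =
      - (real m1 + real m2) * coef \<mu> s"
  proof (rule einstein_coefficient[OF D(1,2)])
    \<comment> \<open>Since \<open>ncoef\<close> is even in \<open>\<mu>\<close>,
      \<open>dcoef_ncoef\<close> for \<open>- \<mu>\<close> gives
      \<open>(H' / H) s F H = - F^2\<close>.\<close>
    show "real m2 * (if_point 0 (dcoef (- \<mu>) s) * ncoef \<mu> s) = - (real m2 * coef \<mu> s)"
      using dcoef_ncoef[OF D(1) D(3)] by (cases "m2 = 0") (simp_all add: if_point_def coef_def ncoef_def)
  qed
  have c2: "2 * (real m2 - 1) * (- \<mu>) + (- (1 / s\<^sup>2) - 3 * (- \<mu>)\<^sup>2 * s\<^sup>2 / 4 + (?t - 2 * dcoef (- \<mu>) s) * ncoef (- \<mu>) s) =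
      - (real m1 + real m2) * coef (- \<mu>) s" if "m2 \<noteq> 0"
  proof -
    have "real m1 * (dcoef \<mu> s * ncoef (- \<mu>) s) = - (real m1 * coef (- \<mu>) s)"
      using dcoef_ncoef[OF D(1) D(2)] by (simp add: coef_def ncoef_def)
    from einstein_coefficient[OF D(1) D(3)[OF that] this, of "real m2"] show ?thesis
      using that by (simp add: if_point_def add.commute add.left_commute)
  qed
  have g: "g12 M1 g1 M2 g2 \<mu> C i j P = warped_block (coef \<mu>) (\<lambda>s. if_point 1 (coef (- \<mu>) s)) (\<lambda>s. 1 / s\<^sup>2) c d p q s i j"
    unfolding C(3,4) by (rule warpedD[OF warped_plus C(1,2) pq s ij'])
  show "ricci (warped_mfd K) (g12 M1 g1 M2 g2 \<mu>) C i j P = - real (m1 + m2) * g12 M1 g1 M2 g2 \<mu> C i j P"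
  proof -
    consider (1) "i < m1" "j < m1"
      | (2) a b where "a < m2" "b < m2" "i = m1 + a" "j = m1 + b"
      | (r) "i = m1 + m2" "j = m1 + m2"
      | (0) "\<not> (i < m1 \<and> j < m1)" "\<not> (m1 \<le> i \<and> i < m1 + m2 \<and> m1 \<le> j \<and> j < m1 + m2)" "\<not> (i = m1 + m2 \<and> j = m1 + m2)"
    proof (cases "m1 \<le> i \<and> i < m1 + m2 \<and> m1 \<le> j \<and> j < m1 + m2")
      case True
      then show ?thesis
        using that(2)[of "i - m1" "j - m1"] by auto
    qed (use that in blast)
    then show ?thesis
    proof cases
      case 1
      have "ricci (warped_mfd K) (g12 M1 g1 M2 g2 \<mu>) C i j P =
        (2 * (real m1 - 1) * \<mu> + (- (1 / s\<^sup>2) - 3 * \<mu>\<^sup>2 * s\<^sup>2 / 4 + (?t - 2 * dcoef \<mu> s) * ncoef \<mu> s)) * g1 c i j p"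
        unfolding ric using 1 by (simp only: block_simps R1 distrib_right)
      then show ?thesis
        unfolding c1 g using 1 by (simp add: warped_block_def)
    next
      case 2
      then have m: "m2 \<noteq> 0"
        by auto
      have "ricci (warped_mfd K) (g12 M1 g1 M2 g2 \<mu>) C i j P =
        (2 * (real m2 - 1) * (- \<mu>) + (- (1 / s\<^sup>2) - 3 * (- \<mu>)\<^sup>2 * s\<^sup>2 / 4 + (?t - 2 * dcoef (- \<mu>) s) * ncoef (- \<mu>) s)) * g2 d a b q"
        unfolding ric using 2 m by (simp only: block_simps R2 distrib_right if_point_def if_False)
      then show ?thesis
        unfolding c2[OF m] g using 2 m by (simp add: warped_block_def if_point_def)
    next
      case r
      \<comment> \<open>By the Riccati equation and \<open>w = - 1/s\<close>, the expression
        \<open>u' + u^2 - u w\<close> is \<open>1/s^2\<close>, and likewise for \<open>v\<close> if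
        \<open>m2\<close> is positive.\<close>
      show ?thesis
        unfolding ric g unfolding r
        by (simp add: warped_block_def block_def if_point_def ring_distribs diff_divide_distrib)
    next
      case 0
      have "block m1 Y (block m2 Z X) i j = 0" for Y Z X
        using 0 ij' by (auto simp: block_def)
      then show ?thesis
        unfolding ric g warped_block_def by simp
    qed
  qed
qed

lemma poincare_einstein_product:
  "poincare_einstein (warped_mfd J) (g12 M1 g1 M2 g2 \<mu>)"
  unfolding poincare_einstein_def conformally_compact_def mfd_interior_warped[OF J0]
  using warped_mfd_with_boundary[OF J_open] pseudo_metric_plus compactification_bar ricci_g12
  by (auto simp: add.commute)

end

text \<open>In dimension 1 antisymmetry leaves no curvature, in dimension 0 the sum is empty; a
  point is taken to read off \<open>Sc\<close>. This makes \<open>2 m (m - 1) \<mu> = Sc\<close>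
  solvable in the degenerate dimensions.\<close>

lemma einstein_dim_le_1:
  assumes "einstein M g Sc" "topspace (mtop M) \<noteq> {}" "mdim M \<le> 1"
  shows "Sc = 0"
proof -
  interpret manifold_on "topspace (Euclidean_space (mdim M))" M
    using assms(1) by unfold_locales (simp add: einstein_def manifold_def)
  obtain c p where "c \<in> atlas M" "p \<in> fst c"
    using assms(2) chart_at by blast
  then have "scalar_curvature M g c p = Sc"
    using assms(1) by (simp add: einstein_def)
  moreover have "ricci M g c 0 0 p = 0" if "mdim M = 1"
    using that by (simp add: ricci_def ricci_coord_def riemann_def)
  moreover have "mdim M = 0 \<or> mdim M = 1"
    using assms(3) by linarith
  ultimately show ?thesis
    by (auto simp: scalar_curvature_def)
qed

text \<open>Division by the dimension turns the normalisation of \<open>\<mu>\<close> into a Ricci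
  constant, and in dimension 0 there are no components. The second factor uses it with
  \<open>- \<mu>\<close>.\<close>

lemma einstein_ricci_eq:
  assumes "einstein M g Sc" "2 * real (mdim M) * (real (mdim M) - 1) * \<mu> = Sc"
  shows "ricci_eq M g (2 * (real (mdim M) - 1) * \<mu>)"
proof (cases "mdim M = 0")
  case False
  then have "Sc / real (mdim M) = 2 * (real (mdim M) - 1) * \<mu>"
    unfolding assms(2)[symmetric] by simp
  then show ?thesis
    using assms(1) by (simp add: einstein_def)
qed (simp add: ricci_eq_def)

text \<open>For \<open>s >= 0\<close> the function \<open>1 - \<nu> s^2 / 2\<close> vanishes at most
  at \<open>sqrt (2 / \<nu>)\<close>, and only if \<open>\<nu> > 0\<close>. So at most one of the
  two coefficients has a zero, at \<open>sqrt (2 / |\<mu>|)\<close>.\<close>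

lemma interval_I_properties:
  fixes \<mu> :: real and m :: nat
  defines "J \<equiv> interval_I m \<mu>"
  shows "0 \<in> J" "openin (top_of_set {0..}) J"
    and "s \<in> J \<Longrightarrow> 1 - \<mu> * s\<^sup>2 / 2 \<noteq> 0"
    and "s \<in> J \<Longrightarrow> m \<noteq> 0 \<Longrightarrow> 1 + \<mu> * s\<^sup>2 / 2 \<noteq> 0"
proof -
  show "0 \<in> J"
    by (simp add: J_def interval_I_def)
  have "openin (top_of_set {0..}) ({0..} - {a})" for a :: real
    unfolding openin_open by (intro exI[of _ "- {a}"]) auto
  then show "openin (top_of_set {0..}) J"
    by (simp add: J_def interval_I_def)
  have root: "s = sqrt (2 / \<nu>) \<and> 0 < \<nu>" if "1 - \<nu> * s\<^sup>2 / 2 = 0" "0 \<le> s" for \<nu> :: real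
  proof -
    have eq: "\<nu> * s\<^sup>2 = 2"
      using that(1) by simp
    then have "0 < \<nu> * s\<^sup>2"
      by simp
    then have pos: "0 < \<nu>"
      by (simp add: zero_less_mult_iff)
    then have "2 / \<nu> = s\<^sup>2"
      using eq by (simp add: field_simps)
    then show ?thesis
      using that(2) pos by simp
  qed
  show "1 - \<mu> * s\<^sup>2 / 2 \<noteq> 0" if "s \<in> J"
    using that root[of \<mu>] by (auto simp: J_def interval_I_def split: if_splits)
  show "1 + \<mu> * s\<^sup>2 / 2 \<noteq> 0" if "s \<in> J" "m \<noteq> 0"
    using that root[of "- \<mu>"] by (auto simp: J_def interval_I_def split: if_splits)
qed

theorem theorem4p1:
  fixes M1 :: "'a atlas_space" and g1 :: "'a tensor2"
    and M2 :: "'b atlas_space" and g2 :: "'b tensor2"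
    and m1 m2 :: nat and Sc1 Sc2 :: real
  assumes "mdim M1 = m1" and "mdim M2 = m2" and "m1 \<ge> 1"
    and "topspace (mtop M1) \<noteq> {}" and "topspace (mtop M2) \<noteq> {}"
    and "m2 = 0 \<Longrightarrow> \<exists>q. topspace (mtop M2) = {q}"
    and "einstein M1 g1 Sc1" and "einstein M2 g2 Sc2"
    and "real m2 * (real m2 - 1) * Sc1 = - (real m1 * (real m1 - 1) * Sc2)"
  shows
    "(\<exists>(N :: ('a \<times> 'b \<times> real) atlas_space) g F.
        mdim N = m1 + m2 + 1 \<and>
        poincare_einstein N g \<and>
        ricci_eq (mfd_interior N) g (- real (m1 + m2)) \<and>
        conformal_infinity N g (prod_mfd M1 M2) (product_metric M1 g1 M2 g2) F)
     \<and> (\<exists>\<mu>. 2 * real m1 * (real m1 - 1) * \<mu> = Sc1 \<and> 2 * real m2 * (real m2 - 1) * \<mu> = - Sc2)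
     \<and> (\<forall>\<mu>. 2 * real m1 * (real m1 - 1) * \<mu> = Sc1 \<and> 2 * real m2 * (real m2 - 1) * \<mu> = - Sc2 \<longrightarrow>
          poincare_einstein (M12 M1 M2 \<mu>) (g12 M1 g1 M2 g2 \<mu>) \<and>
          ricci_eq (mfd_interior (M12 M1 M2 \<mu>)) (g12 M1 g1 M2 g2 \<mu>) (- real (m1 + m2)) \<and>
          conformal_infinity (M12 M1 M2 \<mu>) (g12 M1 g1 M2 g2 \<mu>)
            (prod_mfd M1 M2) (product_metric M1 g1 M2 g2) (\<lambda>(p, q). (p, q, 0)))"
proof -
  have explicit: "poincare_einstein (M12 M1 M2 \<mu>) (g12 M1 g1 M2 g2 \<mu>) \<and>
      ricci_eq (mfd_interior (M12 M1 M2 \<mu>)) (g12 M1 g1 M2 g2 \<mu>) (- real (m1 + m2)) \<and>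
      conformal_infinity (M12 M1 M2 \<mu>) (g12 M1 g1 M2 g2 \<mu>)
        (prod_mfd M1 M2) (product_metric M1 g1 M2 g2) (\<lambda>(p, q). (p, q, 0))"
    if \<mu>: "2 * real m1 * (real m1 - 1) * \<mu> = Sc1" "2 * real m2 * (real m2 - 1) * \<mu> = - Sc2" for \<mu>
  proof -
    interpret two_factors M1 g1 M2 g2
      using assms(7,8) by unfold_locales (simp_all add: einstein_def)
    have 1: "ricci_eq M1 g1 (2 * (real (mdim M1) - 1) * \<mu>)"
      using assms(1,7) \<mu>(1) by (intro einstein_ricci_eq) simp_all
    have 2: "ricci_eq M2 g2 (2 * (real (mdim M2) - 1) * (- \<mu>))"
      using assms(2,8) \<mu>(2) by (intro einstein_ricci_eq) simp_all
    interpret poincare_product M1 g1 M2 g2 \<mu> "interval_I (mdim M2) \<mu>"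
      by unfold_locales (fact interval_I_properties 1 2 | erule (1) interval_I_properties | erule interval_I_properties)+
    have "M12 M1 M2 \<mu> = warped_mfd (interval_I (mdim M2) \<mu>)"
      by (simp add: M12_def warped_mfd_def)
    then show ?thesis
      using poincare_einstein_product ricci_g12 conformal_infinity_product mfd_interior_warped[OF J0] assms(1,2)
      by (simp add: emb_def)
  qed
  \<comment> \<open>If \<open>m1 > 1\<close>, the first equation determines \<open>\<mu>\<close> and
    the hypothesis on the scalar curvatures gives the second. If \<open>m1 = 1\<close>, the first
    holds for every \<open>\<mu>\<close> because \<open>Sc1 = 0\<close>, and \<open>\<mu>\<close> is
    read off from the second, or set to 0 if that one is degenerate too.\<close>
  have ex: "\<exists>\<mu>. 2 * real m1 * (real m1 - 1) * \<mu> = Sc1 \<and> 2 * real m2 * (real m2 - 1) * \<mu> = - Sc2"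
  proof (cases "m1 = 1")
    case False
    then have nz: "real m1 * (real m1 - 1) \<noteq> 0"
      using assms(3) by simp
    let ?\<mu> = "Sc1 / (2 * (real m1 * (real m1 - 1)))"
    have "2 * real m1 * (real m1 - 1) * ?\<mu> = Sc1"
      using nz by simp
    moreover have "2 * real m2 * (real m2 - 1) * ?\<mu> = real m2 * (real m2 - 1) * Sc1 / (real m1 * (real m1 - 1))"
      by simp
    moreover have "\<dots> = - Sc2"
      unfolding assms(9) using nz by simp
    ultimately show ?thesis
      by metis
  next
    case True
    then have Sc1: "Sc1 = 0"
      using einstein_dim_le_1[OF assms(7,4)] assms(1) by simp
    show ?thesis
    proof (cases "m2 \<le> 1")
      case True
      then have "Sc2 = 0"
        using einstein_dim_le_1[OF assms(8,5)] assms(2) by simp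
      then show ?thesis
        using Sc1 by (intro exI[of _ 0]) simp
    next
      case False
      then have "real m2 * (real m2 - 1) \<noteq> 0"
        by simp
      then show ?thesis
        using Sc1 \<open>m1 = 1\<close> by (intro exI[of _ "- Sc2 / (2 * (real m2 * (real m2 - 1)))"]) simp
    qed
  qed
  \<comment> \<open>The explicit structure for any such \<open>\<mu>\<close> is the witness for the
    existence claim.\<close>
  then obtain \<mu> where \<mu>: "2 * real m1 * (real m1 - 1) * \<mu> = Sc1" "2 * real m2 * (real m2 - 1) * \<mu> = - Sc2"
    by blast
  have "mdim (M12 M1 M2 \<mu>) = m1 + m2 + 1"
    using assms(1,2) by (simp add: M12_def)
  then show ?thesis
    using explicit[OF \<mu>] explicit ex by blast
qed

end
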